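(* Let $d\ge 1$, let $\mu,\nu,\sigma\ge 0$ satisfy $1>5\mu+6\sigma+2\nu$, and set $\rho=\sigma+\nu+\mu$. For $\hbar\in(0,1]$ let $\phi_\hbar,u_\hbar:\mathbb{R}^d\to\mathbb{C}$ be $C^\infty$ functions such that, with constants independent of $\hbar$ and $x$: (i) $\frac{\partial\phi_\hbar}{\partial x}(0)=0$, $\operatorname{Im}\phi_\hbar(x)\ge 0$ on $\operatorname{supp}(u_\hbar)$, and $\operatorname{Im}\phi_\hbar(0)=0$; (ii) $|\partial_x^\alpha\phi_\hbar(x)|\lesssim_\alpha \hbar^{-\mu-\nu(|\alpha|-2)}$ for all multi-indices with $|\alpha|\ge 2$, and the Hessian $\frac{\partial^2\phi_\hbar}{\partial x^2}(0)$ is invertible with $\big\|\big(\frac{\partial^2\phi_\hbar}{\partial x^2}(0)\big)^{-1}\big\|\lesssim\hbar^{-\sigma}$; (iii) $|\partial_x^\alpha u_\hbar(x)|\lesssim_\alpha\hbar^{-\rho|\alpha|}$ for all multi-indices $\alpha$, and $\operatorname{supp}(u_\hbar)\subset\{x:|x|\le\varepsilon\hbar^\rho\}$, where $\varepsilon>0$ is sufficiently small (i.e. $0<\varepsilon\le\varepsilon_0$ for some $\varepsilon_0>0$ depending only on $d$ and the implicit constants in (ii)). Let $I_\hbar=\int_{\mathbb{R}^d}e^{\frac{i}{\hbar}\phi_\hbar(x)}u_\hbar(x)\,dx$. Then for each integer $N\ge1$, $$\left|I_\hbar-(2\pi\hbar)^{\frac d2}\frac{e^{\frac i\hbar\phi_\hbar(0)}}{\det^{1/2}\left(\frac1i\frac{\partial^2\phi_\hbar}{\partial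 x^2}(0)\right)}\sum_{j=0}^{N-1}\hbar^j\,\big(\mathscr{L}_{j,\hbar}u_\hbar\big)(0)\right|\lesssim_N\left|\det{}^{-1/2}\left(\tfrac1i\tfrac{\partial^2\phi_\hbar}{\partial x^2}(0)\right)\right|\hbar^{(1-\sigma-2\rho)N+\frac d2},$$ where $\mathscr{L}_{j,\hbar}$ are the differential operators $$\mathscr{L}_{j,\hbar}f:=\sum_{\ell-m=j}\ \sum_{2\ell\ge3m}\frac{i^{-j}2^{-\ell}}{\ell!\,m!}\Big\langle\Big(\tfrac{\partial^2\phi_\hbar}{\partial x^2}(0)\Big)^{-1}D_x,D_x\Big\rangle^{\ell}\big(g_\hbar^mf\big),$$ $$g_\hbar(x):=\phi_\hbar(x)-\phi_\hbar(0)-\frac12\Big(\frac{\partial^2\phi_\hbar}{\partial x^2}(0)\Big)x\cdot x .$$ For each $N$, the implicit constant in this estimate depends (besides $d,N,\mu,\nu,\sigma$) only on finitely many of the implicit constants in (ii) and (iii). Moreover, for each $j\geq 0$, $|(\mathscr{L}_{j,\hbar}u_\hbar)(0)|\lesssim_j\hbar^{-j(\sigma+2\rho)}$.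
   Context: $A\lesssim B$ means $A\le CB$ with a constant $C$ independent of $\hbar$; subscripts on $\lesssim$ indicate further quantities on which $C$ may depend. $D_{x_j}=\frac1i\partial_{x_j}$, and for a symmetric matrix $M=(M_{kl})$, $\langle MD_x,D_x\rangle=\sum_{k,l}M_{kl}D_{x_k}D_{x_l}$. The sum defining $\mathscr{L}_{j,\hbar}$ runs over integers $\ell,m\ge0$ with $\ell-m=j$ and $2\ell\ge3m$. The branch $E\mapsto\det^{1/2}E$ is the continuous branch of the square root of the determinant on the nondegenerate matrices in the closure of the set of complex symmetric matrices with positive definite real part, normalized by $\det^{1/2}E>0$ when $E$ is real positive definite. *)

theory Defs
  imports "HOL-Analysis.Analysis"
begin

section \<open>Partial derivatives\<close>

definition partial_deriv :: "'n \<Rightarrow> (real^'n::finite \<Rightarrow> complex) \<Rightarrow> real^'n \<Rightarrow> complex" where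
  "partial_deriv k f x = vector_derivative (\<lambda>t. f (x + t *\<^sub>R axis k 1)) (at 0)"

text \<open>\<open>iter_partial [k\<^sub>1, \<dots>, k\<^sub>r] f\<close> is the derivative of \<open>f\<close> first in direction \<open>k\<^sub>r\<close>,
  \<dots>, last in direction \<open>k\<^sub>1\<close>.\<close>

definition iter_partial :: "'n list \<Rightarrow> (real^'n::finite \<Rightarrow> complex) \<Rightarrow> real^'n \<Rightarrow> complex" where
  "iter_partial ks f = foldr partial_deriv ks f"

text \<open>Differentiability is total (Frechet) differentiability, so every iterated partial derivative
  exists and is continuous; conversely this holds for every function of class \<open>C\<close>-infinity.\<close>

definition smooth :: "(real^'n::finite \<Rightarrow> complex) \<Rightarrow> bool" where
  "smooth f \<longleftrightarrow> (\<forall>ks x. iter_partial ks f differentiable (at x))"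

type_synonym 'n multi_index = "'n \<Rightarrow> nat"

definition mi_order :: "'n::finite multi_index \<Rightarrow> nat" where
  "mi_order \<alpha> = (\<Sum>k\<in>UNIV. \<alpha> k)"

text \<open>The index type carries no order, so some order of differentiation has to be chosen; by the
  symmetry of higher derivatives the choice is irrelevant for smooth functions.\<close>

definition mi_partial :: "'n multi_index \<Rightarrow> (real^'n::finite \<Rightarrow> complex) \<Rightarrow> real^'n \<Rightarrow> complex" where
  "mi_partial \<alpha> f = iter_partial (SOME ks. \<forall>k. count_list ks k = \<alpha> k) f"

definition hessian :: "(real^'n::finite \<Rightarrow> complex) \<Rightarrow> real^'n \<Rightarrow> complex^'n^'n" where
  "hessian f x = (\<chi> k l. partial_deriv k (partial_deriv l f) x)"

definition supp :: "(real^'n::finite \<Rightarrow> complex) \<Rightarrow> (real^'n) set" where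
  "supp f = closure {x. f x \<noteq> 0}"


section \<open>The square root of the determinant\<close>

definition posdef_Re :: "(complex^'n^'n::finite) set" where
  "posdef_Re = {E. transpose E = E \<and>
     (\<forall>x::real^'n. x \<noteq> 0 \<longrightarrow> x \<bullet> ((\<chi> k l. Re (E $ k $ l)) *v x) > 0)}"

definition det_sqrt_domain :: "(complex^'n^'n::finite) set" where
  "det_sqrt_domain = {E \<in> closure posdef_Re. det E \<noteq> 0}"

definition det_sqrt_branch :: "(complex^'n^'n::finite \<Rightarrow> complex) \<Rightarrow> bool" where
  "det_sqrt_branch s \<longleftrightarrow>
     continuous_on det_sqrt_domain s \<and>
     (\<forall>E \<in> det_sqrt_domain. (s E)\<^sup>2 = det E) \<and>
     (\<forall>E \<in> posdef_Re. (\<forall>k l. Im (E $ k $ l) = 0) \<longrightarrow> Im (s E) = 0 \<and> Re (s E) > 0)"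

text \<open>The domain is star-shaped about the identity matrix, so a branch exists and is unique there.
  Outside the domain, where there is no distinguished branch, \<open>det_sqrt\<close> is totalised by an
  arbitrary square root of the determinant.  In stationary phase, with the imaginary part of the
  phase nonnegative merely on the support of the amplitude \<open>u\<close>, the matrix in question can lie
  outside the domain only if all derivatives of \<open>u\<close> vanish at 0.  Then the expansion is zero and
  only the modulus of the determinant matters.\<close>

definition det_sqrt :: "complex^'n^'n::finite \<Rightarrow> complex" where
  "det_sqrt E =
     (if E \<in> det_sqrt_domain then (SOME s. det_sqrt_branch s) E else csqrt (det E))"


section \<open>The operators of the expansion\<close>

text \<open>\<open>quad_D M\<close> is \<open>\<langle>M D\<^sub>x, D\<^sub>x\<rangle>\<close>, where \<open>D\<^sub>k\<close> is \<open>1/\<i>\<close> times the \<open>k\<close>-th partial derivative.\<close>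

definition D_op :: "'n \<Rightarrow> (real^'n::finite \<Rightarrow> complex) \<Rightarrow> real^'n \<Rightarrow> complex" where
  "D_op k f = (\<lambda>x. 1 / \<i> * partial_deriv k f x)"

definition quad_D :: "complex^'n^'n \<Rightarrow> (real^'n::finite \<Rightarrow> complex) \<Rightarrow> real^'n \<Rightarrow> complex" where
  "quad_D M f = (\<lambda>x. \<Sum>k\<in>UNIV. \<Sum>l\<in>UNIV. M $ k $ l * D_op k (D_op l f) x)"

definition phase_remainder :: "(real^'n::finite \<Rightarrow> complex) \<Rightarrow> real^'n \<Rightarrow> complex" where
  "phase_remainder \<phi> x = \<phi> x - \<phi> 0
     - 1/2 * (\<Sum>k\<in>UNIV. \<Sum>l\<in>UNIV. hessian \<phi> 0 $ k $ l * of_real (x $ l) * of_real (x $ k))"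

text \<open>The summation set below is finite, since its members satisfy \<open>m \<le> 2 * j\<close>.\<close>

definition L_op ::
  "(real^'n::finite \<Rightarrow> complex) \<Rightarrow> nat \<Rightarrow> (real^'n \<Rightarrow> complex) \<Rightarrow> real^'n \<Rightarrow> complex" where
  "L_op \<phi> j f x =
     (\<Sum>(l, m) \<in> {(l::nat, m::nat). int l - int m = int j \<and> 2 * l \<ge> 3 * m}.
        \<i> powi (- int j) * 2 powi (- int l) / (fact l * fact m) *
        (quad_D (matrix_inv (hessian \<phi> 0)) ^^ l) (\<lambda>y. phase_remainder \<phi> y ^ m * f y) x)"


section \<open>The oscillatory integral and the assumptions on phase and amplitude\<close>

definition osc_integral ::
  "real \<Rightarrow> (real^'n::finite \<Rightarrow> complex) \<Rightarrow> (real^'n \<Rightarrow> complex) \<Rightarrow> complex" where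
  "osc_integral h \<phi> u = (LINT x|lborel. exp (\<i> / of_real h * \<phi> x) * u x)"

text \<open>\<open>A\<close>, \<open>B\<close> and \<open>C\<close> are the implicit constants in the bounds on, respectively, the derivatives of
  the phase, the inverse of its Hessian at 0 and the derivatives of the amplitude.\<close>

definition phase_bounds ::
  "real \<Rightarrow> real \<Rightarrow> real \<Rightarrow> ('n::finite multi_index \<Rightarrow> real) \<Rightarrow> real \<Rightarrow>
     (real \<Rightarrow> real^'n \<Rightarrow> complex) \<Rightarrow> bool" where
  "phase_bounds \<mu> \<nu> \<sigma> A B \<phi> \<longleftrightarrow> (\<forall>h\<in>{0<..1}.
     (\<forall>\<alpha> x. mi_order \<alpha> \<ge> 2 \<longrightarrow>
        norm (mi_partial \<alpha> (\<phi> h) x) \<le> A \<alpha> * h powr (- \<mu> - \<nu> * (real (mi_order \<alpha>) - 2))) \<and>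
     invertible (hessian (\<phi> h) 0) \<and>
     onorm (\<lambda>v. matrix_inv (hessian (\<phi> h) 0) *v v) \<le> B * h powr (- \<sigma>))"

definition amplitude_bounds ::
  "real \<Rightarrow> ('n::finite multi_index \<Rightarrow> real) \<Rightarrow> real \<Rightarrow>
     (real \<Rightarrow> real^'n \<Rightarrow> complex) \<Rightarrow> bool" where
  "amplitude_bounds \<rho> C \<epsilon> u \<longleftrightarrow> (\<forall>h\<in>{0<..1}.
     (\<forall>\<alpha> x. norm (mi_partial \<alpha> (u h) x) \<le> C \<alpha> * h powr (- \<rho> * real (mi_order \<alpha>))) \<and>
     supp (u h) \<subseteq> {x. norm x \<le> \<epsilon> * h powr \<rho>})"

definition stationary_phase_data ::
  "real \<Rightarrow> real \<Rightarrow> real \<Rightarrow> ('n::finite multi_index \<Rightarrow> real) \<Rightarrow> real \<Rightarrow>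
     ('n multi_index \<Rightarrow> real) \<Rightarrow> real \<Rightarrow>
     (real \<Rightarrow> real^'n \<Rightarrow> complex) \<Rightarrow> (real \<Rightarrow> real^'n \<Rightarrow> complex) \<Rightarrow> bool" where
  "stationary_phase_data \<mu> \<nu> \<sigma> A B C \<epsilon> \<phi> u \<longleftrightarrow>
     (\<forall>h\<in>{0<..1}. smooth (\<phi> h) \<and> smooth (u h)) \<and>
     (\<forall>h\<in>{0<..1}. (\<forall>k. partial_deriv k (\<phi> h) 0 = 0) \<and>
        (\<forall>x\<in>supp (u h). Im (\<phi> h x) \<ge> 0) \<and> Im (\<phi> h 0) = 0) \<and>
     phase_bounds \<mu> \<nu> \<sigma> A B \<phi> \<and>
     amplitude_bounds (\<sigma> + \<nu> + \<mu>) C \<epsilon> u"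

end

theory Submission
  imports Defs "HOL-Probability.Distributions"
begin

text \<open>Write \<open>H\<close> for the Hessian of the phase at 0, \<open>W\<close> for its inverse, \<open>E = H / \<i>\<close>, \<open>g\<close> for the
  remainder of the phase after its quadratic part, and \<open>\<gamma> = 1 - \<sigma> - 2\<rho> = 1 - 3\<sigma> - 2\<nu> - 2\<mu>\<close>.  The condition
  \<open>5\<mu> + 6\<sigma> + 2\<nu> < 1\<close> makes \<open>\<gamma>\<close> positive.  Consequently an error bound that is off by a fixed power
  of \<open>h\<close> does no harm: the expansion is carried out to a much higher order than demanded, and the
  surplus terms are themselves of the size of the permitted error.

  \<^bold>\<open>Removing the remainder.\<close>  Insert a parameter \<open>s\<close> in front of \<open>g\<close> and apply Taylor's formula at
  \<open>s = 0\<close> to the integral.  The Taylor coefficients are integrals of \<open>g\<^sup>m u\<close> against the Gaussian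
  \<open>exp (- \<langle>E x, x\<rangle> / 2h)\<close>.  The error after \<open>2k\<close> terms is an oscillatory integral whose amplitude
  \<open>(\<i> g / h)\<^sup>2\<^sup>k u\<close> vanishes to order \<open>6k\<close> at the critical point.  It is integrated by parts
  \<open>3k - 1\<close> times along a vector field \<open>X\<close> that takes the phase to 1.  Since \<open>X\<close> is a perturbation of
  \<open>W x / \<bar>x\<bar>\<^sup>2\<close>, a step gains \<open>h \<cdot> h\<^sup>-\<^sup>\<sigma>\<close> and costs two orders of vanishing
  (\<open>nonstationary_phase\<close>, \<open>perturbed_vector_field\<close>), so that the error is \<open>O(h\<^sup>k\<^sup>\<gamma>\<^sup>-\<^sup>1)\<close>
  (\<open>Taylor_remainder_estimate\<close>).  All derivatives are counted with the weight \<open>\<bar>x\<bar>\<close>, which on the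
  support of \<open>u\<close> is at most \<open>h\<^sup>\<rho>\<close>; in this scale \<open>u\<close> is of size 1 and \<open>g\<close> of size
  \<open>h\<^sup>-\<^sup>\<mu>\<^sup>-\<^sup>\<nu> \<bar>x\<bar>\<^sup>3\<close>.  The choice of \<open>\<epsilon>0\<close> guarantees that \<open>g\<close> disturbs the vector field by a factor
  at distance at most 1/2 from 1.

  \<^bold>\<open>Quadratic phases.\<close>  For a test function \<open>f\<close>, \<open>J(t) = det\<^sup>1\<^sup>/\<^sup>2 (E / t) \<integral> exp (- \<langle>E x, x\<rangle> / 2t) f\<close>
  satisfies a heat equation: the \<open>t\<close>-derivative of \<open>J\<close> is the same expression for
  \<open>1/2 \<langle>E\<^sup>-\<^sup>1\<partial>, \<partial>\<rangle> f\<close>.  This follows from integration by parts and Jacobi's formula for the derivative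
  of a determinant.  The trivial bound \<open>O(t\<^sup>-\<^sup>d\<^sup>/\<^sup>2)\<close> for
  \<open>J\<close> and for its \<open>t\<close>-derivatives improves to a uniform bound by repeated integration from \<open>t = 1\<close>
  (\<open>normalized_gint_bound\<close>).  The limit of \<open>J\<close> at \<open>t = 0\<close> is \<open>(2\<pi>)\<^sup>d\<^sup>/\<^sup>2 f(0)\<close>: deform \<open>E\<close> to the
  identity matrix along a segment inside the domain of the branch and compute with the real Gaussian.
  Taylor's formula in \<open>t\<close> then yields the expansion (\<open>quadratic_expansion\<close>).

  \<^bold>\<open>Collecting terms.\<close>  The two expansions produce terms indexed by \<open>(l, m)\<close>, of size
  \<open>h\<close> to the power \<open>(l - m) \<gamma>\<close>, which vanish for \<open>2l < 3m\<close> because \<open>g\<^sup>m u\<close> vanishes to order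
  \<open>3m\<close>.  Those with \<open>l - m = j\<close> form the \<open>j\<close>-th term of the asymptotic series; those with
  \<open>l - m \<ge> N\<close> belong to the error (\<open>box_sum\<close>).  The errors that do not carry the factor
  \<open>det\<^sup>-\<^sup>1\<^sup>/\<^sup>2 E\<close> acquire it at the price of \<open>h\<close> to the power \<open>- \<mu> d / 2\<close>, by the trivial upper
  bound for the determinant (\<open>absorb_determinant\<close>).

  \<^bold>\<open>The degenerate case.\<close>  The imaginary part of the phase is nonnegative on the support of \<open>u\<close> only.
  If some derivative of \<open>u\<close> at 0 is nonzero, then in every direction the support comes arbitrarily
  close to 0, hence the imaginary part of \<open>H\<close> is nonnegative and \<open>E\<close> lies in the domain of the branch
  (\<open>Im_hessian_nonneg\<close>).  Otherwise \<open>u\<close> vanishes to infinite order at 0, the series is zero,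
  and the integration by parts applies to \<open>u\<close> itself (\<open>flat_estimate\<close>).\<close>

section \<open>Iterated partial derivatives\<close>

lemma partial_deriv_eq:
  assumes "(f has_derivative f') (at x)"
  shows "partial_deriv k f x = f' (axis k 1)"
proof -
  have "((\<lambda>t. f (x + t *\<^sub>R axis k 1)) has_derivative (\<lambda>t. f' (t *\<^sub>R axis k 1))) (at 0)"
    by (rule has_derivative_compose[of "\<lambda>t. x + t *\<^sub>R axis k 1"])
       (use assms in \<open>auto intro!: derivative_eq_intros\<close>)
  moreover have "f' (t *\<^sub>R axis k 1) = t *\<^sub>R f' (axis k 1)" for t
    using assms has_derivative_linear linear_scale by blast
  ultimately have "((\<lambda>t. f (x + t *\<^sub>R axis k 1)) has_vector_derivative f' (axis k 1)) (at 0)"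
    by (simp add: has_vector_derivative_def)
  then show ?thesis
    unfolding partial_deriv_def by (rule vector_derivative_at)
qed

lemma has_derivative_partials:
  assumes "f differentiable (at x)"
  shows "(f has_derivative (\<lambda>v. \<Sum>k\<in>UNIV. (v $ k) *\<^sub>R partial_deriv k f x)) (at x)"
proof -
  obtain f' where f': "(f has_derivative f') (at x)"
    using assms by (auto simp: differentiable_def)
  interpret linear f' using f' has_derivative_linear by blast
  have "f' v = (\<Sum>k\<in>UNIV. (v $ k) *\<^sub>R partial_deriv k f x)" for v
  proof -
    have "f' v = f' (\<Sum>k\<in>UNIV. (v $ k) *\<^sub>R axis k 1)"
      using basis_expansion[of v] by (simp add: scalar_mult_eq_scaleR)
    also have "\<dots> = (\<Sum>k\<in>UNIV. (v $ k) *\<^sub>R f' (axis k 1))"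
      by (simp add: sum scale)
    finally show ?thesis by (simp add: partial_deriv_eq[OF f'])
  qed
  then have "f' = (\<lambda>v. \<Sum>k\<in>UNIV. (v $ k) *\<^sub>R partial_deriv k f x)" by blast
  with f' show ?thesis by simp
qed

lemma has_vector_derivative_line:
  assumes "f differentiable (at (x + t *\<^sub>R v))"
  shows "((\<lambda>t. f (x + t *\<^sub>R v)) has_vector_derivative
    (\<Sum>k\<in>UNIV. (v $ k) *\<^sub>R partial_deriv k f (x + t *\<^sub>R v))) (at t)"
proof -
  have "((\<lambda>t. f (x + t *\<^sub>R v)) has_derivative
    (\<lambda>s. \<Sum>k\<in>UNIV. ((s *\<^sub>R v) $ k) *\<^sub>R partial_deriv k f (x + t *\<^sub>R v))) (at t)"
    by (rule has_derivative_compose[where f = "\<lambda>t. x + t *\<^sub>R v" and f' = "\<lambda>s. s *\<^sub>R v",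
          OF _ has_derivative_partials[OF assms]])
       (auto intro!: derivative_eq_intros)
  then show ?thesis
    by (simp add: has_vector_derivative_def scaleR_sum_right)
qed

lemma has_vector_derivative_axis:
  assumes "f differentiable (at (x + t *\<^sub>R axis k 1))"
  shows "((\<lambda>t. f (x + t *\<^sub>R axis k 1)) has_vector_derivative
    partial_deriv k f (x + t *\<^sub>R axis k 1)) (at t)"
proof -
  have "(\<Sum>j\<in>UNIV. (axis k (1::real) $ j) *\<^sub>R partial_deriv j f (x + t *\<^sub>R axis k 1))
      = (\<Sum>j\<in>UNIV. if j = k then partial_deriv j f (x + t *\<^sub>R axis k 1) else 0)"
    by (rule sum.cong) (auto simp: axis_def)
  with has_vector_derivative_line[OF assms] show ?thesis by simp
qed

lemma partial_deriv_const [simp]: "partial_deriv k (\<lambda>x. c) x = 0"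
  by (rule partial_deriv_eq[where f' = "\<lambda>_. 0"]) simp

lemma has_derivative_coord:
  "((\<lambda>x::real^'n. complex_of_real (x $ j)) has_derivative (\<lambda>v. complex_of_real (v $ j))) (at x)"
  by (intro bounded_linear_imp_has_derivative bounded_linear_compose[OF bounded_linear_of_real]
      bounded_linear_vec_nth)

lemma partial_deriv_coord [simp]:
  "partial_deriv k (\<lambda>x. of_real (x $ j)) x = (if j = k then 1 else 0)"
  by (subst partial_deriv_eq[OF has_derivative_coord]) (simp add: axis_def)

lemma differentiable_coord [simp, derivative_intros]:
  "(\<lambda>x::real^'n. complex_of_real (x $ j)) differentiable (at x)"
  using has_derivative_coord unfolding differentiable_def by blast

context
  fixes f g :: "real^'n::finite \<Rightarrow> complex" and x :: "real^'n"
  assumes f: "f differentiable (at x)" and g: "g differentiable (at x)"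
begin

lemma partial_deriv_add: "partial_deriv k (\<lambda>x. f x + g x) x = partial_deriv k f x + partial_deriv k g x"
proof -
  obtain f' g' where d: "(f has_derivative f') (at x)" "(g has_derivative g') (at x)"
    using f g by (auto simp: differentiable_def)
  show ?thesis
    using partial_deriv_eq[OF has_derivative_add[OF d]] d by (simp add: partial_deriv_eq)
qed

lemma partial_deriv_diff: "partial_deriv k (\<lambda>x. f x - g x) x = partial_deriv k f x - partial_deriv k g x"
proof -
  obtain f' g' where d: "(f has_derivative f') (at x)" "(g has_derivative g') (at x)"
    using f g by (auto simp: differentiable_def)
  show ?thesis
    using partial_deriv_eq[OF has_derivative_diff[OF d]] d by (simp add: partial_deriv_eq)
qed

lemma partial_deriv_mult: "partial_deriv k (\<lambda>x. f x * g x) x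
    = partial_deriv k f x * g x + f x * partial_deriv k g x"
proof -
  obtain f' g' where d: "(f has_derivative f') (at x)" "(g has_derivative g') (at x)"
    using f g by (auto simp: differentiable_def)
  have "((\<lambda>x. f x * g x) has_derivative (\<lambda>h. f x * g' h + f' h * g x)) (at x)"
    by (rule has_derivative_mult[OF d])
  from partial_deriv_eq[OF this] d show ?thesis
    by (simp add: partial_deriv_eq)
qed

end

lemma partial_deriv_cmult:
  assumes "f differentiable (at x)"
  shows "partial_deriv k (\<lambda>x. a * f x) x = a * partial_deriv k f x"
  using partial_deriv_mult[of "\<lambda>_. a" x f k] assms by simp

lemma partial_deriv_sum:
  assumes "finite I" "\<And>i. i \<in> I \<Longrightarrow> f i differentiable (at x)"
  shows "partial_deriv k (\<lambda>x. \<Sum>i\<in>I. f i x) x = (\<Sum>i\<in>I. partial_deriv k (f i) x)"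
  using assms
proof (induction I rule: finite_induct)
  case (insert i I)
  have "(\<lambda>x. \<Sum>i\<in>I. f i x) differentiable (at x)" using insert by (auto intro: differentiable_sum)
  then show ?case using insert by (simp add: partial_deriv_add)
qed simp

lemma partial_deriv_exp:
  assumes "f differentiable (at x)"
  shows "partial_deriv k (\<lambda>x. exp (f x)) x = exp (f x) * partial_deriv k f x"
    and "(\<lambda>x. exp (f x)) differentiable (at x)"
proof -
  obtain f' where f': "(f has_derivative f') (at x)"
    using assms by (auto simp: differentiable_def)
  have *: "((\<lambda>x. exp (f x)) has_derivative (\<lambda>v. exp (f x) * f' v)) (at x)"
    by (rule has_derivative_compose[OF f', of exp "\<lambda>z. exp (f x) * z"])
       (use DERIV_exp[of "f x"] in \<open>simp add: has_field_derivative_def\<close>)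
  show "partial_deriv k (\<lambda>x. exp (f x)) x = exp (f x) * partial_deriv k f x"
    using partial_deriv_eq[OF *] partial_deriv_eq[OF f'] by simp
  show "(\<lambda>x. exp (f x)) differentiable (at x)" using * by (auto simp: differentiable_def)
qed

lemma iter_partial_Nil [simp]: "iter_partial [] f = f"
  and iter_partial_Cons [simp]: "iter_partial (k # ks) f = partial_deriv k (iter_partial ks f)"
  and iter_partial_append: "iter_partial (ks @ ls) f = iter_partial ks (iter_partial ls f)"
  by (simp_all add: iter_partial_def)

lemma partial_deriv_cong_open:
  assumes "open U" "x \<in> U" "\<And>y. y \<in> U \<Longrightarrow> f y = g y"
  shows "partial_deriv k f x = partial_deriv k g x"
proof -
  let ?l = "\<lambda>t. x + t *\<^sub>R axis k (1::real)"
  have V: "open (?l -` U)" "0 \<in> ?l -` U"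
    using assms by (auto intro!: open_vimage continuous_intros)
  have "(((\<lambda>t. f (?l t)) has_vector_derivative D) (at 0)) = (((\<lambda>t. g (?l t)) has_vector_derivative D) (at 0))" for D
    using has_vector_derivative_transform_within_open[OF _ V] assms(3) 
    by (smt (verit, best) vimageE)
  then show ?thesis by (simp add: partial_deriv_def vector_derivative_def)
qed

lemma differentiable_cong_open:
  assumes "open U" "x \<in> U" "\<And>y. y \<in> U \<Longrightarrow> f y = g y" "f differentiable (at x)"
  shows "g differentiable (at x)"
  using assms has_derivative_transform_within_open unfolding differentiable_def by blast

lemma iter_partial_cong_open:
  assumes "open U" "x \<in> U" "\<And>y. y \<in> U \<Longrightarrow> f y = g y"
  shows "iter_partial ks f x = iter_partial ks g x"
  using \<open>x \<in> U\<close>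
proof (induction ks arbitrary: x)
  case (Cons k ks)
  then show ?case using partial_deriv_cong_open[OF assms(1), of x "iter_partial ks f"] by simp
qed (use assms in auto)

lemma iter_partial_zero [simp]: "iter_partial ks (\<lambda>_. 0) = (\<lambda>_. 0)"
proof (induction ks)
  case (Cons k ks)
  have "partial_deriv k (\<lambda>_. 0) = (\<lambda>_. 0)" by (simp add: fun_eq_iff)
  with Cons show ?case by simp
qed simp

lemma smooth_iter: "smooth f \<Longrightarrow> smooth (iter_partial ks f)"
  by (simp add: smooth_def iter_partial_append[symmetric])

lemma smooth_partial: "smooth f \<Longrightarrow> smooth (partial_deriv k f)"
  using smooth_iter[of f "[k]"] by simp

lemma smooth_differentiable: "smooth f \<Longrightarrow> f differentiable (at x)"
  using iter_partial_Nil unfolding smooth_def by metis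

lemma smooth_continuous: "smooth f \<Longrightarrow> continuous_on A f"
  by (meson continuous_at_imp_continuous_on differentiable_imp_continuous_within smooth_differentiable)

lemma norm_sq_complex: "(\<Sum>l\<in>UNIV. complex_of_real (x $ l) * complex_of_real (x $ l)) = of_real (norm x ^ 2)"
  for x :: "real^'n::finite"
  by (simp add: norm_vec_def L2_set_def real_sqrt_pow2 sum_nonneg power2_eq_square)

section \<open>Symbol classes\<close>

text \<open>Functions with \<open>n\<close> derivatives on \<open>U\<close> such that every differentiation costs a factor \<open>1 / w\<close>; the
function \<open>c\<close> is the size.  Two weights matter: \<open>w x = norm x\<close> on a punctured ball, the natural scale
near a critical point, and the constant \<open>h\<^sup>\<rho>\<close>, the scale of the amplitude.  The classes form an algebra,
and the constants lost in the operations depend on \<open>n\<close> only; this makes all bounds uniform in \<open>h\<close>.\<close>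

definition symb :: "nat \<Rightarrow> (real^'n::finite) set \<Rightarrow> (real^'n \<Rightarrow> real) \<Rightarrow> (real^'n \<Rightarrow> real)
    \<Rightarrow> (real^'n \<Rightarrow> complex) \<Rightarrow> bool" where
  "symb n U w c f \<longleftrightarrow> (\<forall>ks. length ks \<le> n \<longrightarrow> (\<forall>x\<in>U. iter_partial ks f differentiable (at x) \<and>
     norm (iter_partial ks f x) * w x ^ length ks \<le> c x))"

lemma symbD:
  assumes "symb n U w c f" "length ks \<le> n" "x \<in> U"
  shows "iter_partial ks f differentiable (at x)" "norm (iter_partial ks f x) * w x ^ length ks \<le> c x"
  using assms by (auto simp: symb_def)

lemma symb_bound: "symb n U w c f \<Longrightarrow> x \<in> U \<Longrightarrow> norm (f x) \<le> c x"
  using symbD(2)[of n U w c f "[]"] by simp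

lemma symb_differentiable: "symb n U w c f \<Longrightarrow> x \<in> U \<Longrightarrow> f differentiable (at x)"
  using symbD(1)[of n U w c f "[]"] by simp

lemma symb_nonneg: "symb n U w c f \<Longrightarrow> x \<in> U \<Longrightarrow> 0 \<le> c x"
  using symb_bound order_trans[OF norm_ge_zero] by blast

lemma symb_0: "symb 0 U w c f \<longleftrightarrow> (\<forall>x\<in>U. f differentiable (at x) \<and> norm (f x) \<le> c x)"
  by (simp add: symb_def)

text \<open>Reduces the product and quotient rules for symbols of order \<open>n + 1\<close> to those of order \<open>n\<close> for the
first derivatives, so that no explicit higher Leibniz formula is needed.\<close>

lemma symb_Suc:
  assumes w: "\<And>x. x \<in> U \<Longrightarrow> w x > 0"
  shows "symb (Suc n) U w c f \<longleftrightarrow> symb 0 U w c f \<and> (\<forall>k. symb n U w (\<lambda>x. c x / w x) (partial_deriv k f))"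
proof
  assume L: "symb (Suc n) U w c f"
  have "symb n U w (\<lambda>x. c x / w x) (partial_deriv k f)" for k
    unfolding symb_def
  proof safe
    fix ks :: "'a list" and x assume ks: "length ks \<le> n" and x: "x \<in> U"
    have eq: "iter_partial (ks @ [k]) f = iter_partial ks (partial_deriv k f)"
      by (simp add: iter_partial_append)
    from L ks x have *: "iter_partial (ks @ [k]) f differentiable (at x)"
       "norm (iter_partial (ks @ [k]) f x) * w x ^ Suc (length ks) \<le> c x"
      by (auto simp: symb_def simp del: power_Suc elim!: allE[of _ "ks @ [k]"])
    from *(1) show "iter_partial ks (partial_deriv k f) differentiable (at x)" by (simp add: eq)
    show "norm (iter_partial ks (partial_deriv k f) x) * w x ^ length ks \<le> c x / w x"
      using *(2) w[OF x] by (simp add: eq field_simps)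
  qed
  moreover have "symb 0 U w c f" using symb_bound[OF L] symb_differentiable[OF L] by (simp add: symb_0)
  ultimately show "symb 0 U w c f \<and> (\<forall>k. symb n U w (\<lambda>x. c x / w x) (partial_deriv k f))" by blast
next
  assume R: "symb 0 U w c f \<and> (\<forall>k. symb n U w (\<lambda>x. c x / w x) (partial_deriv k f))"
  show "symb (Suc n) U w c f"
    unfolding symb_def
  proof safe
    fix ks :: "'a list" and x assume ks: "length ks \<le> Suc n" and x: "x \<in> U"
    consider "ks = []" | ls k where "ks = ls @ [k]" by (cases ks rule: rev_cases)
    then have "iter_partial ks f differentiable (at x) \<and> norm (iter_partial ks f x) * w x ^ length ks \<le> c x"
    proof cases
      case 1 then show ?thesis using R x by (simp add: symb_0)
    next
      case 2
      then have "length ls \<le> n" using ks by simp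
      with R x have "iter_partial ls (partial_deriv k f) differentiable (at x)"
        "norm (iter_partial ls (partial_deriv k f) x) * w x ^ length ls \<le> c x / w x"
        by (auto simp: symb_def)
      then show ?thesis using 2 w[OF x] by (simp add: iter_partial_append field_simps)
    qed
    then show "iter_partial ks f differentiable (at x)" "norm (iter_partial ks f x) * w x ^ length ks \<le> c x"
      by blast+
  qed
qed

lemma symb_mono:
  assumes "symb n U w c f" "m \<le> n" "V \<subseteq> U" "\<And>x. x \<in> V \<Longrightarrow> c x \<le> d x"
  shows "symb m V w d f"
  using assms unfolding symb_def by (meson in_mono order_trans)

lemma symb_SucI:
  assumes "\<And>x. x \<in> U \<Longrightarrow> w x > 0" "symb 0 U w c f" "\<And>k. symb n U w (\<lambda>x. c x / w x) (partial_deriv k f)"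
  shows "symb (Suc n) U w c f"
  using assms by (simp add: symb_Suc)

lemma symb_less: "symb n U w c f \<Longrightarrow> m \<le> n \<Longrightarrow> symb m U w c f"
  by (rule symb_mono) auto

lemma symb_cong:
  assumes "open U" "\<And>x. x \<in> U \<Longrightarrow> f x = g x" "symb n U w c f"
  shows "symb n U w c g"
  unfolding symb_def
proof safe
  fix ks :: "'a list" and x assume ks: "length ks \<le> n" and x: "x \<in> U"
  have eq: "iter_partial ks f y = iter_partial ks g y" if "y \<in> U" for y
    using iter_partial_cong_open[OF assms(1) that assms(2)] .
  show "iter_partial ks g differentiable (at x)"
    using assms(3) ks x differentiable_cong_open[OF assms(1) x eq] by (auto simp: symb_def)
  show "norm (iter_partial ks g x) * w x ^ length ks \<le> c x"
    using symbD(2)[OF assms(3) ks x] eq[OF x] by simp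
qed

lemma symb_add:
  assumes U: "open U" and w: "\<And>x. x \<in> U \<Longrightarrow> w x > 0"
    and "symb n U w c f" "symb n U w d g"
  shows "symb n U w (\<lambda>x. c x + d x) (\<lambda>x. f x + g x)"
  using assms(3,4)
proof (induction n arbitrary: f g c d)
  case 0
  then show ?case by (auto simp: symb_0 intro: norm_triangle_mono)
next
  case (Suc n)
  have *: "symb n U w (\<lambda>x. (c x + d x) / w x) (partial_deriv k (\<lambda>x. f x + g x))" for k
  proof (rule symb_cong[OF U])
    show "symb n U w (\<lambda>x. (c x + d x) / w x) (\<lambda>x. partial_deriv k f x + partial_deriv k g x)"
      unfolding add_divide_distrib using Suc by (auto simp: symb_Suc w)
  qed (use Suc.prems in \<open>auto simp: partial_deriv_add symb_differentiable\<close>)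
  have "symb 0 U w (\<lambda>x. c x + d x) (\<lambda>x. f x + g x)"
    using Suc.prems by (auto simp: symb_Suc w symb_0 intro: norm_triangle_mono)
  with * show ?case by (simp add: symb_Suc w)
qed

text \<open>The factor \<open>2 ^ n\<close> is the sum of the coefficients in Leibniz' formula of order \<open>n\<close>.\<close>

lemma symb_mult:
  assumes U: "open U" and w: "\<And>x. x \<in> U \<Longrightarrow> w x > 0"
    and "symb n U w c f" "symb n U w d g"
  shows "symb n U w (\<lambda>x. 2 ^ n * (c x * d x)) (\<lambda>x. f x * g x)"
  using assms(3,4)
proof (induction n arbitrary: f g c d)
  case 0
  then show ?case by (auto simp: symb_0 norm_mult intro!: mult_mono elim: order_trans[OF norm_ge_zero])
next
  case (Suc n)
  have f: "symb n U w c f" and g: "symb n U w d g"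
    and df: "symb n U w (\<lambda>x. c x / w x) (partial_deriv k f)"
    and dg: "symb n U w (\<lambda>x. d x / w x) (partial_deriv k g)" for k
    using symb_less[OF Suc.prems(1), of n] symb_less[OF Suc.prems(2), of n] Suc.prems
    by (auto simp: symb_Suc w)
  have *: "symb n U w (\<lambda>x. 2 ^ Suc n * (c x * d x) / w x) (partial_deriv k (\<lambda>x. f x * g x))" for k
  proof (rule symb_cong[OF U])
    have "symb n U w (\<lambda>x. 2 ^ n * (c x / w x * d x) + 2 ^ n * (c x * (d x / w x)))
        (\<lambda>x. partial_deriv k f x * g x + f x * partial_deriv k g x)"
      by (rule symb_add[OF U w Suc.IH[OF df g] Suc.IH[OF f dg]])
    then show "symb n U w (\<lambda>x. 2 ^ Suc n * (c x * d x) / w x) 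
        (\<lambda>x. partial_deriv k f x * g x + f x * partial_deriv k g x)"
      by (simp add: algebra_simps)
  qed (use f g in \<open>auto simp: partial_deriv_mult symb_differentiable\<close>)
  have "symb 0 U w (\<lambda>x. 2 ^ Suc n * (c x * d x)) (\<lambda>x. f x * g x)"
  proof -
    have "norm (f x) * norm (g x) \<le> 2 ^ Suc n * (c x * d x)" if x: "x \<in> U" for x
    proof -
      have "norm (f x) * norm (g x) \<le> 1 * (c x * d x)"
        using symb_bound[OF f x] symb_bound[OF g x] by (auto intro!: mult_mono elim: order_trans[OF norm_ge_zero])
      also have "\<dots> \<le> 2 ^ Suc n * (c x * d x)"
        using symb_nonneg[OF f x] symb_nonneg[OF g x] by (intro mult_right_mono one_le_power mult_nonneg_nonneg) auto
      finally show ?thesis .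
    qed
    then show ?thesis using f g by (auto simp: symb_0 norm_mult symb_differentiable)
  qed
  with * show ?case by (simp add: symb_Suc w)
qed

lemma symb_partial:
  assumes "\<And>x. x \<in> U \<Longrightarrow> w x > 0" "symb (Suc n) U w c f"
  shows "symb n U w (\<lambda>x. c x / w x) (partial_deriv k f)"
  using assms by (simp add: symb_Suc)

lemma symb_zero: 
  assumes "\<And>x. x \<in> U \<Longrightarrow> 0 \<le> c x"
  shows "symb n U w c (\<lambda>_. 0)"
  using assms by (auto simp: symb_def)

lemma symb_const:
  assumes w: "\<And>x. x \<in> U \<Longrightarrow> w x > 0"
  shows "symb n U w (\<lambda>_. norm a) (\<lambda>_. a)"
proof (cases n)
  case (Suc m)
  have *: "partial_deriv k (\<lambda>_. a) = (\<lambda>_. 0)" for k by (simp add: fun_eq_iff)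
  show ?thesis unfolding Suc
    by (intro symb_SucI w) (auto simp: * symb_0 intro!: symb_zero divide_nonneg_pos w)
qed (simp add: symb_0)

lemma symb_coord:
  assumes w: "\<And>x. x \<in> U \<Longrightarrow> w x > 0" "\<And>x. x \<in> U \<Longrightarrow> norm x \<le> c x" "\<And>x. x \<in> U \<Longrightarrow> w x \<le> c x"
  shows "symb n U w c (\<lambda>x. of_real (x $ k))"
proof (cases n)
  case 0
  show ?thesis unfolding 0 symb_0 by (auto intro: order_trans[OF component_le_norm_cart w(2)])
next
  case (Suc m)
  have "partial_deriv l (\<lambda>x. of_real (x $ k)) = (\<lambda>_. if k = l then 1 else 0)" for l
    by (auto simp: fun_eq_iff)
  note * = this
  have **: "symb m U w (\<lambda>x. c x / w x) (\<lambda>_. if k = l then 1 else 0)" for l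
  proof (rule symb_mono)
    show "symb m U w (\<lambda>_. norm (if k = l then 1 else 0::complex)) (\<lambda>_. if k = l then 1 else 0)"
      by (rule symb_const) (rule w)
    fix x assume x: "x \<in> U"
    then show "norm (if k = l then 1 else 0::complex) \<le> c x / w x"
      using w(1)[OF x] w(3)[OF x] by (simp add: le_divide_eq)
  qed auto
  show ?thesis unfolding Suc
    by (intro symb_SucI w) (auto simp: * ** symb_0 intro: order_trans[OF component_le_norm_cart w(2)])
qed

lemma symb_cmult:
  assumes U: "open U" and w: "\<And>x. x \<in> U \<Longrightarrow> w x > 0" and f: "symb n U w c f"
  shows "symb n U w (\<lambda>x. norm a * c x) (\<lambda>x. a * f x)"
  using f
proof (induction n arbitrary: f c)
  case 0
  then show ?case by (auto simp: symb_0 norm_mult mult_left_mono)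
next
  case (Suc n)
  have *: "symb n U w (\<lambda>x. (norm a * c x) / w x) (partial_deriv k (\<lambda>x. a * f x))" for k
  proof (rule symb_cong[OF U])
    show "symb n U w (\<lambda>x. (norm a * c x) / w x) (\<lambda>x. a * partial_deriv k f x)"
      using Suc.IH[OF symb_partial[OF w Suc.prems, of k]] by simp
  qed (use Suc.prems in \<open>auto simp: partial_deriv_cmult symb_differentiable\<close>)
  have "symb 0 U w (\<lambda>x. norm a * c x) (\<lambda>x. a * f x)"
    using Suc.prems by (auto simp: symb_Suc w symb_0 norm_mult mult_left_mono)
  with * show ?case by (simp add: symb_Suc w)
qed

lemma symb_sum:
  assumes U: "open U" and w: "\<And>x. x \<in> U \<Longrightarrow> w x > 0" and "finite I"
    and "\<And>i. i \<in> I \<Longrightarrow> symb n U w (c i) (f i)"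
  shows "symb n U w (\<lambda>x. \<Sum>i\<in>I. c i x) (\<lambda>x. \<Sum>i\<in>I. f i x)"
  using assms(3,4)
proof (induction I rule: finite_induct)
  case empty then show ?case by (auto intro: symb_zero)
next
  case (insert i I)
  then show ?case by (simp add: symb_add[OF U w])
qed

lemma symb_power:
  assumes U: "open U" and w: "\<And>x. x \<in> U \<Longrightarrow> w x > 0" and f: "symb n U w c f"
  shows "symb n U w (\<lambda>x. 2 ^ (n * m) * c x ^ m) (\<lambda>x. f x ^ m)"
proof (induction m)
  case 0
  show ?case using symb_const[of U w n 1] w by simp
next
  case (Suc m)
  from symb_mult[OF U w f this] show ?case
    by (simp add: power_add mult_ac)
qed

lemma differentiable_inverse_complex:
  fixes f :: "real^'n::finite \<Rightarrow> complex"
  assumes "f differentiable (at x)" "f x \<noteq> 0"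
  shows "(\<lambda>x. inverse (f x)) differentiable (at x)"
    and "partial_deriv k (\<lambda>x. inverse (f x)) x = - (inverse (f x) * inverse (f x) * partial_deriv k f x)"
proof -
  obtain f' where f': "(f has_derivative f') (at x)"
    using assms by (auto simp: differentiable_def)
  have *: "((\<lambda>x. inverse (f x)) has_derivative (\<lambda>h. - (inverse (f x) * f' h * inverse (f x)))) (at x)"
    by (rule Deriv.has_derivative_inverse[OF assms(2) f'])
  show "(\<lambda>x. inverse (f x)) differentiable (at x)" using * by (auto simp: differentiable_def)
  show "partial_deriv k (\<lambda>x. inverse (f x)) x = - (inverse (f x) * inverse (f x) * partial_deriv k f x)"
    using partial_deriv_eq[OF *] partial_deriv_eq[OF f'] by simp
qed

text \<open>The recursion comes from the derivative \<open>- f' / f\<^sup>2\<close> of \<open>1 / f\<close>: two products of symbols of order \<open>n\<close>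
contribute one factor \<open>2 ^ n\<close> each.\<close>

primrec inverse_const :: "real \<Rightarrow> nat \<Rightarrow> real" where
  "inverse_const a 0 = \<bar>a\<bar> + 1"
| "inverse_const a (Suc n) = inverse_const a n + 2 ^ n * (2 ^ n * (inverse_const a n * inverse_const a n))"

lemma inverse_const_pos: "inverse_const a n > 0"
  by (induction n) (auto intro: add_pos_pos)

text \<open>Since \<open>c\<close> bounds \<open>f\<close> from above and, up to the factor \<open>a\<close>, from below, the size of the reciprocal
involves only the ratio \<open>a\<close> of the two bounds; it does not deteriorate where \<open>f\<close> is small or large.\<close>

lemma symb_inverse:
  assumes U: "open U" and w: "\<And>x. x \<in> U \<Longrightarrow> w x > 0"
    and lower: "\<And>x. x \<in> U \<Longrightarrow> 0 < c x" "\<And>x. x \<in> U \<Longrightarrow> c x \<le> a * norm (f x)"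
    and f: "symb n U w c f"
  shows "symb n U w (\<lambda>x. inverse_const a n / c x) (\<lambda>x. inverse (f x))"
  using f
proof (induction n)
  case 0
  show ?case
    unfolding symb_0
  proof safe
    fix x assume x: "x \<in> U"
    have nz: "f x \<noteq> 0" using lower[OF x] by auto
    then show "(\<lambda>x. inverse (f x)) differentiable at x"
      using differentiable_inverse_complex(1) symb_differentiable[OF 0 x] by blast
    have "c x \<le> (\<bar>a\<bar> + 1) * norm (f x)"
      by (rule order_trans[OF lower(2)[OF x]]) (auto intro: mult_right_mono)
    then show "norm (inverse (f x)) \<le> inverse_const a 0 / c x"
      using nz lower(1)[OF x] by (simp add: norm_inverse norm_divide field_simps)
  qed
next
  case (Suc n)
  let ?K = "inverse_const a n" and ?K' = "inverse_const a (Suc n)"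
  have K: "?K > 0" by (rule inverse_const_pos)
  have fn: "symb n U w c f" by (rule symb_less[OF Suc.prems]) simp
  note I = Suc.IH[OF fn]
  have df: "symb n U w (\<lambda>x. c x / w x) (partial_deriv k f)" for k
    using symb_partial[OF w Suc.prems] by blast
  have "symb n U w (\<lambda>x. 2 ^ n * (2 ^ n * (?K / c x * (?K / c x)) * (c x / w x)))
      (\<lambda>x. inverse (f x) * inverse (f x) * partial_deriv k f x)" for k
    using symb_mult[OF U w symb_mult[OF U w I I] df] by blast
  from symb_cmult[OF U w this, of "-1"]
  have "symb n U w (\<lambda>x. 2 ^ n * (2 ^ n * (?K / c x * (?K / c x)) * (c x / w x)))
      (\<lambda>x. - (inverse (f x) * inverse (f x) * partial_deriv k f x))" for k
    by simp
  then have d: "symb n U w (\<lambda>x. ?K' / c x / w x)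
      (\<lambda>x. - (inverse (f x) * inverse (f x) * partial_deriv k f x))" for k
  proof (rule symb_mono)
    fix x assume x: "x \<in> U"
    have "2 ^ n * (2 ^ n * (?K / c x * (?K / c x)) * (c x / w x)) = 2 ^ n * (2 ^ n * (?K * ?K)) / c x / w x"
      using lower(1)[OF x] by (simp add: field_simps)
    also have "\<dots> \<le> ?K' / c x / w x"
      using lower(1)[OF x] w[OF x] K by (intro divide_right_mono) (auto simp: less_imp_le)
    finally show "2 ^ n * (2 ^ n * (?K / c x * (?K / c x)) * (c x / w x)) \<le> ?K' / c x / w x" .
  qed auto
  show ?case
  proof (intro symb_SucI w)
    show "symb n U w (\<lambda>x. ?K' / c x / w x) (partial_deriv k (\<lambda>x. inverse (f x)))" for k
    proof (rule symb_cong[OF U _ d])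
      fix x assume x: "x \<in> U"
      then have "f x \<noteq> 0" using lower[OF x] by auto
      then show "- (inverse (f x) * inverse (f x) * partial_deriv k f x) = partial_deriv k (\<lambda>x. inverse (f x)) x"
        using differentiable_inverse_complex(2) symb_differentiable[OF fn x] by metis
    qed
    show "symb 0 U w (\<lambda>x. ?K' / c x) (\<lambda>x. inverse (f x))"
    proof (rule symb_mono[OF I])
      fix x assume "x \<in> U"
      then show "?K / c x \<le> ?K' / c x" using lower(1) K by (intro divide_right_mono) (auto simp: less_imp_le)
    qed auto
  qed
qed

text \<open>Transfers the closure properties of symbols to smooth functions.\<close>

lemma smooth_iff_symb: "smooth f \<longleftrightarrow> (\<forall>n. \<exists>c. symb n UNIV (\<lambda>_. 1) c f)"
proof
  assume f: "smooth f"
  have fin: "finite {ks::'a list. length ks \<le> n}" for n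
    using finite_lists_length_le[of "UNIV::'a set" n] by simp
  show "\<forall>n. \<exists>c. symb n UNIV (\<lambda>_. 1) c f"
  proof (intro allI exI)
    fix n
    show "symb n UNIV (\<lambda>_. 1) (\<lambda>x. \<Sum>ks | length ks \<le> n. norm (iter_partial ks f x)) f"
      using f unfolding symb_def smooth_def by (auto intro!: member_le_sum[OF _ _ fin])
  qed
next
  assume "\<forall>n. \<exists>c. symb n UNIV (\<lambda>_. 1) c f"
  then show "smooth f" unfolding smooth_def symb_def by (metis UNIV_I order_refl)
qed

lemma smooth_const: "smooth (\<lambda>_. a)"
  unfolding smooth_iff_symb using symb_const[of UNIV "\<lambda>_. 1"] by auto

lemma smooth_coord: "smooth (\<lambda>x. of_real (x $ k))"
  unfolding smooth_iff_symb using symb_coord[of UNIV "\<lambda>_. 1" "\<lambda>x. norm x + 1"] by auto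

lemma smooth_add: "smooth f \<Longrightarrow> smooth g \<Longrightarrow> smooth (\<lambda>x. f x + g x)"
  unfolding smooth_iff_symb
proof
  fix n assume "\<forall>n. \<exists>c. symb n UNIV (\<lambda>_. 1) c f" "\<forall>n. \<exists>c. symb n UNIV (\<lambda>_. 1) c g"
  then obtain c d where "symb n UNIV (\<lambda>_. 1) c f" "symb n UNIV (\<lambda>_. 1) d g" by blast
  from symb_add[OF open_UNIV _ this] show "\<exists>c. symb n UNIV (\<lambda>_. 1) c (\<lambda>x. f x + g x)" by auto
qed

lemma smooth_mult: "smooth f \<Longrightarrow> smooth g \<Longrightarrow> smooth (\<lambda>x. f x * g x)"
  unfolding smooth_iff_symb
proof
  fix n assume "\<forall>n. \<exists>c. symb n UNIV (\<lambda>_. 1) c f" "\<forall>n. \<exists>c. symb n UNIV (\<lambda>_. 1) c g"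
  then obtain c d where "symb n UNIV (\<lambda>_. 1) c f" "symb n UNIV (\<lambda>_. 1) d g" by blast
  from symb_mult[OF open_UNIV _ this] show "\<exists>c. symb n UNIV (\<lambda>_. 1) c (\<lambda>x. f x * g x)" by auto
qed

lemma smooth_cmult: "smooth f \<Longrightarrow> smooth (\<lambda>x. a * f x)"
  using smooth_mult smooth_const by blast

lemma smooth_diff: "smooth f \<Longrightarrow> smooth g \<Longrightarrow> smooth (\<lambda>x. f x - g x)"
  using smooth_add[of f "\<lambda>x. (-1) * g x"] smooth_cmult[of g "-1"] by simp

lemma smooth_sum: "finite I \<Longrightarrow> (\<And>i. i \<in> I \<Longrightarrow> smooth (f i)) \<Longrightarrow> smooth (\<lambda>x. \<Sum>i\<in>I. f i x)"
  by (induction I rule: finite_induct) (auto intro: smooth_add smooth_const)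

lemma smooth_power: "smooth f \<Longrightarrow> smooth (\<lambda>x. f x ^ m)"
  by (induction m) (auto intro: smooth_mult smooth_const)


section \<open>Symmetry of higher derivatives\<close>

text \<open>The second difference is symmetric in \<open>k\<close> and \<open>l\<close>, so its limit proves the symmetry of second
derivatives.  The limit exists because the first derivative is totally differentiable at the point, which
controls its increments in all directions at once.\<close>

lemma second_difference_tendsto:
  fixes f :: "real^'n::finite \<Rightarrow> complex"
  assumes f: "\<And>y. f differentiable (at y)" and D: "partial_deriv k f differentiable (at x)"
  shows "((\<lambda>h. (f (x + h *\<^sub>R axis k 1 + h *\<^sub>R axis l 1) - f (x + h *\<^sub>R axis k 1)
      - f (x + h *\<^sub>R axis l 1) + f x) / of_real (h\<^sup>2)) \<longlongrightarrow> partial_deriv l (partial_deriv k f) x) (at_right 0)"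
proof (rule tendstoI)
  fix \<epsilon> :: real assume "\<epsilon> > 0"
  let ?D = "partial_deriv k f" and ?a = "axis k 1 :: real^'n" and ?b = "axis l 1 :: real^'n"
  obtain D' where D': "(?D has_derivative D') (at x)"
    using D by (auto simp: differentiable_def)
  interpret linear D' using D' has_derivative_linear by blast
  have c: "partial_deriv l ?D x = D' ?b" by (rule partial_deriv_eq[OF D'])
  \<comment> \<open>a quarter, because the differences below add up to \<open>3 * e\<close> and a strict inequality is wanted\<close>
  define e where "e = \<epsilon> / 4"
  have e: "e > 0" using \<open>\<epsilon> > 0\<close> by (simp add: e_def)
  obtain \<delta> where \<delta>: "\<delta> > 0" "\<And>y. norm (y - x) < \<delta> \<Longrightarrow> norm (?D y - ?D x - D' (y - x)) \<le> e * norm (y - x)"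
    using D' e unfolding has_derivative_at_alt by blast
  have main: "dist ((f (x + h *\<^sub>R ?a + h *\<^sub>R ?b) - f (x + h *\<^sub>R ?a)
      - f (x + h *\<^sub>R ?b) + f x) / of_real (h\<^sup>2)) (partial_deriv l ?D x) < \<epsilon>"
    if h: "0 < h" "h < \<delta> / 2" for h
  proof -
    \<comment> \<open>the increment of \<open>G\<close> over \<open>[0, h]\<close> is the second difference minus \<open>h\<^sup>2\<close> times the expected limit\<close>
    define G where "G t = f ((x + h *\<^sub>R ?b) + t *\<^sub>R ?a) - f (x + t *\<^sub>R ?a) - t *\<^sub>R (h *\<^sub>R D' ?b)" for t
    have G': "(G has_vector_derivative ?D ((x + h *\<^sub>R ?b) + t *\<^sub>R ?a) - ?D (x + t *\<^sub>R ?a) - h *\<^sub>R D' ?b) (at t)" for t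
      unfolding G_def
      by (intro has_vector_derivative_diff has_vector_derivative_axis f)
         (auto intro!: derivative_eq_intros)
    have est: "norm (?D ((x + h *\<^sub>R ?b) + t *\<^sub>R ?a) - ?D (x + t *\<^sub>R ?a) - h *\<^sub>R D' ?b) \<le> 3 * e * h"
      if t: "0 < t" "t < h" for t
    proof -
      have n1: "norm (t *\<^sub>R ?a) \<le> h" using t by simp
      have n2: "norm (h *\<^sub>R ?b + t *\<^sub>R ?a) \<le> 2 * h" using t h by (intro norm_triangle_le) simp
      have "norm (?D ((x + h *\<^sub>R ?b) + t *\<^sub>R ?a) - ?D x - D' (h *\<^sub>R ?b + t *\<^sub>R ?a)) \<le> e * norm (h *\<^sub>R ?b + t *\<^sub>R ?a)"
        using \<delta>(2)[of "(x + h *\<^sub>R ?b) + t *\<^sub>R ?a"] n2 h by (simp add: add.assoc)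
      also have "\<dots> \<le> e * (2 * h)" using n2 e by (intro mult_left_mono) auto
      finally have 1: "norm (?D ((x + h *\<^sub>R ?b) + t *\<^sub>R ?a) - ?D x - D' (h *\<^sub>R ?b + t *\<^sub>R ?a)) \<le> e * (2 * h)" .
      have "norm (?D (x + t *\<^sub>R ?a) - ?D x - D' (t *\<^sub>R ?a)) \<le> e * norm (t *\<^sub>R ?a)"
        using \<delta>(2)[of "x + t *\<^sub>R ?a"] n1 h by simp
      also have "\<dots> \<le> e * h" using n1 e by (intro mult_left_mono) auto
      finally have 2: "norm (?D (x + t *\<^sub>R ?a) - ?D x - D' (t *\<^sub>R ?a)) \<le> e * h" .
      have "?D ((x + h *\<^sub>R ?b) + t *\<^sub>R ?a) - ?D (x + t *\<^sub>R ?a) - h *\<^sub>R D' ?b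
          = (?D ((x + h *\<^sub>R ?b) + t *\<^sub>R ?a) - ?D x - D' (h *\<^sub>R ?b + t *\<^sub>R ?a))
          - (?D (x + t *\<^sub>R ?a) - ?D x - D' (t *\<^sub>R ?a))"
        by (simp add: add scale)
      also have "norm \<dots> \<le> e * (2 * h) + e * h" using 1 2 norm_triangle_ineq4 order_trans add_mono by meson
      finally show ?thesis by (simp add: algebra_simps)
    qed
    have "norm (G h - G 0) \<le> (3 * e * h) * h - (3 * e * h) * 0"
    proof (rule differentiable_bound_general[OF h(1)])
      show "continuous_on {0..h} G"
        using G' by (meson continuous_at_imp_continuous_on has_vector_derivative_continuous)
      show "continuous_on {0..h} (\<lambda>t. (3 * e * h) * t)" by (intro continuous_intros)
      show "((\<lambda>t. (3 * e * h) * t) has_vector_derivative 3 * e * h) (at t)" for t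
        by (auto intro!: derivative_eq_intros simp: has_real_derivative_iff_has_vector_derivative[symmetric])
    qed (use G' est in auto)
    then have *: "norm (G h - G 0) \<le> 3 * e * h\<^sup>2" by (simp add: power2_eq_square)
    have "(f (x + h *\<^sub>R ?a + h *\<^sub>R ?b) - f (x + h *\<^sub>R ?a) - f (x + h *\<^sub>R ?b) + f x) / of_real (h\<^sup>2) - D' ?b
        = (G h - G 0) / of_real (h\<^sup>2)"
      using h by (simp add: G_def field_simps scaleR_conv_of_real power2_eq_square add_ac)
    also have "norm \<dots> \<le> 3 * e" using * h by (simp add: norm_divide field_simps norm_power)
    also have "\<dots> < \<epsilon>" using \<open>\<epsilon> > 0\<close> by (simp add: e_def)
    finally show ?thesis by (simp add: c dist_norm)
  qed
  show "\<forall>\<^sub>F h in at_right 0. dist ((f (x + h *\<^sub>R ?a + h *\<^sub>R ?b) - f (x + h *\<^sub>R ?a)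
      - f (x + h *\<^sub>R ?b) + f x) / of_real (h\<^sup>2)) (partial_deriv l ?D x) < \<epsilon>"
    unfolding eventually_at_right_field
    by (rule exI[of _ "\<delta> / 2"]) (use \<delta>(1) main in auto)
qed

lemma partial_deriv_commute:
  assumes "smooth f"
  shows "partial_deriv k (partial_deriv l f) = partial_deriv l (partial_deriv k f)"
proof
  fix x
  note d = smooth_differentiable[OF assms] smooth_differentiable[OF smooth_partial[OF assms]]
  show "partial_deriv k (partial_deriv l f) x = partial_deriv l (partial_deriv k f) x"
    using tendsto_unique[OF _ second_difference_tendsto[where k=k and l=l, OF d]] 
      second_difference_tendsto[where k=l and l=k, OF d, of x]
    by (simp add: algebra_simps)
qed

lemma iter_partial_move:
  assumes "smooth f"
  shows "iter_partial (ks @ k # ls) f = iter_partial (k # ks @ ls) f"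
proof (induction ks)
  case (Cons j ks)
  have "smooth (iter_partial (ks @ ls) f)" by (rule smooth_iter[OF assms])
  from partial_deriv_commute[OF this] Cons show ?case by simp
qed simp

lemma iter_partial_perm:
  assumes "smooth f" "mset ks = mset ls"
  shows "iter_partial ks f = iter_partial ls f"
  using assms(2)
proof (induction ks arbitrary: ls)
  case (Cons k ks)
  then have "k \<in> set ls" by (metis list.set_intros(1) mset_eq_setD)
  then obtain l1 l2 where ls: "ls = l1 @ k # l2" by (meson split_list)
  with Cons.prems have "mset ks = mset (l1 @ l2)" by simp
  from Cons.IH[OF this] show ?case unfolding ls iter_partial_move[OF assms(1)] by simp
qed simp

text \<open>Justifies working with lists of directions in place of multi-indices.\<close>

lemma mi_partial_eq_iter:
  assumes "smooth f" shows "mi_partial (count_list ks) f = iter_partial ks f"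
proof -
  have "\<forall>k. count_list (SOME ls. \<forall>k. count_list ls k = count_list ks k) k = count_list ks k"
    by (rule someI[of _ ks]) simp
  then have "mset (SOME ls. \<forall>k. count_list ls k = count_list ks k) = mset ks"
    by (auto simp: multiset_eq_iff count_mset count_list_eq_length_filter)
  from iter_partial_perm[OF assms this] show ?thesis by (simp add: mi_partial_def)
qed

lemma mi_order_count_list: "mi_order (count_list ks) = length (ks :: 'n::finite list)"
  unfolding mi_order_def by (rule sum_count_set) auto

lemma finite_mi_order: "finite {\<alpha> :: 'n::finite multi_index. mi_order \<alpha> \<le> n}"
proof (rule finite_subset)
  show "{\<alpha> :: 'n multi_index. mi_order \<alpha> \<le> n} \<subseteq> PiE UNIV (\<lambda>_. {..n})"
    unfolding mi_order_def by (auto simp: PiE_def intro: order_trans[OF member_le_sum[of _ UNIV]])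
  show "finite (PiE UNIV (\<lambda>_. {..n}) :: 'n multi_index set)" by (rule finite_PiE) auto
qed

section \<open>Functions vanishing at the origin\<close>

text \<open>The mean value inequality on the segment from 0 to \<open>x\<close>.\<close>

lemma vanish_step:
  fixes f :: "real^'n::finite \<Rightarrow> complex" and M :: real
  assumes d: "\<And>y. f differentiable (at y)" and f0: "f 0 = 0"
    and b: "\<And>k y. norm y \<le> norm x \<Longrightarrow> norm (partial_deriv k f y) \<le> M"
  shows "norm (f x) \<le> CARD('n) * M * norm x"
proof -
  have "norm (f (0 + 1 *\<^sub>R x) - f (0 + 0 *\<^sub>R x)) \<le> (CARD('n) * M * norm x) * 1 - (CARD('n) * M * norm x) * 0"
  proof (rule differentiable_bound_general)
    show "((\<lambda>t. f (0 + t *\<^sub>R x)) has_vector_derivative 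
        (\<Sum>k\<in>UNIV. (x $ k) *\<^sub>R partial_deriv k f (0 + t *\<^sub>R x))) (at t)" for t
      by (rule has_vector_derivative_line[OF d])
    then show "continuous_on {0..1} (\<lambda>t. f (0 + t *\<^sub>R x))"
      by (meson continuous_at_imp_continuous_on has_vector_derivative_continuous)
    show "continuous_on {0..1} (\<lambda>t. (CARD('n) * M * norm x) * t)" by (intro continuous_intros)
    show "((\<lambda>t. (CARD('n) * M * norm x) * t) has_vector_derivative (CARD('n) * M * norm x)) (at t)" for t
      by (auto intro!: derivative_eq_intros simp: has_real_derivative_iff_has_vector_derivative[symmetric])
    fix t :: real assume t: "0 < t" "t < 1"
    have "norm (\<Sum>k\<in>UNIV. (x $ k) *\<^sub>R partial_deriv k f (0 + t *\<^sub>R x)) \<le> (\<Sum>k\<in>(UNIV::'n set). norm x * M)"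
    proof (rule sum_norm_le)
      fix k
      have "norm (0 + t *\<^sub>R x) \<le> norm x" using t by (simp add: mult_left_le_one_le)
      from b[OF this] show "norm ((x $ k) *\<^sub>R partial_deriv k f (0 + t *\<^sub>R x)) \<le> norm x * M"
        using component_le_norm_cart[of x k] by (auto intro!: mult_mono)
    qed
    then show "norm (\<Sum>k\<in>UNIV. (x $ k) *\<^sub>R partial_deriv k f (0 + t *\<^sub>R x)) \<le> CARD('n) * M * norm x"
      by (simp add: mult_ac)
  qed simp
  then show ?thesis by (simp add: f0)
qed

text \<open>A substitute for Taylor's formula: a function whose derivatives below order \<open>m\<close> vanish at 0 and
whose derivatives of order \<open>m\<close> are bounded by \<open>M\<close> is controlled by integrating \<open>m\<close> times from 0,
each integration contributing \<open>CARD('n) * norm x\<close>.\<close>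

lemma vanish_bound:
  fixes f :: "real^'n::finite \<Rightarrow> complex" and M :: real
  assumes f: "smooth f" and v: "\<And>ks. length ks < m \<Longrightarrow> iter_partial ks f 0 = 0"
    and b: "\<And>ks y. length ks = m \<Longrightarrow> norm y \<le> norm x \<Longrightarrow> norm (iter_partial ks f y) \<le> M"
    and ks: "length ks \<le> m"
  shows "norm (iter_partial ks f x) \<le> real CARD('n) ^ (m - length ks) * M * norm x ^ (m - length ks)"
proof -
  have "norm (iter_partial ks f y) \<le> real CARD('n) ^ p * M * norm y ^ p" 
    if "length ks = m - p" "p \<le> m" "norm y \<le> norm x" for ks y p
    using that
  proof (induction p arbitrary: ks y)
    case 0
    then show ?case using b by simp
  next
    case (Suc p)
    have "norm (iter_partial ks f y) \<le> CARD('n) * (real CARD('n) ^ p * M * norm y ^ p) * norm y"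
    proof (rule vanish_step[where f = "iter_partial ks f" and x = y and M = "real CARD('n) ^ p * M * norm y ^ p"])
      show "iter_partial ks f differentiable at y" for y using f by (simp add: smooth_def)
      show "iter_partial ks f 0 = 0" using Suc.prems by (intro v) auto
      fix k :: 'n and z :: "real^'n" assume z: "norm z \<le> norm y"
      have M: "M \<ge> 0" using order_trans[OF norm_ge_zero b[of "replicate m k" x]] by simp
      have "norm (iter_partial (k # ks) f z) \<le> real CARD('n) ^ p * M * norm z ^ p"
        using Suc.prems z by (intro Suc.IH) auto
      also have "\<dots> \<le> real CARD('n) ^ p * M * norm y ^ p"
        using z M by (intro mult_left_mono power_mono) auto
      finally show "norm (partial_deriv k (iter_partial ks f) z) \<le> real CARD('n) ^ p * M * norm y ^ p" by simp
    qed
    then show ?case by (simp add: mult_ac)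
  qed
  from this[of ks "m - length ks" x] ks show ?thesis by auto
qed

section \<open>Integrals of continuous functions with bounded support\<close>

lemma integrable_bounded_support:
  fixes f :: "real^'n::finite \<Rightarrow> complex"
  assumes "continuous_on UNIV f" "\<And>x. norm x > R \<Longrightarrow> f x = 0"
  shows "integrable lborel f"
proof -
  have "integrable lborel (\<lambda>x. indicator (cball 0 R) x *\<^sub>R f x)"
    by (rule borel_integrable_compact) (use assms(1) continuous_on_subset in auto)
  moreover have "(\<lambda>x. indicator (cball 0 R) x *\<^sub>R f x) = f"
    using assms(2) by (fastforce simp: indicator_def fun_eq_iff)
  ultimately show ?thesis by simp
qed

lemma norm_integral_bounded_support:
  fixes f :: "real^'n::finite \<Rightarrow> complex"
  assumes "\<And>x. norm x > 1 \<Longrightarrow> f x = 0" "\<And>x. norm x \<le> 1 \<Longrightarrow> norm (f x) \<le> c"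
  shows "norm (LINT x|lborel. f x) \<le> c * measure lborel (cball (0::real^'n) 1)"
proof -
  have c: "c \<ge> 0" using order_trans[OF norm_ge_zero assms(2)[of 0]] by simp
  have fin: "emeasure lborel (cball (0::real^'n) 1) < \<infinity>" by (rule emeasure_bounded_finite) auto
  show ?thesis
  proof (cases "integrable lborel f")
    case True
    have "norm (LINT x|lborel. f x) \<le> (LINT x|lborel. norm (f x))" by (rule integral_norm_bound)
    also have "\<dots> \<le> (LINT x|lborel. c * indicator (cball (0::real^'n) 1) x)"
      using True fin assms c
      by (intro integral_mono integrable_norm integrable_mult_right integrable_real_indicator)
         (auto simp: indicator_def not_le)
    also have "\<dots> = c * measure lborel (cball (0::real^'n) 1)" by simp
    finally show ?thesis .
  qed (use c in \<open>simp add: not_integrable_integral_eq\<close>)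
qed

lemma leibniz_bounded_support:
  fixes f f' :: "real \<Rightarrow> real^'n::finite \<Rightarrow> complex"
  assumes T: "convex T" "t0 \<in> T"
    and d: "\<And>t x. t \<in> T \<Longrightarrow> ((\<lambda>t. f t x) has_vector_derivative f' t x) (at t within T)"
    and c: "\<And>t. t \<in> T \<Longrightarrow> continuous_on UNIV (f t)"
    and c': "continuous_on (T \<times> UNIV) (\<lambda>(t, x). f' t x)"
    and z: "\<And>t x. t \<in> T \<Longrightarrow> norm x > R \<Longrightarrow> f t x = 0" "\<And>t x. t \<in> T \<Longrightarrow> norm x > R \<Longrightarrow> f' t x = 0"
  shows "((\<lambda>t. LINT x|lborel. f t x) has_vector_derivative (LINT x|lborel. f' t0 x)) (at t0 within T)"
proof -
  obtain b where b: "cball (0::real^'n) R \<subseteq> cbox (-b) b"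
    using bounded_subset_cbox_symmetric[of "cball (0::real^'n) R"] by auto
  have eq: "(LINT x|lborel. g x) = integral (cbox (-b) b) g" 
    if "continuous_on UNIV g" "\<And>x. norm x > R \<Longrightarrow> g x = 0" for g :: "real^'n \<Rightarrow> complex"
  proof -
    have "(LINT x|lborel. g x) = integral UNIV g"
      using integral_lborel[OF integrable_bounded_support[OF that]] by simp
    also have "\<dots> = integral UNIV (\<lambda>x. if x \<in> cbox (-b) b then g x else 0)"
      using that(2) b by (intro arg_cong[where f="integral UNIV"] ext) (force simp: subset_iff)
    also have "\<dots> = integral (cbox (-b) b) g" by (rule integral_restrict_UNIV)
    finally show ?thesis .
  qed
  have c'': "continuous_on UNIV (f' t)" if "t \<in> T" for t
  proof -
    have "continuous_on UNIV (\<lambda>x. case (t, x) of (t, x) \<Rightarrow> f' t x)"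
      by (rule continuous_on_compose2[OF c']) (use that in \<open>auto intro!: continuous_intros\<close>)
    then show ?thesis by simp
  qed
  have "((\<lambda>t. integral (cbox (-b) b) (f t)) has_vector_derivative integral (cbox (-b) b) (f' t0)) (at t0 within T)"
  proof (rule leibniz_rule_vector_derivative[OF d _ _ T(2,1)])
    show "f t integrable_on cbox (-b) b" if "t \<in> T" for t
      by (rule integrable_continuous) (use c[OF that] continuous_on_subset in auto)
    show "continuous_on (T \<times> cbox (-b) b) (\<lambda>(t, x). f' t x)"
      by (rule continuous_on_subset[OF c']) auto
  qed
  then show ?thesis
    using has_vector_derivative_transform[OF T(2), of "\<lambda>t. LINT x|lborel. f t x"] eq c c'' z T(2) by simp
qed

text \<open>By translation invariance the integral of \<open>F (x + t e\<^sub>k)\<close> does not depend on \<open>t\<close>; differentiate under the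
integral sign at \<open>t = 0\<close>.  This is the only form of integration by parts that is used, and it requires
merely continuous first derivatives.\<close>

lemma integral_partial_deriv:
  fixes F :: "real^'n::finite \<Rightarrow> complex"
  assumes d: "\<And>x. F differentiable (at x)" and c: "continuous_on UNIV (partial_deriv k F)"
    and z: "\<And>x. norm x > 1 \<Longrightarrow> F x = 0"
  shows "(LINT x|lborel. partial_deriv k F x) = 0"
proof -
  let ?a = "axis k 1 :: real^'n"
  have cF: "continuous_on UNIV F"
    using d by (simp add: continuous_at_imp_continuous_on differentiable_imp_continuous_within)
  \<comment> \<open>the translates by \<open>t\<close> in \<open>[-1, 1]\<close> have their support in the ball of radius 2\<close>
  have far: "norm (x + t *\<^sub>R ?a) > 1" if "t \<in> {-1..1}" "norm x > 2" for x t
  proof -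
    have "norm x \<le> norm (x + t *\<^sub>R ?a) + norm (t *\<^sub>R ?a)" by (metis add_diff_cancel norm_triangle_ineq4)
    moreover have "norm (t *\<^sub>R ?a) \<le> 1" using that by auto
    ultimately show ?thesis using that by linarith
  qed
  have z': "partial_deriv k F x = 0" if "norm x > 1" for x
  proof -
    have "partial_deriv k F x = partial_deriv k (\<lambda>_. 0) x"
      by (rule partial_deriv_cong_open[where U = "- cball 0 1"]) (use that z in auto)
    then show ?thesis by simp
  qed
  have "((\<lambda>t. LINT x|lborel. F (x + t *\<^sub>R ?a)) has_vector_derivative (LINT x|lborel. partial_deriv k F (x + 0 *\<^sub>R ?a)))
      (at 0 within {-1..1})"
  proof (rule leibniz_bounded_support[where R = 2])
    show "((\<lambda>t. F (x + t *\<^sub>R ?a)) has_vector_derivative partial_deriv k F (x + t *\<^sub>R ?a)) (at t within {-1..1})" for x t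
      by (rule has_vector_derivative_at_within[OF has_vector_derivative_axis[OF d]])
    show "continuous_on UNIV (\<lambda>x. F (x + t *\<^sub>R ?a))" for t
      by (rule continuous_on_compose2[OF cF]) (auto intro!: continuous_intros)
    show "continuous_on ({- 1..1} \<times> UNIV) (\<lambda>(t, x). partial_deriv k F (x + t *\<^sub>R ?a))"
      unfolding split_beta by (rule continuous_on_compose2[OF c]) (auto intro!: continuous_intros)
  qed (use far z z' in auto)
  moreover have "(LINT x|lborel. F (x + t *\<^sub>R ?a)) = (LINT x|lborel. F x)" for t
  proof -
    have "(LINT x|lborel. F x) = (LINT x|distr lborel borel ((+) (t *\<^sub>R ?a)). F x)"
      by (simp add: lborel_distr_plus)
    also have "\<dots> = (LINT x|lborel. F (t *\<^sub>R ?a + x))"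
      using borel_measurable_continuous_onI[OF cF] by (intro integral_distr) auto
    finally show ?thesis by (simp add: add.commute)
  qed
  ultimately have "((\<lambda>t. LINT x|lborel. F x) has_vector_derivative (LINT x|lborel. partial_deriv k F x)) (at 0 within {-1..1})"
    by simp
  moreover have "((\<lambda>t. LINT x|lborel. F x) has_vector_derivative 0) (at 0 within {-1..1})" by simp
  ultimately show ?thesis
    using vector_derivative_unique_within[of "0::real" "{-1..1}"] 
    by (metis at_within_Icc_at greaterThanLessThan_iff neg_less_0_iff_less trivial_limit_at zero_less_one vector_derivative_unique_at)
qed


section \<open>Nonstationary phase away from the critical point\<close>

text \<open>Together with the next lemma, shows that functions with symbol bounds in the punctured ball extend as
functions of class \<open>C\<^sup>1\<close> across the origin as soon as they are of size \<open>norm x ^ 2\<close>.\<close>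

lemma flat_at_zero:
  fixes G :: "real^'n::finite \<Rightarrow> complex" and B :: real
  assumes R: "R > 0" and b: "\<And>x. norm x < R \<Longrightarrow> norm (G x) \<le> B * norm x ^ 2"
  shows "(G has_derivative (\<lambda>_. 0)) (at 0)"
proof -
  have G0: "G 0 = 0" using b[of 0] R by simp
  show ?thesis
    unfolding has_derivative_at_alt
  proof safe
    fix e :: real assume e: "e > 0"
    show "\<exists>d>0. \<forall>y. norm (y - 0) < d \<longrightarrow> norm (G y - G 0 - 0) \<le> e * norm (y - 0)"
    proof (intro exI conjI allI impI)
      show "min R (e / (\<bar>B\<bar> + 1)) > 0" using R e by simp
      fix y :: "real^'n" assume y: "norm (y - 0) < min R (e / (\<bar>B\<bar> + 1))"
      then have "norm (G y) \<le> B * norm y ^ 2" using b by simp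
      also have "\<dots> \<le> (\<bar>B\<bar> + 1) * norm y ^ 2" by (intro mult_right_mono) auto
      also have "\<dots> = ((\<bar>B\<bar> + 1) * norm y) * norm y" by (simp add: power2_eq_square)
      also have "\<dots> \<le> e * norm y"
        using y by (intro mult_right_mono) (auto simp: field_simps)
      finally show "norm (G y - G 0 - 0) \<le> e * norm (y - 0)" by (simp add: G0)
    qed
  qed simp
qed

lemma isCont_at_zero:
  fixes G :: "real^'n::finite \<Rightarrow> complex" and B :: real
  assumes R: "R > 0" and b: "\<And>x. norm x < R \<Longrightarrow> norm (G x) \<le> B * norm x"
  shows "isCont G 0"
proof -
  have G0: "G 0 = 0" using b[of 0] R by simp
  have "(G \<longlongrightarrow> 0) (at 0)"
  proof (rule Lim_null_comparison)
    show "\<forall>\<^sub>F x in at 0. norm (G x) \<le> B * norm x"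
      using R b unfolding eventually_at by (auto simp: dist_norm intro!: exI[of _ R])
    have "((\<lambda>x::real^'n. B * norm x) \<longlongrightarrow> B * norm (0::real^'n)) (at 0)"
      by (rule tendsto_mult_left[OF tendsto_norm[OF tendsto_ident_at]])
    then show "((\<lambda>x::real^'n. B * norm x) \<longlongrightarrow> 0) (at 0)" by simp
  qed
  then show ?thesis by (simp add: isCont_def G0)
qed

text \<open>The divergence of \<open>f X\<close>.  If \<open>X\<close> takes \<open>\<psi>\<close> to 1, then the operator \<open>(h / \<i>) X\<close> leaves
  \<open>exp (\<i> \<psi> / h)\<close> invariant, and its transpose is \<open>\<i> h\<close> times this divergence.\<close>

definition transport :: "('n \<Rightarrow> real^'n::finite \<Rightarrow> complex) \<Rightarrow> (real^'n \<Rightarrow> complex) \<Rightarrow> real^'n \<Rightarrow> complex" where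
  "transport X f x = (\<Sum>k\<in>UNIV. partial_deriv k (\<lambda>x. X k x * f x) x)"

context
  fixes R :: real
begin

lemma punctured_symb_add:
  "symb n (ball 0 R - {0}) norm c f \<Longrightarrow> symb n (ball 0 R - {0}) norm d g
    \<Longrightarrow> symb n (ball 0 R - {0}) norm (\<lambda>x. c x + d x) (\<lambda>x. f x + g x)"
  by (rule symb_add) auto

lemma punctured_symb_mult:
  "symb n (ball 0 R - {0}) norm c f \<Longrightarrow> symb n (ball 0 R - {0}) norm d g
    \<Longrightarrow> symb n (ball 0 R - {0}) norm (\<lambda>x. 2 ^ n * (c x * d x)) (\<lambda>x. f x * g x)"
  by (rule symb_mult) auto

lemma punctured_symb_cmult:
  "symb n (ball 0 R - {0}) norm c f \<Longrightarrow> symb n (ball 0 R - {0}) norm (\<lambda>x. norm a * c x) (\<lambda>x. a * f x)"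
  by (rule symb_cmult) auto

lemma punctured_symb_partial:
  "symb (Suc n) (ball 0 R - {0}) norm c f
    \<Longrightarrow> symb n (ball 0 R - {0}) norm (\<lambda>x. c x / norm x) (partial_deriv k f)"
  by (rule symb_partial) auto

lemma punctured_symb_sum:
  fixes f :: "'n::finite \<Rightarrow> real^'n \<Rightarrow> complex"
  shows "(\<And>i. symb n (ball 0 R - {0}) norm (c i) (f i))
    \<Longrightarrow> symb n (ball 0 R - {0}) norm (\<lambda>x. \<Sum>i\<in>UNIV. c i x) (\<lambda>x. \<Sum>i\<in>UNIV. f i x)"
  by (rule symb_sum) auto

end

context
  fixes R h :: real and S :: "(real^'n::finite) set" and \<psi> :: "real^'n \<Rightarrow> complex"
    and X :: "'n \<Rightarrow> real^'n \<Rightarrow> complex" and b :: real and U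
  defines "U \<equiv> ball 0 R - {0}"
  assumes R: "0 < R" "R \<le> 1" and S: "closed S" "S \<subseteq> ball 0 R" and h: "h > 0" and \<psi>: "smooth \<psi>"
    and X1: "\<And>x. x \<in> U \<Longrightarrow> (\<Sum>k\<in>UNIV. X k x * partial_deriv k \<psi> x) = 1"
begin

lemma punctured: "open U" "\<And>x. x \<in> U \<Longrightarrow> norm x > 0"
  by (auto simp: U_def)

lemma punctured_cases: "x \<in> U \<or> x = 0 \<or> x \<notin> S"
  using S(2) by (auto simp: U_def)

context
  fixes f :: "real^'n \<Rightarrow> complex" and n m :: nat and c :: real
  assumes n: "n \<ge> 2" and m: "m \<ge> 3" and fS: "\<And>x. x \<notin> S \<Longrightarrow> f x = 0" and f0: "f 0 = 0"
    and f: "symb n U norm (\<lambda>x. c * norm x ^ m) f"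
    and X: "\<And>k. symb n U norm (\<lambda>x. b / norm x) (X k)"
begin

lemma product_symb: "symb n U norm (\<lambda>x. (2 ^ n * b * c) * norm x ^ (m - 1)) (\<lambda>x. X k x * f x)"
proof (rule symb_mono[OF symb_mult[OF punctured X f]])
  fix x :: "real^'n" assume x: "x \<in> U"
  have "norm x ^ m = norm x * norm x ^ (m - 1)" using m by (cases m) auto
  then show "2 ^ n * (b / norm x * (c * norm x ^ m)) \<le> (2 ^ n * b * c) * norm x ^ (m - 1)"
    using punctured(2)[OF x] by simp
qed auto

lemma product_partial_symb: 
  "symb (n - 1) U norm (\<lambda>x. (2 ^ n * b * c) * norm x ^ (m - 2)) (partial_deriv j (\<lambda>x. X k x * f x))"
proof (rule symb_mono[OF symb_partial[OF punctured(2)]])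
  show "symb (Suc (n - 1)) U norm (\<lambda>x. (2 ^ n * b * c) * norm x ^ (m - 1)) (\<lambda>x. X k x * f x)"
    using n product_symb by simp
  fix x :: "real^'n" assume x: "x \<in> U"
  have "norm x ^ (m - 1) = norm x * norm x ^ (m - 2)" using m by (cases m; cases "m - 1") auto
  then show "(2 ^ n * b * c) * norm x ^ (m - 1) / norm x \<le> (2 ^ n * b * c) * norm x ^ (m - 2)"
    using punctured(2)[OF x] by simp
qed auto

lemma product_const_nonneg: "0 \<le> 2 ^ n * b * c"
proof -
  define k :: 'n where "k = undefined"
  \<comment> \<open>any point of the punctured ball shows the sign of the constant\<close>
  let ?x = "(R / 2) *\<^sub>R axis k 1 :: real^'n"
  have "?x \<in> U" using R by (auto simp: U_def)
  from symb_nonneg[OF product_symb this] punctured(2)[OF this] show ?thesis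
    by (meson mult_neg_pos not_less zero_less_power)
qed

lemma product_outside: "x \<notin> S \<Longrightarrow> partial_deriv j (\<lambda>x. X k x * f x) x = 0"
  using partial_deriv_cong_open[of "- S" x "\<lambda>x. X k x * f x" "\<lambda>_. 0"] S(1) fS by (simp add: open_Compl)

lemma product_at_zero: "((\<lambda>x. X k x * f x) has_derivative (\<lambda>_. 0)) (at 0)"
proof (rule flat_at_zero[OF R(1)])
  fix x :: "real^'n" assume x: "norm x < R"
  show "norm (X k x * f x) \<le> (2 ^ n * b * c) * norm x ^ 2"
  proof (cases "x = 0")
    case False
    then have "x \<in> U" using x by (simp add: U_def)
    from symb_bound[OF product_symb this, of k]
    have "norm (X k x * f x) \<le> (2 ^ n * b * c) * norm x ^ (m - 1)" .
    also have "\<dots> \<le> (2 ^ n * b * c) * norm x ^ 2"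
      using x R m by (intro mult_left_mono power_decreasing product_const_nonneg) auto
    finally show ?thesis .
  qed (simp add: f0)
qed

lemma product_differentiable: "(\<lambda>x. X k x * f x) differentiable (at x)"
proof -
  consider "x \<in> U" | "x = 0" | "x \<notin> S" using punctured_cases by blast
  then show ?thesis
  proof cases
    case 1 then show ?thesis using symb_differentiable[OF product_symb] by blast
  next
    case 2 then show ?thesis using product_at_zero by (auto simp: differentiable_def)
  next
    case 3
    show ?thesis
      by (rule differentiable_cong_open[of "- S" x "\<lambda>_. 0"]) (use 3 S(1) fS in \<open>auto simp: open_Compl\<close>)
  qed
qed

lemma product_partial_zero: "partial_deriv j (\<lambda>x. X k x * f x) 0 = 0"
  using partial_deriv_eq[OF product_at_zero] .

lemma product_partial_continuous: "continuous_on UNIV (partial_deriv j (\<lambda>x. X k x * f x))"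
proof (rule continuous_at_imp_continuous_on, rule ballI)
  fix x :: "real^'n"
  let ?G = "partial_deriv j (\<lambda>x. X k x * f x)"
  consider "x \<in> U" | "x = 0" | "x \<notin> S" using punctured_cases by blast
  then show "isCont ?G x"
  proof cases
    case 1 then show ?thesis 
      using symb_differentiable[OF product_partial_symb] differentiable_imp_continuous_within by blast
  next
    case 2
    have "isCont ?G 0"
    proof (rule isCont_at_zero[OF R(1)])
      fix x :: "real^'n" assume x: "norm x < R"
      show "norm (?G x) \<le> (2 ^ n * b * c) * norm x"
      proof (cases "x = 0")
        case False
        then have "x \<in> U" using x by (simp add: U_def)
        from symb_bound[OF product_partial_symb this]
        have "norm (?G x) \<le> (2 ^ n * b * c) * norm x ^ (m - 2)" .
        also have "\<dots> \<le> (2 ^ n * b * c) * norm x ^ 1"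
          using x R m by (intro mult_left_mono power_decreasing product_const_nonneg) auto
        finally show ?thesis by simp
      qed (simp add: product_partial_zero)
    qed
    then show ?thesis using 2 by simp
  next
    case 3
    have "?G differentiable (at x)"
      by (rule differentiable_cong_open[of "- S" x "\<lambda>_. 0"])
         (use 3 S(1) product_outside in \<open>auto simp: open_Compl\<close>)
    then show ?thesis using differentiable_imp_continuous_within by blast
  qed
qed

lemma transport_outside: "x \<notin> S \<Longrightarrow> transport X f x = 0"
  by (simp add: transport_def product_outside)

lemma transport_zero: "transport X f 0 = 0"
  by (simp add: transport_def product_partial_zero)

lemma transport_symb: "symb (n - 1) U norm (\<lambda>x. (real CARD('n) * 2 ^ n * b * c) * norm x ^ (m - 2)) (transport X f)"
  using punctured_symb_sum[OF product_partial_symb[unfolded U_def]]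
  by (simp add: transport_def[abs_def] mult_ac U_def)

text \<open>One integration by parts.  The vector field is singular at 0, but the product \<open>X f\<close> is of class
\<open>C\<^sup>1\<close> everywhere because \<open>f\<close> vanishes to third order.\<close>

lemma transport_integral:
  "(LINT x|lborel. exp (\<i> / of_real h * \<psi> x) * f x)
     = \<i> * of_real h * (LINT x|lborel. exp (\<i> / of_real h * \<psi> x) * transport X f x)"
proof -
  let ?e = "\<lambda>x. exp (\<i> / of_real h * \<psi> x)" and ?G = "\<lambda>k x. X k x * f x"
  have d\<psi>: "\<psi> differentiable (at x)" for x using smooth_differentiable[OF \<psi>] .
  have d: "(\<lambda>x. \<i> / of_real h * \<psi> x) differentiable (at x)" for x
    using d\<psi>[of x] by (intro derivative_intros) auto
  have de: "partial_deriv k ?e x = ?e x * (\<i> / of_real h * partial_deriv k \<psi> x)" "?e differentiable (at x)" for k x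
    using partial_deriv_exp[OF d[of x]] partial_deriv_cmult[OF d\<psi>[of x], of k "\<i> / of_real h"] by simp_all
  have ce: "continuous_on UNIV ?e"
    using de(2) by (simp add: continuous_at_imp_continuous_on differentiable_imp_continuous_within)
  have cG: "continuous_on UNIV (?G k)" for k
    using product_differentiable by (simp add: continuous_at_imp_continuous_on differentiable_imp_continuous_within)
  have c\<psi>: "continuous_on UNIV (partial_deriv k \<psi>)" for k
    by (rule smooth_continuous[OF smooth_partial[OF \<psi>]])
  have far: "x \<notin> S" if "norm x > 1" for x using that S R by (force simp: subset_iff)
  let ?A = "\<lambda>k x. ?e x * (partial_deriv k \<psi> x * ?G k x)" and ?B = "\<lambda>k x. ?e x * partial_deriv k (?G k) x"
  have iA: "integrable lborel (?A k)" for k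
  proof (rule integrable_bounded_support[of _ 1])
    show "continuous_on UNIV (?A k)" by (intro continuous_on_mult ce cG c\<psi>)
  qed (use far fS in auto)
  have iB: "integrable lborel (?B k)" for k
  proof (rule integrable_bounded_support[of _ 1])
    show "continuous_on UNIV (?B k)" by (intro continuous_on_mult ce product_partial_continuous)
  qed (use far product_outside in auto)
  have "(LINT x|lborel. \<i> / of_real h * ?A k x + ?B k x) = 0" for k
  proof -
    have pd: "partial_deriv k (\<lambda>x. ?e x * ?G k x) x = \<i> / of_real h * ?A k x + ?B k x" for x
      using partial_deriv_mult[OF de(2)[of x] product_differentiable[where k = k and x = x], of k] de(1)[of k x] by (simp add: algebra_simps)
    have "(LINT x|lborel. partial_deriv k (\<lambda>x. ?e x * ?G k x) x) = 0"
    proof (rule integral_partial_deriv)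
      show "(\<lambda>x. ?e x * ?G k x) differentiable at x" for x
        using de(2)[of x] product_differentiable[of k x] by (rule differentiable_mult)
      show "continuous_on UNIV (partial_deriv k (\<lambda>x. ?e x * ?G k x))"
        unfolding pd[abs_def]
        by (intro continuous_on_add continuous_on_mult continuous_on_const ce cG c\<psi> product_partial_continuous)
      show "?e x * ?G k x = 0" if "norm x > 1" for x using far[OF that] fS by simp
    qed
    then show ?thesis unfolding ext[OF pd] .
  qed
  then have 0: "\<i> / of_real h * (LINT x|lborel. ?A k x) + (LINT x|lborel. ?B k x) = 0" for k
    using Bochner_Integration.integral_add[OF integrable_mult_right[OF iA, of "\<i> / of_real h"] iB, of k k]
    by (simp only: integral_mult_right_zero)
  have 1: "(\<Sum>k\<in>UNIV. LINT x|lborel. ?A k x) = (LINT x|lborel. ?e x * f x)"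
  proof -
    have "(\<Sum>k\<in>UNIV. ?A k x) = ?e x * f x" for x
    proof (cases "x \<in> U")
      case True
      have "(\<Sum>k\<in>UNIV. ?A k x) = ?e x * f x * (\<Sum>k\<in>UNIV. X k x * partial_deriv k \<psi> x)"
        by (simp add: sum_distrib_left mult_ac)
      then show ?thesis using X1[OF True] by simp
    next
      case False
      then have "f x = 0" using fS f0 punctured_cases[of x] by auto
      then show ?thesis by simp
    qed
    moreover have "(\<Sum>k\<in>UNIV. LINT x|lborel. ?A k x) = (LINT x|lborel. (\<Sum>k\<in>UNIV. ?A k x))"
      by (rule Bochner_Integration.integral_sum[symmetric]) (rule iA)
    ultimately show ?thesis by simp
  qed
  have 2: "(\<Sum>k\<in>UNIV. LINT x|lborel. ?B k x) = (LINT x|lborel. ?e x * transport X f x)"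
  proof -
    have "(\<Sum>k\<in>UNIV. LINT x|lborel. ?B k x) = (LINT x|lborel. (\<Sum>k\<in>UNIV. ?B k x))"
      by (rule Bochner_Integration.integral_sum[symmetric]) (rule iB)
    then show ?thesis by (simp only: transport_def sum_distrib_left)
  qed
  have "\<i> / of_real h * (LINT x|lborel. ?e x * f x) + (LINT x|lborel. ?e x * transport X f x) = 0"
    unfolding 1[symmetric] 2[symmetric] sum_distrib_left sum.distrib[symmetric] by (simp only: 0 sum.neutral_const)
  then have "\<i> * of_real h * (LINT x|lborel. ?e x * transport X f x)
      = \<i> * of_real h * - (\<i> / of_real h * (LINT x|lborel. ?e x * f x))"
    by (simp add: add_eq_0_iff)
  also have "\<dots> = (LINT x|lborel. ?e x * f x)" using h by simp
  finally show ?thesis by simp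
qed

end

text \<open>Every integration by parts gains \<open>h * b\<close> and lowers the order of vanishing of the amplitude by two, one
for the division by \<open>norm x\<close> in \<open>X\<close> and one for the derivative.  The order has to be at least 3 before
each step, which explains \<open>2 * p + 1\<close>.  After the last step the integrand is bounded by its modulus.\<close>

lemma nonstationary_phase:
  assumes Im: "\<And>x. x \<in> S \<Longrightarrow> Im (\<psi> x) \<ge> 0" and fS: "\<And>x. x \<notin> S \<Longrightarrow> f x = 0" and f0: "f 0 = 0"
    and X: "\<And>k. symb (Suc p) U norm (\<lambda>x. b / norm x) (X k)"
    and f: "symb (Suc p) U norm (\<lambda>x. c * norm x ^ m) f" and m: "m \<ge> 2 * p + 1"
  shows "norm (LINT x|lborel. exp (\<i> / of_real h * \<psi> x) * f x)
    \<le> measure lborel (cball (0::real^'n) 1) * (real CARD('n) * 2 ^ Suc p) ^ p * (h * b) ^ p * c"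
  using fS f0 f m X
proof (induction p arbitrary: f c m)
  case 0
  \<comment> \<open>\<open>c\<close> is nonnegative since it bounds a norm at some point of the punctured ball\<close>
  define k :: 'n where "k = undefined"
  have xU: "(R / 2) *\<^sub>R axis k 1 \<in> U" using R by (auto simp: U_def)
  have c: "c \<ge> 0" using symb_nonneg[OF 0(3) xU] punctured(2)[OF xU]
    by (meson mult_neg_pos not_less zero_less_power)
  have "norm (LINT x|lborel. exp (\<i> / of_real h * \<psi> x) * f x) \<le> c * measure lborel (cball (0::real^'n) 1)"
  proof (rule norm_integral_bounded_support)
    fix x :: "real^'n"
    show "exp (\<i> / of_real h * \<psi> x) * f x = 0" if "norm x > 1"
      using that S R 0(1)[of x] by (force simp: subset_iff)
    show "norm (exp (\<i> / of_real h * \<psi> x) * f x) \<le> c" if x: "norm x \<le> 1"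
    proof (cases "x \<in> S \<and> x \<noteq> 0")
      case True
      then have xU: "x \<in> U" using S by (auto simp: U_def)
      have "norm (exp (\<i> / of_real h * \<psi> x)) \<le> 1"
        using Im[of x] True h by (simp add: norm_exp_eq_Re divide_nonneg_pos)
      moreover have "norm (f x) \<le> c * 1"
        using symb_bound[OF 0(3) xU] mult_left_mono[OF power_le_one[OF norm_ge_zero x] c] by (rule order_trans)
      ultimately have "norm (exp (\<i> / of_real h * \<psi> x)) * norm (f x) \<le> 1 * (c * 1)"
        by (intro mult_mono) auto
      then show ?thesis by (simp add: norm_mult)
    next
      case False
      then show ?thesis using 0(1,2) c by auto
    qed
  qed
  then show ?case by (simp add: mult_ac)
next
  case (Suc p)
  have X': "symb (Suc p) U norm (\<lambda>x. b / norm x) (X k)" for k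
    using symb_less[OF Suc.prems(5)] by simp
  have m3: "m \<ge> 3" and n2: "Suc (Suc p) \<ge> 2" using Suc.prems(4) by auto
  note T = m3 Suc.prems(1,2,3,5)
  let ?c = "real CARD('n) * 2 ^ Suc (Suc p) * b * c"
  have "norm (LINT x|lborel. exp (\<i> / of_real h * \<psi> x) * f x)
     = h * norm (LINT x|lborel. exp (\<i> / of_real h * \<psi> x) * transport X f x)"
    by (subst transport_integral[OF n2 T]) (use h in \<open>auto simp: norm_mult\<close>)
  also have "\<dots> \<le> h * (measure lborel (cball (0::real^'n) 1) * (real CARD('n) * 2 ^ Suc p) ^ p * (h * b) ^ p * ?c)"
  proof (intro mult_left_mono Suc.IH X')
    show "transport X f x = 0" if "x \<notin> S" for x by (rule transport_outside[OF n2 T that])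
    show "transport X f 0 = 0" by (rule transport_zero[OF n2 T])
    show "symb (Suc p) U norm (\<lambda>x. ?c * norm x ^ (m - 2)) (transport X f)"
      using transport_symb[OF n2 T] by simp
    show "2 * p + 1 \<le> m - 2" using Suc.prems(4) by simp
  qed (use h in auto)
  also have "\<dots> = (measure lborel (cball (0::real^'n) 1) * (h * b) ^ Suc p * c) * 
       ((real CARD('n) * 2 ^ Suc p) ^ p * (real CARD('n) * 2 ^ Suc (Suc p)))"
    by (simp add: algebra_simps)
  also have "\<dots> \<le> (measure lborel (cball (0::real^'n) 1) * (h * b) ^ Suc p * c) * 
       ((real CARD('n) * 2 ^ Suc (Suc p)) ^ p * (real CARD('n) * 2 ^ Suc (Suc p)))"
  proof (intro mult_left_mono mult_right_mono power_mono)
    define k :: 'n where "k = undefined"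
    have xU: "(R / 2) *\<^sub>R axis k 1 \<in> U" using R by (auto simp: U_def)
    have c: "c \<ge> 0" using symb_nonneg[OF Suc.prems(3) xU] punctured(2)[OF xU]
      by (meson mult_neg_pos not_less zero_less_power)
    have b: "b \<ge> 0" using symb_nonneg[OF X' xU] punctured(2)[OF xU]
      by (simp add: zero_le_divide_iff)
    show "0 \<le> measure lborel (cball (0::real^'n) 1) * (h * b) ^ Suc p * c"
      using b c h by simp
    show "(2::real) ^ Suc p \<le> 2 ^ Suc (Suc p)" by (rule power_increasing) auto
  qed auto
  finally show ?case by (simp add: algebra_simps)
qed

end

text \<open>The components of \<open>x\<close> are of size \<open>norm x\<close>, so \<open>x\<^sub>1\<^sup>2 + \<dots> + x\<^sub>d\<^sup>2\<close> is of size \<open>d * 2 ^ n * norm x ^ 2\<close>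
as a symbol; this exceeds its value by the ratio that enters the constant.\<close>

definition field_const :: "nat \<Rightarrow> nat \<Rightarrow> real" where
  "field_const d n = inverse_const (real d * 2 ^ n) n"

text \<open>The field is \<open>W\<^sup>T x / \<bar>x\<bar>\<^sup>2\<close>; applied to the quadratic phase \<open>\<langle>H x, x\<rangle> / 2\<close> with \<open>W H = 1\<close> it gives 1.\<close>

lemma vector_field_symb:
  fixes W :: "complex^'n::finite^'n" and \<beta> :: real
  assumes W: "\<And>k l. norm (W $ k $ l) \<le> \<beta>"
  shows "symb n (ball 0 R - {0}) norm (\<lambda>x. field_const CARD('n) n * \<beta> / norm x)
    (\<lambda>x. (\<Sum>l\<in>UNIV. W $ l $ k * of_real (x $ l)) * inverse (\<Sum>l\<in>UNIV. of_real (x $ l) * of_real (x $ l)))"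
proof -
  define a where "a = real CARD('n) * 2 ^ n"
  have a: "a > 0" by (simp add: a_def)
  let ?K = "field_const CARD('n) n" and ?U = "ball 0 R - {0} :: (real^'n) set"
  have U: "open ?U" and w: "\<And>x. x \<in> ?U \<Longrightarrow> norm x > 0" by auto
  have co: "symb n ?U norm norm (\<lambda>x. of_real (x $ l))" for l by (rule symb_coord) auto
  have "symb n ?U norm (\<lambda>x. inverse_const a n / (a * norm x ^ 2)) (\<lambda>x. inverse (\<Sum>l\<in>UNIV. of_real (x $ l) * of_real (x $ l)))"
  proof (rule symb_inverse[OF U w])
    show "symb n ?U norm (\<lambda>x. a * (norm x)\<^sup>2) (\<lambda>x. \<Sum>l\<in>UNIV. of_real (x $ l) * of_real (x $ l))"
      using punctured_symb_sum[OF punctured_symb_mult[OF co co]]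
      by (simp add: a_def power2_eq_square mult_ac)
  qed (use a in \<open>auto simp: norm_sq_complex norm_power\<close>)
  moreover have "symb n ?U norm (\<lambda>x. real CARD('n) * \<beta> * norm x) (\<lambda>x. \<Sum>l\<in>UNIV. W $ l $ k * of_real (x $ l))"
  proof (rule symb_mono[OF punctured_symb_sum[OF punctured_symb_cmult[OF co]]])
    fix x :: "real^'n"
    have "(\<Sum>l\<in>UNIV. norm (W $ l $ k) * norm x) \<le> (\<Sum>l\<in>(UNIV::'n set). \<beta> * norm x)"
      using W by (intro sum_mono mult_right_mono) auto
    then show "(\<Sum>l\<in>UNIV. norm (W $ l $ k) * norm x) \<le> real CARD('n) * \<beta> * norm x" by simp
  qed auto
  ultimately have "symb n ?U norm (\<lambda>x. 2 ^ n * ((real CARD('n) * \<beta> * norm x) * (?K / (a * norm x ^ 2))))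
     (\<lambda>x. (\<Sum>l\<in>UNIV. W $ l $ k * of_real (x $ l)) * inverse (\<Sum>l\<in>UNIV. of_real (x $ l) * of_real (x $ l)))"
    unfolding field_const_def a_def[symmetric] using punctured_symb_mult by blast
  then show ?thesis
    by (rule symb_mono) (auto simp: a_def power2_eq_square field_simps)
qed

text \<open>Here \<open>M'\<close> bounds, as a symbol, the factor \<open>q\<close> by which the remainder of the phase disturbs the field
\<open>W x / \<bar>x\<bar>\<^sup>2\<close>; its reciprocal is estimated with the ratio \<open>2 * M'\<close>, since \<open>q\<close> is at least 1/2 in modulus.\<close>

definition perturbed_field_const :: "nat \<Rightarrow> nat \<Rightarrow> real \<Rightarrow> real" where
  "perturbed_field_const d n M = (let M' = 1 + real d * 2 ^ n * field_const d n * M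
     in 2 ^ n * (field_const d n * (inverse_const (2 * M') n / M')))"

lemma field_const_pos: "field_const d n > 0"
  by (simp add: field_const_def inverse_const_pos)

lemma perturbed_field_const_pos: "M \<ge> 0 \<Longrightarrow> perturbed_field_const d n M > 0"
  using field_const_pos[of d n]
  by (auto simp: perturbed_field_const_def Let_def inverse_const_pos intro!: mult_pos_pos divide_pos_pos add_pos_nonneg)

text \<open>Divide the field for the quadratic part of the phase by its value \<open>q\<close> on the full phase.  The
assumption \<open>small\<close> keeps \<open>q\<close> away from 0, and \<open>bM\<close> makes the result uniform: in terms of \<open>h\<close>,
the factors of \<open>\<beta> * cg * R\<close> are \<open>h\<close> to the powers \<open>- \<sigma>\<close>, \<open>- \<mu> - \<nu>\<close> and \<open>\<rho>\<close>, which cancel.\<close>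

lemma perturbed_vector_field:
  fixes W H :: "complex^'n::finite^'n" and \<beta> cg M :: real
  assumes R: "R > 0" and M: "M \<ge> 0" and WH: "W ** H = mat 1" and W: "\<And>k l. norm (W $ k $ l) \<le> \<beta>"
    and g: "symb (Suc n) (ball 0 R - {0}) norm (\<lambda>x. cg * norm x ^ 3) g" and bM: "\<beta> * cg * R \<le> M" and s: "norm s \<le> 1"
    and small: "\<And>x. x \<in> ball 0 R \<Longrightarrow>
      norm (\<Sum>k\<in>UNIV. (\<Sum>l\<in>UNIV. W $ l $ k * of_real (x $ l)) * partial_deriv k g x) \<le> norm x ^ 2 / 2"
  obtains X where "\<And>k. symb n (ball 0 R - {0}) norm (\<lambda>x. perturbed_field_const CARD('n) n M * \<beta> / norm x) (X k)"
    and "\<And>x. x \<in> ball 0 R - {0} \<Longrightarrow>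
      (\<Sum>k\<in>UNIV. X k x * ((\<Sum>l\<in>UNIV. H $ k $ l * of_real (x $ l)) + s * partial_deriv k g x)) = 1"
proof -
  let ?K1 = "field_const CARD('n) n"
  define M' where "M' = 1 + real CARD('n) * 2 ^ n * ?K1 * M"
  have K1: "?K1 > 0" by (rule field_const_pos)
  have M': "M' > 0" using M K1 by (auto simp: M'_def intro: add_pos_nonneg)
  let ?U = "ball 0 R - {0} :: (real^'n) set"
  have U: "open ?U" and w: "\<And>x. x \<in> ?U \<Longrightarrow> norm x > 0" by auto
  define V where "V k x = (\<Sum>l\<in>UNIV. W $ l $ k * of_real (x $ l)) * inverse (\<Sum>l\<in>UNIV. of_real (x $ l) * of_real (x $ l))" 
    for k and x :: "real^'n"
  \<comment> \<open>the value on the full phase of the field \<open>V\<close>, which takes the quadratic part to 1\<close>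
  define q where "q x = 1 + s * (\<Sum>k\<in>UNIV. V k x * partial_deriv k g x)" for x
  have V: "symb n ?U norm (\<lambda>x. ?K1 * \<beta> / norm x) (V k)" for k
    unfolding V_def[abs_def] by (rule vector_field_symb[OF W])
  have "symb n ?U norm (\<lambda>x. cg * norm x ^ 2) (partial_deriv k g)" for k
    by (rule symb_mono[OF punctured_symb_partial[OF g]]) (auto simp: power3_eq_cube power2_eq_square)
  from punctured_symb_mult[OF V this]
  have "symb n ?U norm (\<lambda>x. 2 ^ n * (?K1 * M)) (\<lambda>x. V k x * partial_deriv k g x)" for k
  proof (rule symb_mono)
    fix x :: "real^'n" assume x: "x \<in> ?U"
    define k :: 'n where "k = undefined"
    have "0 \<le> ?K1 * \<beta> / norm x" "0 \<le> cg * norm x ^ 3" using symb_nonneg[OF V x] symb_nonneg[OF g x] by auto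
    then have nn: "0 \<le> \<beta>" "0 \<le> cg" using w[OF x] K1 by (auto simp: zero_le_divide_iff zero_le_mult_iff)
    have "\<beta> * cg * norm x \<le> \<beta> * cg * R" using x nn by (intro mult_left_mono) auto
    then have "2 ^ n * (?K1 * (\<beta> * cg * norm x)) \<le> 2 ^ n * (?K1 * M)"
      using bM K1 by (intro mult_left_mono) auto
    then show "2 ^ n * (?K1 * \<beta> / norm x * (cg * (norm x)\<^sup>2)) \<le> 2 ^ n * (?K1 * M)"
      using w[OF x] by (simp add: power2_eq_square mult_ac)
  qed auto
  from punctured_symb_cmult[OF punctured_symb_sum[OF this], of s]
  have "symb n ?U norm (\<lambda>x. norm s * (real CARD('n) * (2 ^ n * (?K1 * M)))) (\<lambda>x. s * (\<Sum>k\<in>UNIV. V k x * partial_deriv k g x))"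
    by simp
  from punctured_symb_add[OF symb_const this, of 1]
  have "symb n ?U norm (\<lambda>x. 1 + norm s * (real CARD('n) * (2 ^ n * (?K1 * M)))) q"
    by (simp add: q_def[abs_def])
  then have q: "symb n ?U norm (\<lambda>x. M') q"
  proof (rule symb_mono)
    have "norm s * (real CARD('n) * (2 ^ n * (?K1 * M))) \<le> 1 * (real CARD('n) * (2 ^ n * (?K1 * M)))"
      using s K1 M by (intro mult_right_mono) auto
    then show "1 + norm s * (real CARD('n) * (2 ^ n * (?K1 * M))) \<le> M'" by (simp add: M'_def mult_ac)
  qed auto
  have q_half: "norm (q x) \<ge> 1 / 2" if x: "x \<in> ?U" for x
  proof -
    have "(\<Sum>k\<in>UNIV. V k x * partial_deriv k g x) 
        = (\<Sum>k\<in>UNIV. (\<Sum>l\<in>UNIV. W $ l $ k * of_real (x $ l)) * partial_deriv k g x) / of_real (norm x ^ 2)"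
      unfolding V_def norm_sq_complex by (simp add: sum_divide_distrib divide_inverse mult_ac sum_distrib_left)
    then have "norm (\<Sum>k\<in>UNIV. V k x * partial_deriv k g x) \<le> 1 / 2"
      using small[of x] x w[OF x] by (simp add: norm_divide norm_power divide_le_eq)
    then have "norm s * norm (\<Sum>k\<in>UNIV. V k x * partial_deriv k g x) \<le> 1 * (1 / 2)"
      using s by (intro mult_mono) auto
    then have *: "norm (s * (\<Sum>k\<in>UNIV. V k x * partial_deriv k g x)) \<le> 1 / 2" by (simp add: norm_mult)
    have "1 - norm (s * (\<Sum>k\<in>UNIV. V k x * partial_deriv k g x)) \<le> norm (q x)"
      unfolding q_def using norm_diff_ineq[of 1 "s * (\<Sum>k\<in>UNIV. V k x * partial_deriv k g x)"] by simp
    with * show ?thesis by simp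
  qed
  have qi: "symb n ?U norm (\<lambda>x. inverse_const (2 * M') n / M') (\<lambda>x. inverse (q x))"
  proof (rule symb_inverse[OF U w _ _ q])
    show "M' \<le> 2 * M' * cmod (q x)" if "x \<in> ?U" for x
      using mult_left_mono[OF q_half[OF that], of "2 * M'"] M' by simp
  qed (use M' in auto)
  show ?thesis
  proof (rule that[of "\<lambda>k x. V k x * inverse (q x)"])
    show "symb n ?U norm (\<lambda>x. perturbed_field_const CARD('n) n M * \<beta> / norm x) (\<lambda>x. V k x * inverse (q x))" for k
      using punctured_symb_mult[OF V[of k] qi]
      unfolding perturbed_field_const_def Let_def M'_def[symmetric] by (simp add: mult_ac)
    fix x :: "real^'n" assume x: "x \<in> ?U"
    have "(\<Sum>k\<in>UNIV. (\<Sum>l\<in>UNIV. W $ l $ k * of_real (x $ l)) * (\<Sum>j\<in>UNIV. H $ k $ j * of_real (x $ j)))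
      = (\<Sum>l\<in>UNIV. \<Sum>j\<in>UNIV. (W ** H) $ l $ j * of_real (x $ l) * of_real (x $ j))"
    proof -
      have "(\<Sum>k\<in>UNIV. (\<Sum>l\<in>UNIV. W $ l $ k * of_real (x $ l)) * (\<Sum>j\<in>UNIV. H $ k $ j * of_real (x $ j)))
        = (\<Sum>k\<in>UNIV. \<Sum>l\<in>UNIV. \<Sum>j\<in>UNIV. W $ l $ k * H $ k $ j * of_real (x $ l) * of_real (x $ j))"
        unfolding sum_product by (intro sum.cong refl) (simp add: mult_ac)
      also have "\<dots> = (\<Sum>l\<in>UNIV. \<Sum>k\<in>UNIV. \<Sum>j\<in>UNIV. W $ l $ k * H $ k $ j * of_real (x $ l) * of_real (x $ j))"
        by (rule sum.swap)
      also have "\<dots> = (\<Sum>l\<in>UNIV. \<Sum>j\<in>UNIV. \<Sum>k\<in>UNIV. W $ l $ k * H $ k $ j * of_real (x $ l) * of_real (x $ j))"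
        by (intro sum.cong refl sum.swap)
      finally show ?thesis by (simp add: matrix_matrix_mult_def sum_distrib_right)
    qed
    also have "\<dots> = (\<Sum>l\<in>UNIV. of_real (x $ l) * of_real (x $ l))"
      unfolding WH by (intro sum.cong refl) (simp add: mat_def if_distrib if_distribR cong: if_cong)
    finally have 1: "(\<Sum>k\<in>UNIV. V k x * (\<Sum>j\<in>UNIV. H $ k $ j * of_real (x $ j))) = 1"
      using w[OF x] unfolding V_def norm_sq_complex
      by (simp add: mult_ac flip: sum_distrib_left)
    have "(\<Sum>k\<in>UNIV. V k x * inverse (q x) * ((\<Sum>l\<in>UNIV. H $ k $ l * of_real (x $ l)) + s * partial_deriv k g x))
       = inverse (q x) * ((\<Sum>k\<in>UNIV. V k x * (\<Sum>j\<in>UNIV. H $ k $ j * of_real (x $ j))) + s * (\<Sum>k\<in>UNIV. V k x * partial_deriv k g x))"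
      by (simp add: sum_distrib_left algebra_simps sum.distrib)
    also have "\<dots> = inverse (q x) * q x" unfolding 1 q_def by simp
    also have "\<dots> = 1" using q_half[OF x] by (intro left_inverse) auto
    finally show "(\<Sum>k\<in>UNIV. V k x * inverse (q x) * ((\<Sum>l\<in>UNIV. H $ k $ l * of_real (x $ l)) + s * partial_deriv k g x)) = 1" .
  qed
qed


section \<open>The branch of the square root of the determinant\<close>

definition qform :: "complex^'n^'n::finite \<Rightarrow> real^'n \<Rightarrow> complex" where
  "qform E x = (\<Sum>k\<in>UNIV. \<Sum>l\<in>UNIV. E $ k $ l * of_real (x $ l) * of_real (x $ k))"

lemma Re_qform: "Re (qform E x) = x \<bullet> ((\<chi> k l. Re (E $ k $ l)) *v x)"
  by (simp add: qform_def inner_vec_def matrix_vector_mult_def sum_distrib_left mult_ac)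

lemma posdef_Re_iff: "E \<in> posdef_Re \<longleftrightarrow> transpose E = E \<and> (\<forall>x. x \<noteq> 0 \<longrightarrow> Re (qform E x) > 0)"
  by (simp add: posdef_Re_def Re_qform)

lemma qform_add: "qform (A + B) x = qform A x + qform B x"
  by (simp add: qform_def algebra_simps sum.distrib)

lemma qform_scaleR: "qform (c *\<^sub>R A) x = c *\<^sub>R qform A x"
  by (simp add: qform_def scaleR_sum_right)

lemma qform_mat1: "qform (mat 1) x = of_real (norm x ^ 2)"
  unfolding norm_sq_complex[symmetric] qform_def
  by (intro sum.cong refl) (simp add: mat_def if_distrib if_distribR cong: if_cong)

lemma continuous_on_qform [continuous_intros]:
  assumes "continuous_on S E"
  shows "continuous_on S (\<lambda>t. qform (E t) x)"
  unfolding qform_def using assms by (intro continuous_intros) 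

lemma continuous_on_det [continuous_intros]:
  fixes E :: "'a::topological_space \<Rightarrow> complex^'n::finite^'n"
  assumes "continuous_on S E"
  shows "continuous_on S (\<lambda>t. det (E t))"
  unfolding det_def using assms by (intro continuous_intros)

lemma symmetric_iff: "transpose E = E \<longleftrightarrow> (\<forall>k l. E $ k $ l = E $ l $ k)"
  by (auto simp: transpose_def vec_eq_iff)

lemma posdef_qform_nonneg: "E \<in> posdef_Re \<Longrightarrow> Re (qform E x) \<ge> 0"
  by (cases "x = 0") (auto simp: posdef_Re_iff qform_def less_imp_le)

text \<open>For \<open>v = p + \<i> q\<close> with real \<open>p\<close>, \<open>q\<close>, the real part of \<open>v\<^sup>* E v\<close> is the sum of the real parts of the
form at \<open>p\<close> and at \<open>q\<close>, because the cross terms cancel by symmetry.  It is positive unless \<open>v = 0\<close>, so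
the kernel of \<open>E\<close> is trivial.\<close>

lemma posdef_det_nonzero:
  fixes E :: "complex^'n::finite^'n"
  assumes "E \<in> posdef_Re"
  shows "det E \<noteq> 0"
proof
  assume "det E = 0"
  then have "\<not> (\<exists>B. B ** E = mat 1)"
    by (simp add: invertible_left_inverse[symmetric] invertible_det_nz)
  then obtain v where v: "v \<noteq> 0" "E *v v = 0"
    by (auto simp: matrix_left_invertible_ker)
  have sym: "E $ k $ l = E $ l $ k" for k l using assms by (auto simp: posdef_Re_iff symmetric_iff)
  define p q :: "real^'n" where "p = (\<chi> k. Re (v $ k))" and "q = (\<chi> k. Im (v $ k))"
  have "0 = (\<Sum>k\<in>UNIV. cnj (v $ k) * (E *v v) $ k)" using v by simp
  also have "\<dots> = (\<Sum>k\<in>UNIV. \<Sum>l\<in>UNIV. cnj (v $ k) * E $ k $ l * v $ l)"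
    by (simp add: matrix_vector_mult_def sum_distrib_left mult_ac)
  finally have "0 = Re (\<Sum>k\<in>UNIV. \<Sum>l\<in>UNIV. cnj (v $ k) * E $ k $ l * v $ l)" by (metis zero_complex.sel(1))
  also have "\<dots> = (\<Sum>k\<in>UNIV. \<Sum>l\<in>UNIV. Re (E $ k $ l) * p $ l * p $ k + Re (E $ k $ l) * q $ l * q $ k
      + (Im (E $ k $ l) * q $ k * p $ l - Im (E $ k $ l) * p $ k * q $ l))"
    by (simp add: p_def q_def algebra_simps)
  also have "\<dots> = Re (qform E p) + Re (qform E q)
      + ((\<Sum>k\<in>UNIV. \<Sum>l\<in>UNIV. Im (E $ k $ l) * q $ k * p $ l) - (\<Sum>k\<in>UNIV. \<Sum>l\<in>UNIV. Im (E $ k $ l) * p $ k * q $ l))"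
    by (simp add: qform_def sum.distrib sum_subtractf)
  also have "(\<Sum>k\<in>UNIV. \<Sum>l\<in>UNIV. Im (E $ k $ l) * q $ k * p $ l) = (\<Sum>l\<in>UNIV. \<Sum>k\<in>UNIV. Im (E $ k $ l) * q $ k * p $ l)"
    by (rule sum.swap)
  also have "\<dots> = (\<Sum>k\<in>UNIV. \<Sum>l\<in>UNIV. Im (E $ k $ l) * p $ k * q $ l)"
    by (intro sum.cong refl) (simp add: sym mult_ac)
  finally have 0: "Re (qform E p) + Re (qform E q) = 0" by simp
  have "p \<noteq> 0 \<or> q \<noteq> 0"
    using v(1) by (auto simp: p_def q_def vec_eq_iff complex_eq_iff)
  moreover have "p \<noteq> 0 \<Longrightarrow> Re (qform E p) > 0" "q \<noteq> 0 \<Longrightarrow> Re (qform E q) > 0"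
    using assms by (auto simp: posdef_Re_iff)
  ultimately have "Re (qform E p) + Re (qform E q) > 0"
    using posdef_qform_nonneg[OF assms, of p] posdef_qform_nonneg[OF assms, of q] by auto
  with 0 show False by simp
qed

text \<open>Adding a small positive multiple of the identity moves a matrix with nonnegative real part into
the open cone, so the closure consists of all these matrices.\<close>

lemma det_sqrt_domain_iff:
  fixes E :: "complex^'n::finite^'n"
  shows "E \<in> det_sqrt_domain \<longleftrightarrow> transpose E = E \<and> (\<forall>x. Re (qform E x) \<ge> 0) \<and> det E \<noteq> 0"
proof -
  have "closure posdef_Re = {E :: complex^'n^'n. transpose E = E \<and> (\<forall>x. Re (qform E x) \<ge> 0)}" (is "_ = ?C")
  proof
    have cl: "closed ?C"
      unfolding symmetric_iff
      by (intro closed_Collect_conj closed_Collect_all closed_Collect_eq closed_Collect_le continuous_intros)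
    have "posdef_Re \<subseteq> ?C" using posdef_qform_nonneg posdef_Re_iff by blast
    then show "closure posdef_Re \<subseteq> ?C" using cl by (rule closure_minimal)
    show "?C \<subseteq> closure posdef_Re"
    proof safe
      fix E :: "complex^'n^'n" assume E: "transpose E = E" "\<forall>x. Re (qform E x) \<ge> 0"
      define X where "X n = E + inverse (real (Suc n)) *\<^sub>R mat 1" for n
      have "X n \<in> posdef_Re" for n
        unfolding posdef_Re_iff
      proof safe
        show "transpose (X n) = X n" using E(1) by (auto simp: X_def symmetric_iff mat_def)
        fix x :: "real^'n" assume "x \<noteq> 0"
        then have "0 < inverse (real (Suc n)) * norm x ^ 2" by simp
        moreover have "Re (qform E x) \<ge> 0" using E(2) by blast
        ultimately have "0 < Re (qform E x) + inverse (real (Suc n)) * norm x ^ 2" by linarith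
        then show "0 < Re (qform (X n) x)"
          unfolding X_def qform_add qform_scaleR qform_mat1 by simp
      qed
      moreover have "X \<longlonglongrightarrow> E + 0 *\<^sub>R mat 1"
        unfolding X_def by (intro tendsto_intros LIMSEQ_inverse_real_of_nat)
      ultimately show "E \<in> closure posdef_Re" unfolding closure_sequential by auto
    qed
  qed
  then show ?thesis by (auto simp: det_sqrt_domain_def)
qed

lemma posdef_domain: "E \<in> posdef_Re \<Longrightarrow> E \<in> det_sqrt_domain"
  using posdef_det_nonzero closure_subset[of posdef_Re] by (auto simp: det_sqrt_domain_def)

text \<open>The segment from the identity to \<open>E\<close>.  It stays in the domain of the branch and serves both to
determine signs by continuity and to deform complex Gaussians to the real one.\<close>

definition interp :: "complex^'n^'n::finite \<Rightarrow> real \<Rightarrow> complex^'n^'n" where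
  "interp E t = (1 - t) *\<^sub>R mat 1 + t *\<^sub>R E"

lemma interp_0 [simp]: "interp E 0 = mat 1" and interp_1 [simp]: "interp E 1 = E"
  by (simp_all add: interp_def)

lemma continuous_on_interp [continuous_intros]: "continuous_on S (interp E)"
  unfolding interp_def[abs_def] by (intro continuous_intros)

lemma interp_domain:
  assumes E: "E \<in> det_sqrt_domain" and t: "t \<in> {0..1}"
  shows "interp E t \<in> det_sqrt_domain"
proof (cases "t = 1")
  case False
  have "interp E t \<in> posdef_Re"
    unfolding posdef_Re_iff
  proof safe
    show "transpose (interp E t) = interp E t" 
      using E by (auto simp: interp_def det_sqrt_domain_iff symmetric_iff mat_def)
    fix x :: "real^'a" assume "x \<noteq> 0"
    then have "0 < (1 - t) * norm x ^ 2" using t False by simp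
    moreover have "t * Re (qform E x) \<ge> 0" using E t by (simp add: det_sqrt_domain_iff)
    ultimately have "0 < (1 - t) * norm x ^ 2 + t * Re (qform E x)" by linarith
    then show "0 < Re (qform (interp E t) x)"
      unfolding interp_def qform_add qform_scaleR qform_mat1 by simp
  qed
  then show ?thesis by (rule posdef_domain)
qed (use E in auto)

lemma mat_1_domain: "mat 1 \<in> det_sqrt_domain" 
  by (auto simp: det_sqrt_domain_iff symmetric_iff mat_def qform_mat1[unfolded mat_def] qform_def if_distrib if_distribR cong: if_cong)
     (simp_all add: mat_def[symmetric] sum_nonneg)

lemma starlike_det_sqrt_domain: "starlike (det_sqrt_domain :: (complex^'n::finite^'n) set)"
  unfolding starlike_def
proof (rule bexI[OF _ mat_1_domain], safe)
  fix E F :: "complex^'n^'n" assume E: "E \<in> det_sqrt_domain" and F: "F \<in> closed_segment (mat 1) E"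
  then obtain t where "t \<in> {0..1}" "F = interp E t" by (auto simp: in_segment interp_def)
  then show "F \<in> det_sqrt_domain" using interp_domain[OF E] by blast
qed

lemma positive_by_continuity:
  fixes f :: "real \<Rightarrow> real"
  assumes "continuous_on {0..1} f" "f 0 > 0" "\<And>t. t \<in> {0..1} \<Longrightarrow> f t \<noteq> 0"
  shows "f 1 > 0"
proof (rule ccontr)
  assume "\<not> f 1 > 0"
  then obtain t where "0 \<le> t" "t \<le> 1" "f t = 0"
    using IVT2'[of f 1 0 0] assms(1,2) by auto
  with assms(3) show False by auto
qed

lemma real_sqrt_branch:
  fixes z :: complex
  assumes "z\<^sup>2 = of_real r" "r > 0"
  shows "Im z = 0" "Re z \<noteq> 0"
proof -
  have "Re z * Im z = 0" "Re z ^ 2 - Im z ^ 2 = r"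
    using arg_cong[OF assms(1), of Im] arg_cong[OF assms(1), of Re] by (auto simp: power2_eq_square)
  moreover from this have "Re z \<noteq> 0"
    using assms(2) zero_le_power2[of "Im z"] by (auto simp del: zero_le_power2)
  ultimately show "Im z = 0" "Re z \<noteq> 0" by auto
qed

lemma det_of_real:
  fixes A :: "real^'n::finite^'n"
  shows "det (\<chi> k l. complex_of_real (A $ k $ l)) = of_real (det A)"
  by (simp add: det_def)

text \<open>The domain is contractible, so the nowhere vanishing determinant has a continuous square root \<open>g\<close>
there.  Dividing by \<open>g (mat 1)\<close> normalises it at the identity.  On a segment of real matrices the determinant
is positive, hence the root stays real and nonzero and keeps its sign.\<close>

lemma det_sqrt_branch_exists: "\<exists>s. det_sqrt_branch (s :: complex^'n::finite^'n \<Rightarrow> complex)"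
proof -
  have nz: "det E \<noteq> 0" if "E \<in> det_sqrt_domain" for E :: "complex^'n^'n"
    using that by (simp add: det_sqrt_domain_def)
  obtain g :: "complex^'n^'n \<Rightarrow> complex" where g: "continuous_on det_sqrt_domain g" "\<And>E. E \<in> det_sqrt_domain \<Longrightarrow> det E = (g E)\<^sup>2"
    by (rule continuous_sqrt_on_contractible[OF continuous_on_det[OF continuous_on_id]
          starlike_imp_contractible[OF starlike_det_sqrt_domain] nz]) (auto intro: that)
  have g1: "(g (mat 1))\<^sup>2 = 1" using g(2)[OF mat_1_domain] by simp
  then have g1': "g (mat 1) \<noteq> 0" by auto
  define s where "s E = g E / g (mat 1)" for E
  have s: "continuous_on det_sqrt_domain s" "\<And>E. E \<in> det_sqrt_domain \<Longrightarrow> (s E)\<^sup>2 = det E" "s (mat 1) = 1"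
    using g g1 g1' by (auto simp: s_def power_divide intro!: continuous_intros)
  have "Im (s E) = 0 \<and> Re (s E) > 0" if E: "E \<in> posdef_Re" and re: "\<forall>k l. Im (E $ k $ l) = 0" for E
  proof -
    have ED: "E \<in> det_sqrt_domain"
      using E by (rule posdef_domain)
    define A where "A t = (\<chi> k l. Re (interp E t $ k $ l))" for t
    have "interp E t = (\<chi> k l. complex_of_real (A t $ k $ l))" for t
      using re by (auto simp: A_def vec_eq_iff interp_def mat_def complex_eq_iff)
    then have dA: "det (interp E t) = of_real (det (A t))" for t by (metis det_of_real)
    then have dA': "det (A t) = Re (det (interp E t))" for t by simp
    have pos: "det (A t) > 0" if t: "t \<in> {0..1}" for t
    proof -
      have "det (A (t * 1)) > 0"
      proof (rule positive_by_continuity[of "\<lambda>u. det (A (t * u))"])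
        show "continuous_on {0..1} (\<lambda>u. det (A (t * u)))"
          unfolding dA' interp_def by (intro continuous_intros)
        show "0 < det (A (t * 0))" by (simp add: dA')
        fix u :: real assume "u \<in> {0..1}"
        then have "t * u \<in> {0..1}" using t by (auto intro: mult_le_one)
        then show "det (A (t * u)) \<noteq> 0"
          using interp_domain[OF ED] dA[of "t * u"] by (auto simp: det_sqrt_domain_iff)
      qed
      then show ?thesis by simp
    qed
    have sq: "(s (interp E t))\<^sup>2 = of_real (det (A t))" if "t \<in> {0..1}" for t
      using s(2)[OF interp_domain[OF ED that]] dA by simp
    have "Re (s (interp E 1)) > 0"
    proof (rule positive_by_continuity)
      have "continuous_on {0..1} (\<lambda>t. s (interp E t))"
        by (rule continuous_on_compose2[OF s(1)]) (use interp_domain[OF ED] in \<open>auto intro!: continuous_intros\<close>)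
      then show "continuous_on {0..1} (\<lambda>t. Re (s (interp E t)))" by (intro continuous_intros)
      show "Re (s (interp E t)) \<noteq> 0" if "t \<in> {0..1}" for t
        using real_sqrt_branch(2)[OF sq[OF that] pos[OF that]] .
    qed (simp add: s(3))
    moreover have "Im (s (interp E 1)) = 0"
      using real_sqrt_branch(1)[OF sq pos, of 1] by simp
    ultimately show ?thesis by simp
  qed
  then show ?thesis using s by (auto simp: det_sqrt_branch_def intro!: exI[of _ s])
qed

lemma
  shows det_sqrt_continuous: "continuous_on (det_sqrt_domain :: (complex^'n::finite^'n) set) det_sqrt"
    and det_sqrt_square: "(det_sqrt (E :: complex^'n::finite^'n))\<^sup>2 = det E"
    and det_sqrt_positive: "E \<in> posdef_Re \<Longrightarrow> (\<And>k l. Im (E $ k $ l) = 0) \<Longrightarrow> Im (det_sqrt E) = 0 \<and> Re (det_sqrt E) > 0"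
proof -
  let ?s = "SOME s. det_sqrt_branch (s :: complex^'n^'n \<Rightarrow> complex)"
  have s: "det_sqrt_branch ?s" using someI_ex[OF det_sqrt_branch_exists] .
  have eq: "det_sqrt E = ?s E" if "E \<in> det_sqrt_domain" for E :: "complex^'n^'n"
    using that by (simp add: det_sqrt_def)
  show "continuous_on (det_sqrt_domain :: (complex^'n^'n) set) det_sqrt"
    using s eq unfolding det_sqrt_branch_def by (metis (no_types, lifting) continuous_on_cong)
  show "(det_sqrt E)\<^sup>2 = det E"
    using s eq by (cases "E \<in> det_sqrt_domain") (auto simp: det_sqrt_branch_def det_sqrt_def)
  assume E: "E \<in> posdef_Re" "\<And>k l. Im (E $ k $ l) = 0"
  then have "E \<in> det_sqrt_domain"
    using posdef_domain by blast
  then show "Im (det_sqrt E) = 0 \<and> Re (det_sqrt E) > 0"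
    using s eq E by (auto simp: det_sqrt_branch_def)
qed

lemma det_sqrt_nonzero: "E \<in> det_sqrt_domain \<Longrightarrow> det_sqrt E \<noteq> 0"
  using det_sqrt_square[of E] by (auto simp: det_sqrt_domain_iff)

lemma det_scaleR:
  fixes E :: "complex^'n::finite^'n"
  shows "det (c *\<^sub>R E) = of_real c ^ CARD('n) * det E"
proof -
  have "c *\<^sub>R E = (\<chi> i. complex_of_real c *s (E $ i))" 
    by (simp add: vec_eq_iff scaleR_conv_of_real[where 'a = complex])
  then have "det (c *\<^sub>R E) = det (\<chi> i. complex_of_real c *s (E $ i))" by simp
  also have "\<dots> = of_real c ^ CARD('n) * det (\<chi> i. E $ i)" by (subst det_rows_mul) simp
  finally show ?thesis by simp
qed

lemma powr_half_square: "c > 0 \<Longrightarrow> (c powr (real n / 2)) ^ 2 = c ^ n"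
  by (simp add: power2_eq_square powr_realpow flip: powr_add)

text \<open>This holds for arbitrary matrices, since the modulus does not depend on the choice of the root.\<close>

lemma norm_det_sqrt_scaleR:
  fixes E :: "complex^'n::finite^'n"
  assumes "c > 0"
  shows "norm (det_sqrt (c *\<^sub>R E)) = c powr (CARD('n) / 2) * norm (det_sqrt E)"
proof -
  have "norm (det_sqrt (c *\<^sub>R E)) ^ 2 = c ^ CARD('n) * norm (det_sqrt E) ^ 2"
    using assms
    by (simp add: norm_power[symmetric] det_sqrt_square det_scaleR norm_mult) (simp add: norm_power)
  also have "c ^ CARD('n) = (c powr (CARD('n) / 2)) ^ 2"
    using assms by (rule powr_half_square[symmetric])
  finally have "norm (det_sqrt (c *\<^sub>R E)) ^ 2 = (c powr (CARD('n) / 2) * norm (det_sqrt E)) ^ 2"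
    by (simp add: power_mult_distrib)
  then show ?thesis by (rule power2_eq_imp_eq) auto
qed

lemma scaleR_domain: "E \<in> det_sqrt_domain \<Longrightarrow> c > 0 \<Longrightarrow> c *\<^sub>R E \<in> det_sqrt_domain"
  by (auto simp: det_sqrt_domain_iff symmetric_iff qform_scaleR det_scaleR)

text \<open>The quotient of both sides is a continuous function with values \<open>1\<close> and \<open>-1\<close> along the segment
from the identity to \<open>E\<close>, and it is positive at the identity.\<close>

lemma det_sqrt_scaleR:
  fixes E :: "complex^'n::finite^'n"
  assumes E: "E \<in> det_sqrt_domain" and c: "c > 0"
  shows "det_sqrt (c *\<^sub>R E) = of_real (c powr (CARD('n) / 2)) * det_sqrt E"
proof -
  let ?p = "c powr (CARD('n) / 2)"
  define f where "f t = det_sqrt (c *\<^sub>R interp E t) / (of_real ?p * det_sqrt (interp E t))" for t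
  have cp: "of_real (?p ^ 2) = (of_real c :: complex) ^ CARD('n)"
    unfolding powr_half_square[OF c] by simp
  have nz: "det_sqrt (interp E t) \<noteq> 0" "det_sqrt (c *\<^sub>R interp E t) \<noteq> 0" if "t \<in> {0..1}" for t
    using interp_domain[OF E that] scaleR_domain[OF interp_domain[OF E that] c] det_sqrt_nonzero by blast+
  have f2: "(f t)\<^sup>2 = of_real 1" if "t \<in> {0..1}" for t
    using nz[OF that] c det_sqrt_square[of "interp E t"] det_sqrt_square[of "c *\<^sub>R interp E t"] cp
    by (simp add: f_def power_divide power_mult_distrib det_scaleR) (metis divide_self_if of_real_eq_0_iff power_not_zero)
  have cont: "continuous_on {0..1} f"
  proof -
    have "continuous_on {0..1} (\<lambda>t. det_sqrt (interp E t))"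
      by (rule continuous_on_compose2[OF det_sqrt_continuous]) (use interp_domain[OF E] in \<open>auto intro!: continuous_intros\<close>)
    moreover have "continuous_on {0..1} (\<lambda>t. det_sqrt (c *\<^sub>R interp E t))"
      by (rule continuous_on_compose2[OF det_sqrt_continuous]) 
         (use scaleR_domain[OF interp_domain[OF E] c] in \<open>auto intro!: continuous_intros\<close>)
    ultimately show ?thesis unfolding f_def using nz c by (intro continuous_intros) auto
  qed
  have pos: "Im (det_sqrt (a *\<^sub>R mat 1 :: complex^'n^'n)) = 0 \<and> Re (det_sqrt (a *\<^sub>R mat 1 :: complex^'n^'n)) > 0" if "a > 0" for a
  proof (rule det_sqrt_positive)
    show "a *\<^sub>R mat 1 \<in> (posdef_Re :: (complex^'n^'n) set)"
      using that by (auto simp: posdef_Re_iff symmetric_iff mat_def qform_scaleR qform_mat1[unfolded mat_def])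
    show "Im ((a *\<^sub>R mat 1 :: complex^'n^'n) $ k $ l) = 0" for k l by (simp add: mat_def)
  qed
  have "Re (f 0) > 0"
  proof -
    have "det_sqrt (c *\<^sub>R mat 1 :: complex^'n^'n) = of_real (Re (det_sqrt (c *\<^sub>R mat 1 :: complex^'n^'n)))"
      "det_sqrt (mat 1 :: complex^'n^'n) = of_real (Re (det_sqrt (mat 1 :: complex^'n^'n)))"
      using pos[OF c] pos[of 1] by (auto simp: complex_eq_iff)
    then have "f 0 = of_real (Re (det_sqrt (c *\<^sub>R mat 1 :: complex^'n^'n)) / (?p * Re (det_sqrt (mat 1 :: complex^'n^'n))))"
      unfolding f_def interp_0 by (metis of_real_divide of_real_mult)
    then show ?thesis using pos[OF c] pos[of 1] c by simp
  qed
  then have "Re (f 1) > 0"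
    using positive_by_continuity[of "\<lambda>t. Re (f t)"] cont real_sqrt_branch(2)[OF f2] by (auto intro!: continuous_intros)
  moreover have "f 1 = 1 \<or> f 1 = -1" using f2[of 1] by (simp add: power2_eq_1_iff)
  ultimately have "f 1 = 1" by auto
  then show ?thesis using nz[of 1] c by (simp add: f_def)
qed

lemma det_sqrt_mat1: "c > 0 \<Longrightarrow> det_sqrt (c *\<^sub>R mat 1 :: complex^'n::finite^'n) = of_real (c powr (CARD('n) / 2))"
proof -
  have "Im (det_sqrt (mat 1 :: complex^'n^'n)) = 0 \<and> Re (det_sqrt (mat 1 :: complex^'n^'n)) > 0"
    by (rule det_sqrt_positive)
       (auto simp: posdef_Re_iff symmetric_iff qform_mat1[unfolded mat_def] mat_def)
  moreover have "det_sqrt (mat 1 :: complex^'n^'n) = 1 \<or> det_sqrt (mat 1 :: complex^'n^'n) = -1"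
    using det_sqrt_square[of "mat 1 :: complex^'n^'n"] by (simp add: power2_eq_1_iff)
  ultimately have "det_sqrt (mat 1 :: complex^'n^'n) = 1" by auto
  then show "c > 0 \<Longrightarrow> ?thesis" by (simp add: det_sqrt_scaleR[OF mat_1_domain])
qed

section \<open>Derivatives along paths of matrices\<close>

lemma has_vector_derivative_iff_quotient:
  fixes f :: "real \<Rightarrow> complex"
  shows "(f has_vector_derivative f') (at t within T) \<longleftrightarrow>
    ((\<lambda>y. (f y - f t) / of_real (y - t)) \<longlongrightarrow> f') (at t within T)"
proof -
  have "(f has_vector_derivative f') (at t within T) \<longleftrightarrow>
     ((\<lambda>y. norm (f y - f t - (y - t) *\<^sub>R f') / norm (y - t)) \<longlongrightarrow> 0) (at t within T)"
    by (simp add: has_vector_derivative_def has_derivative_iff_norm bounded_linear_scaleR_left)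
  also have "\<dots> \<longleftrightarrow> ((\<lambda>y. norm ((f y - f t) / of_real (y - t) - f')) \<longlongrightarrow> 0) (at t within T)"
  proof (rule Lim_cong_within[OF refl refl refl])
    fix y assume "y \<noteq> t"
    then have "(f y - f t) / of_real (y - t) - f' = (f y - f t - (y - t) *\<^sub>R f') / of_real (y - t)"
      by (simp add: field_simps scaleR_conv_of_real)
    then show "norm (f y - f t - (y - t) *\<^sub>R f') / norm (y - t) = norm ((f y - f t) / of_real (y - t) - f')"
      by (simp add: norm_divide flip: of_real_diff)
  qed
  also have "\<dots> \<longleftrightarrow> ((\<lambda>y. (f y - f t) / of_real (y - t)) \<longlongrightarrow> f') (at t within T)"
    by (simp add: tendsto_norm_zero_iff Lim_null[symmetric])
  finally show ?thesis .
qed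

text \<open>Continuity of the root suffices: the difference quotient of \<open>z\<close> is that of \<open>z\<^sup>2\<close> divided by
\<open>z y + z t\<close>, which tends to \<open>2 * z t\<close>.\<close>

lemma has_vector_derivative_sqrt:
  fixes z w :: "real \<Rightarrow> complex"
  assumes c: "continuous_on T z" and sq: "\<And>t. t \<in> T \<Longrightarrow> (z t)\<^sup>2 = w t" and t: "t \<in> T" "z t \<noteq> 0"
    and w: "(w has_vector_derivative w') (at t within T)"
  shows "(z has_vector_derivative w' / (2 * z t)) (at t within T)"
  unfolding has_vector_derivative_iff_quotient
proof (rule Lim_transform_eventually)
  have zt: "(z \<longlongrightarrow> z t) (at t within T)" using c t by (simp add: continuous_on_def)
  show "((\<lambda>y. (w y - w t) / of_real (y - t) / (z y + z t)) \<longlongrightarrow> w' / (2 * z t)) (at t within T)"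
    unfolding mult_2 by (intro tendsto_intros w[unfolded has_vector_derivative_iff_quotient] zt) (use t in auto)
  have "\<forall>\<^sub>F y in at t within T. z y \<noteq> - z t"
    by (rule tendsto_imp_eventually_ne[OF zt]) (use t in auto)
  moreover have "\<forall>\<^sub>F y in at t within T. y \<in> T \<and> y \<noteq> t" 
    by (auto simp: eventually_at_filter)
  ultimately show "\<forall>\<^sub>F y in at t within T. (w y - w t) / of_real (y - t) / (z y + z t) = (z y - z t) / of_real (y - t)"
  proof eventually_elim
    case (elim y)
    then have "z y + z t \<noteq> 0" by (simp add: eq_neg_iff_add_eq_0)
    moreover have "w y - w t = (z y - z t) * (z y + z t)"
      using sq[of y] sq[OF t(1)] elim by (simp add: power2_eq_square algebra_simps flip: sq)
    ultimately show ?case by simp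
  qed
qed

text \<open>All but the \<open>i\<close>-th summand produce a determinant with two equal rows.\<close>

lemma det_row_combination:
  fixes E :: "complex^'n::finite^'n"
  shows "det (\<chi> j. if j = i then (\<Sum>l\<in>UNIV. c l *s (E $ l)) else E $ j) = c i * det E"
proof -
  have "det (\<chi> j. if j = i then (\<Sum>l\<in>UNIV. c l *s (E $ l)) else E $ j)
     = (\<Sum>l\<in>UNIV. det (\<chi> j. if j = i then c l *s (E $ l) else E $ j))"
    by (rule det_linear_row_sum) simp
  also have "\<dots> = (\<Sum>l\<in>UNIV. c l * det (\<chi> j. if j = i then E $ l else E $ j))"
    by (simp only: det_row_mul)
  also have "\<dots> = (\<Sum>l\<in>UNIV. if l = i then c i * det E else 0)"
  proof (intro sum.cong refl)
    fix l
    show "c l * det (\<chi> j. if j = i then E $ l else E $ j) = (if l = i then c i * det E else 0)"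
    proof (cases "l = i")
      case True
      then have "(\<chi> j. if j = i then E $ l else E $ j) = E" by (simp add: vec_eq_iff)
      then show ?thesis using True by simp
    next
      case False
      then have "det (\<chi> j. if j = i then E $ l else E $ j) = 0"
        by (intro det_identical_rows[of i l]) (auto simp: row_def vec_eq_iff)
      then show ?thesis using False by simp
    qed
  qed
  finally show ?thesis by simp
qed

text \<open>Jacobi's formula.  Differentiating a row \<open>E t $ i\<close> replaces it by \<open>E' $ i\<close>, which is the combination of
the rows of \<open>E t\<close> with coefficients from \<open>E' W\<close>.\<close>

lemma has_vector_derivative_det:
  fixes E :: "real \<Rightarrow> complex^'n::finite^'n"
  assumes E: "\<And>k l. ((\<lambda>t. E t $ k $ l) has_vector_derivative E' $ k $ l) (at t within T)" 
    and W: "W ** E t = mat 1"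
  shows "((\<lambda>t. det (E t)) has_vector_derivative (\<Sum>k\<in>UNIV. \<Sum>l\<in>UNIV. E' $ k $ l * W $ l $ k) * det (E t)) (at t within T)"
proof -
  let ?r = "\<lambda>i. \<chi> j. if j = i then E' $ i else E t $ j"
  have "((\<lambda>t. det (E t)) has_derivative (\<lambda>h. \<Sum>p | p permutes (UNIV::'n set). of_int (sign p) *
      (\<Sum>i\<in>UNIV. (h *\<^sub>R E' $ i $ p i) * (\<Prod>j\<in>UNIV - {i}. E t $ j $ p j)))) (at t within T)"
    unfolding det_def
    by (intro has_derivative_sum has_derivative_mult_right has_derivative_prod 
        E[unfolded has_vector_derivative_def])
  moreover have "(\<Sum>p | p permutes (UNIV::'n set). of_int (sign p) *
      (\<Sum>i\<in>UNIV. (h *\<^sub>R E' $ i $ p i) * (\<Prod>j\<in>UNIV - {i}. E t $ j $ p j))) = h *\<^sub>R (\<Sum>i\<in>UNIV. det (?r i))" for h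
  proof -
    have "(\<Prod>j\<in>UNIV. ?r i $ j $ p j) = E' $ i $ p i * (\<Prod>j\<in>UNIV - {i}. E t $ j $ p j)" for i p
      by (subst prod.remove[of _ i]) (auto intro!: arg_cong2[where f = "(*)"] prod.cong)
    then have "(\<Sum>i\<in>UNIV. det (?r i)) = (\<Sum>i\<in>UNIV. \<Sum>p | p permutes (UNIV::'n set). of_int (sign p) *
       (E' $ i $ p i * (\<Prod>j\<in>UNIV - {i}. E t $ j $ p j)))"
      by (simp only: det_def)
    also have "\<dots> = (\<Sum>p | p permutes (UNIV::'n set). \<Sum>i\<in>UNIV. of_int (sign p) *
       (E' $ i $ p i * (\<Prod>j\<in>UNIV - {i}. E t $ j $ p j)))" by (rule sum.swap)
    finally show ?thesis by (simp add: scaleR_sum_right sum_distrib_left)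
  qed
  ultimately have *: "((\<lambda>t. det (E t)) has_vector_derivative (\<Sum>i\<in>UNIV. det (?r i))) (at t within T)"
    by (simp add: has_vector_derivative_def)
  have "det (?r i) = (\<Sum>l\<in>UNIV. E' $ i $ l * W $ l $ i) * det (E t)" for i
  proof -
    have E'_eq: "E' = (E' ** W) ** E t" by (simp add: matrix_mul_assoc[symmetric] W)
    have row: "E' $ i = (\<Sum>l\<in>UNIV. (E' ** W) $ i $ l *s (E t $ l))"
      unfolding vec_eq_iff by (subst (1) E'_eq) (simp add: matrix_matrix_mult_def)
    have "det (?r i) = (E' ** W) $ i $ i * det (E t)"
      using det_row_combination[of i "\<lambda>l. (E' ** W) $ i $ l" "E t"] unfolding row[symmetric] .
    then show ?thesis by (simp add: matrix_matrix_mult_def)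
  qed
  with * show ?thesis by (simp add: sum_distrib_right)
qed


section \<open>Quadratic phases\<close>

text \<open>The radius 1 is large enough for amplitudes supported where \<open>norm x \<le> \<epsilon> h\<^sup>\<rho>\<close>.\<close>

definition test_fun :: "(real^'n::finite \<Rightarrow> complex) \<Rightarrow> bool" where
  "test_fun f \<longleftrightarrow> smooth f \<and> (\<forall>x. norm x > 1 \<longrightarrow> f x = 0)"

lemma iter_partial_outside:
  assumes "\<And>x. norm x > 1 \<Longrightarrow> f x = 0" "norm x > 1"
  shows "iter_partial ks f x = 0"
  using iter_partial_cong_open[of "- cball 0 1" x f "\<lambda>_. 0" ks] assms by auto

lemma test_fun_smooth: "test_fun f \<Longrightarrow> smooth f"
  by (simp add: test_fun_def)

lemma test_fun_iter: "test_fun f \<Longrightarrow> test_fun (iter_partial ks f)"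
  by (auto simp: test_fun_def smooth_iter iter_partial_outside)

lemma test_fun_partial: "test_fun f \<Longrightarrow> test_fun (partial_deriv k f)"
  using test_fun_iter[of f "[k]"] by simp

lemma test_fun_mult: "smooth g \<Longrightarrow> test_fun f \<Longrightarrow> test_fun (\<lambda>x. g x * f x)"
  by (simp add: test_fun_def smooth_mult)

lemma test_fun_cmult: "test_fun f \<Longrightarrow> test_fun (\<lambda>x. a * f x)"
  by (rule test_fun_mult[OF smooth_const])

lemma test_fun_sum: "finite I \<Longrightarrow> (\<And>i. i \<in> I \<Longrightarrow> test_fun (f i)) \<Longrightarrow> test_fun (\<lambda>x. \<Sum>i\<in>I. f i x)"
  by (simp add: test_fun_def smooth_sum)

lemma test_fun_bounded:
  fixes f :: "real^'n::finite \<Rightarrow> complex"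
  assumes "test_fun f"
  obtains M where "M \<ge> 0" "\<And>ks x. length ks \<le> n \<Longrightarrow> norm (iter_partial ks f x) \<le> M"
proof -
  have "\<exists>M. \<forall>x. norm (iter_partial ks f x) \<le> M" for ks
  proof -
    have t: "test_fun (iter_partial ks f)" by (rule test_fun_iter[OF assms])
    have "compact ((\<lambda>x. norm (iter_partial ks f x)) ` cball 0 1)"
      by (intro compact_continuous_image continuous_on_norm smooth_continuous test_fun_smooth[OF t] compact_cball)
    then obtain M where "\<forall>y\<in>(\<lambda>x. norm (iter_partial ks f x)) ` cball 0 1. norm y \<le> M"
      using compact_imp_bounded bounded_iff by metis
    then have M: "norm (iter_partial ks f x) \<le> M" if "norm x \<le> 1" for x using that by auto
    have "norm (iter_partial ks f x) \<le> max M 0" for x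
      using M[of x] t by (cases "norm x \<le> 1") (auto simp: test_fun_def)
    then show ?thesis by blast
  qed
  then obtain B where B: "\<And>ks x. norm (iter_partial ks f x) \<le> B ks" by metis
  have fin: "finite {ks::'n list. length ks \<le> n}"
    using finite_lists_length_le[of "UNIV::'n set" n] by simp
  have Bnn: "0 \<le> B ks" for ks using order_trans[OF norm_ge_zero B[of ks 0]] .
  show ?thesis
  proof (rule that)
    show "0 \<le> (\<Sum>ks | length ks \<le> n. B ks)" by (rule sum_nonneg) (rule Bnn)
    show "norm (iter_partial ks f x) \<le> (\<Sum>ks | length ks \<le> n. B ks)" if "length ks \<le> n" for ks x
      by (rule order_trans[OF B member_le_sum[OF _ _ fin]]) (use that Bnn in auto)
  qed
qed

text \<open>The operator \<open>\<langle>P \<partial>, \<partial>\<rangle>\<close>.\<close>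

definition lap :: "complex^'n^'n \<Rightarrow> (real^'n::finite \<Rightarrow> complex) \<Rightarrow> real^'n \<Rightarrow> complex" where
  "lap P f x = (\<Sum>k\<in>UNIV. \<Sum>l\<in>UNIV. P $ k $ l * partial_deriv k (partial_deriv l f) x)"

lemma smooth_lap: "smooth f \<Longrightarrow> smooth (lap P f)"
  unfolding lap_def[abs_def] by (intro smooth_sum smooth_cmult smooth_partial) auto

lemma test_fun_lap: "test_fun f \<Longrightarrow> test_fun (lap P f)"
  unfolding lap_def[abs_def] by (intro test_fun_sum test_fun_cmult test_fun_partial) auto

lemma test_fun_lap_power: "test_fun f \<Longrightarrow> test_fun ((lap P ^^ i) f)"
  by (induction i) (auto intro: test_fun_lap)

lemma smooth_lap_power: "smooth f \<Longrightarrow> smooth ((lap P ^^ i) f)"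
  by (induction i) (auto intro: smooth_lap)

lemma iter_partial_cmult:
  assumes "smooth f" shows "iter_partial ks (\<lambda>x. a * f x) = (\<lambda>x. a * iter_partial ks f x)"
proof (induction ks)
  case (Cons k ks)
  have "partial_deriv k (\<lambda>x. a * iter_partial ks f x) = (\<lambda>x. a * partial_deriv k (iter_partial ks f) x)"
    by (rule ext) (rule partial_deriv_cmult[OF smooth_differentiable[OF smooth_iter[OF assms]]])
  with Cons show ?case by simp
qed simp

lemma iter_partial_sum:
  assumes "finite I" "\<And>i. i \<in> I \<Longrightarrow> smooth (f i)"
  shows "iter_partial ks (\<lambda>x. \<Sum>i\<in>I. f i x) = (\<lambda>x. \<Sum>i\<in>I. iter_partial ks (f i) x)"
proof (induction ks)
  case (Cons k ks)
  have "(iter_partial ks (f i)) differentiable (at x)" if "i \<in> I" for i x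
    by (rule smooth_differentiable[OF smooth_iter[OF assms(2)[OF that]]])
  then have "partial_deriv k (\<lambda>x. \<Sum>i\<in>I. iter_partial ks (f i) x) = (\<lambda>x. \<Sum>i\<in>I. partial_deriv k (iter_partial ks (f i)) x)"
    by (intro ext partial_deriv_sum[OF assms(1)])
  with Cons show ?case by simp
qed simp

lemma iter_partial_lap:
  assumes f: "smooth f"
  shows "iter_partial ks (lap P f) x = (\<Sum>k\<in>UNIV. \<Sum>l\<in>UNIV. P $ k $ l * iter_partial (ks @ [k, l]) f x)"
proof -
  have s: "smooth (partial_deriv k (partial_deriv l f))" for k l by (intro smooth_partial f)
  have s2: "smooth (\<lambda>x. \<Sum>l\<in>UNIV. P $ k $ l * partial_deriv k (partial_deriv l f) x)" for k
    by (intro smooth_sum smooth_cmult s) auto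
  show ?thesis
    unfolding lap_def[abs_def]
    by (simp add: iter_partial_sum[OF finite s2] iter_partial_sum[OF finite smooth_cmult[OF s]] 
        iter_partial_cmult[OF s] iter_partial_append)
qed

lemma norm_iter_lap_power:
  fixes f :: "real^'n::finite \<Rightarrow> complex"
  assumes f: "smooth f" and P: "\<And>k l. norm (P $ k $ l) \<le> p"
    and M: "\<And>ks. length ks = 2 * i + length ls \<Longrightarrow> norm (iter_partial ks f x) \<le> M"
  shows "norm (iter_partial ls ((lap P ^^ i) f) x) \<le> (real CARD('n) ^ 2 * p) ^ i * M"
  using M
proof (induction i arbitrary: ls)
  case (Suc i)
  have "norm (iter_partial (ls @ [k, l]) ((lap P ^^ i) f) x) \<le> (real CARD('n) ^ 2 * p) ^ i * M" for k l
    by (rule Suc.IH) (use Suc.prems in auto)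
  moreover have "0 \<le> p" using order_trans[OF norm_ge_zero P] .
  ultimately have "norm (P $ k $ l * iter_partial (ls @ [k, l]) ((lap P ^^ i) f) x) \<le> p * ((real CARD('n) ^ 2 * p) ^ i * M)" for k l
    unfolding norm_mult using P by (intro mult_mono) auto
  then have "norm (\<Sum>l\<in>UNIV. P $ k $ l * iter_partial (ls @ [k, l]) ((lap P ^^ i) f) x) 
      \<le> (\<Sum>l\<in>(UNIV::'n set). p * ((real CARD('n) ^ 2 * p) ^ i * M))" for k
    by (intro sum_norm_le)
  then have "norm (\<Sum>k\<in>UNIV. \<Sum>l\<in>UNIV. P $ k $ l * iter_partial (ls @ [k, l]) ((lap P ^^ i) f) x) 
     \<le> (\<Sum>k\<in>(UNIV::'n set). \<Sum>l\<in>(UNIV::'n set). p * ((real CARD('n) ^ 2 * p) ^ i * M))"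
    by (rule sum_norm_le)
  then show ?case
    by (simp add: iter_partial_lap[OF smooth_lap_power[OF f]] power2_eq_square mult_ac)
qed simp

definition gint :: "complex^'n^'n \<Rightarrow> (real^'n::finite \<Rightarrow> complex) \<Rightarrow> complex" where
  "gint E f = (LINT x|lborel. exp (- (1/2) * qform E x) * f x)"

lemma smooth_qform: "smooth (qform E)"
  unfolding qform_def[abs_def] by (intro smooth_sum smooth_mult smooth_const smooth_coord) auto

lemma partial_deriv_qform:
  fixes E :: "complex^'n::finite^'n"
  assumes "transpose E = E"
  shows "partial_deriv j (qform E) x = 2 * (\<Sum>l\<in>UNIV. E $ j $ l * of_real (x $ l))"
proof -
  have sm: "smooth (\<lambda>x. E $ k $ l * of_real (x $ l) * of_real (x $ k))" for k l
    by (intro smooth_mult smooth_const smooth_coord)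
  have sm2: "smooth (\<lambda>x. \<Sum>l\<in>UNIV. E $ k $ l * of_real (x $ l) * of_real (x $ k))" for k
    by (intro smooth_sum sm) auto
  have "partial_deriv j (\<lambda>x. E $ k $ l * of_real (x $ l) * of_real (x $ k)) x
      = (if l = j then E $ k $ l * of_real (x $ k) else 0) + (if k = j then E $ k $ l * of_real (x $ l) else 0)" for k l
  proof -
    have d: "(\<lambda>x::real^'n. E $ k $ l * of_real (x $ l)) differentiable (at x)"
      by (intro differentiable_mult differentiable_const differentiable_coord)
    show ?thesis
      by (subst partial_deriv_mult[OF d differentiable_coord])
         (auto simp: partial_deriv_cmult)
  qed
  then have "partial_deriv j (qform E) x = (\<Sum>k\<in>UNIV. \<Sum>l\<in>UNIV. (if l = j then E $ k $ l * of_real (x $ k) else 0) 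
      + (if k = j then E $ k $ l * of_real (x $ l) else 0))"
    unfolding qform_def[abs_def]
    by (simp add: partial_deriv_sum smooth_differentiable[OF sm] smooth_differentiable[OF sm2])
  also have "\<dots> = (\<Sum>k\<in>UNIV. E $ k $ j * of_real (x $ k)) + (\<Sum>l\<in>UNIV. E $ j $ l * of_real (x $ l))"
    by (simp add: sum.distrib) (simp add: if_distrib[of "\<lambda>s. sum s UNIV"] sum.swap[of _ UNIV UNIV])
  also have "(\<Sum>k\<in>UNIV. E $ k $ j * of_real (x $ k)) = (\<Sum>l\<in>UNIV. E $ j $ l * of_real (x $ l))"
    using assms by (simp add: symmetric_iff)
  finally show ?thesis by simp
qed

lemma
  shows gaussian_factor_continuous: "continuous_on UNIV (\<lambda>x::real^'n::finite. exp (- (1/2) * qform E x))"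
    and gaussian_factor_differentiable: "(\<lambda>x::real^'n. exp (- (1/2) * qform E x)) differentiable (at x)"
    and partial_deriv_gaussian_factor: "transpose E = E \<Longrightarrow> 
      partial_deriv k (\<lambda>x::real^'n. exp (- (1/2) * qform E x)) x 
      = exp (- (1/2) * qform E x) * - (\<Sum>l\<in>UNIV. E $ k $ l * of_real (x $ l))"
proof -
  have d: "(\<lambda>x. - (1/2) * qform E x) differentiable (at x)" for x
    by (rule smooth_differentiable[OF smooth_cmult[OF smooth_qform]])
  note e = partial_deriv_exp[OF d]
  show *: "(\<lambda>x::real^'n. exp (- (1/2) * qform E x)) differentiable (at x)" for x using e(2) .
  then show "continuous_on UNIV (\<lambda>x::real^'n. exp (- (1/2) * qform E x))"
    by (simp add: continuous_at_imp_continuous_on differentiable_imp_continuous_within)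
  show "partial_deriv k (\<lambda>x::real^'n. exp (- (1/2) * qform E x)) x 
      = exp (- (1/2) * qform E x) * - (\<Sum>l\<in>UNIV. E $ k $ l * of_real (x $ l))" if "transpose E = E"
    unfolding e(1) partial_deriv_cmult[OF smooth_differentiable[OF smooth_qform]] partial_deriv_qform[OF that]
    by simp
qed

lemma gint_integrable: 
  assumes "test_fun f" shows "integrable lborel (\<lambda>x. exp (- (1/2) * qform E x) * f x)"
proof (rule integrable_bounded_support[of _ 1])
  show "continuous_on UNIV (\<lambda>x. exp (- (1/2) * qform E x) * f x)"
    by (rule continuous_on_mult[OF gaussian_factor_continuous smooth_continuous[OF test_fun_smooth[OF assms]]])
qed (use assms in \<open>auto simp: test_fun_def\<close>)

lemma gint_add: "test_fun f \<Longrightarrow> test_fun g \<Longrightarrow> gint E (\<lambda>x. f x + g x) = gint E f + gint E g"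
  unfolding gint_def distrib_left by (rule Bochner_Integration.integral_add[OF gint_integrable gint_integrable])

lemma gint_cmult: "gint E (\<lambda>x. a * f x) = a * gint E f"
proof -
  have "gint E (\<lambda>x. a * f x) = (LINT x|lborel. a * (exp (- (1/2) * qform E x) * f x))"
    unfolding gint_def by (intro Bochner_Integration.integral_cong refl) (simp add: mult_ac)
  also have "\<dots> = a * gint E f" unfolding gint_def by (rule integral_mult_right_zero)
  finally show ?thesis .
qed

lemma gint_sum: "finite I \<Longrightarrow> (\<And>i. i \<in> I \<Longrightarrow> test_fun (f i)) \<Longrightarrow> gint E (\<lambda>x. \<Sum>i\<in>I. f i x) = (\<Sum>i\<in>I. gint E (f i))"
  unfolding gint_def sum_distrib_left by (rule Bochner_Integration.integral_sum) (rule gint_integrable)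

text \<open>The gradient of the Gaussian \<open>exp (- \<langle>E x, x\<rangle> / 2)\<close> is \<open>- E x\<close> times the Gaussian.\<close>

lemma gint_by_parts:
  assumes E: "transpose E = E" and f: "test_fun f"
  shows "gint E (\<lambda>x. (\<Sum>l\<in>UNIV. E $ k $ l * of_real (x $ l)) * f x) = gint E (partial_deriv k f)"
proof -
  let ?g = "\<lambda>x. (\<Sum>l\<in>UNIV. E $ k $ l * of_real (x $ l)) * f x" and ?e = "\<lambda>x. exp (- (1/2) * qform E x)"
  have g: "test_fun ?g" 
    by (intro test_fun_mult f smooth_sum smooth_cmult smooth_coord) auto
  note df = smooth_differentiable[OF test_fun_smooth[OF f]]
  have pd: "partial_deriv k (\<lambda>x. ?e x * f x) = (\<lambda>x. (-1) * (?e x * ?g x) + ?e x * partial_deriv k f x)"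
    unfolding fun_eq_iff partial_deriv_mult[OF gaussian_factor_differentiable df] 
      partial_deriv_gaussian_factor[OF E] by simp
  have "(LINT x|lborel. partial_deriv k (\<lambda>x. ?e x * f x) x) = 0"
  proof (rule integral_partial_deriv)
    show "(\<lambda>x. ?e x * f x) differentiable (at x)" for x
      by (intro differentiable_mult gaussian_factor_differentiable df)
    show "continuous_on UNIV (partial_deriv k (\<lambda>x. ?e x * f x))"
      unfolding pd
      by (intro continuous_on_add continuous_on_mult continuous_on_const gaussian_factor_continuous 
          smooth_continuous test_fun_smooth[OF g] smooth_partial test_fun_smooth[OF f])
  qed (use f in \<open>auto simp: test_fun_def\<close>)
  then have "(LINT x|lborel. (-1) * (?e x * ?g x) + ?e x * partial_deriv k f x) = 0" unfolding pd .
  then have "(-1) * (LINT x|lborel. ?e x * ?g x) + (LINT x|lborel. ?e x * partial_deriv k f x) = 0"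
    using Bochner_Integration.integral_add[OF integrable_mult_right[OF gint_integrable[OF g, of E], of "-1"]
        gint_integrable[OF test_fun_partial[OF f], of E k]]
    by (simp only: integral_mult_right_zero)
  then show ?thesis unfolding gint_def by (simp add: eq_neg_iff_add_eq_0)
qed

lemma gint_coord:
  assumes E: "transpose E = E" and W: "W ** E = mat 1" and f: "test_fun f"
  shows "gint E (\<lambda>x. of_real (x $ j) * f x) = (\<Sum>k\<in>UNIV. W $ j $ k * gint E (partial_deriv k f))"
proof -
  have "(\<Sum>k\<in>UNIV. W $ j $ k * (\<Sum>l\<in>UNIV. E $ k $ l * complex_of_real (x $ l))) = of_real (x $ j)" for x
  proof -
    have "(\<Sum>k\<in>UNIV. W $ j $ k * (\<Sum>l\<in>UNIV. E $ k $ l * complex_of_real (x $ l)))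
        = (\<Sum>k\<in>UNIV. \<Sum>l\<in>UNIV. W $ j $ k * E $ k $ l * complex_of_real (x $ l))"
      by (simp add: sum_distrib_left mult_ac)
    also have "\<dots> = (\<Sum>l\<in>UNIV. \<Sum>k\<in>UNIV. W $ j $ k * E $ k $ l * complex_of_real (x $ l))" by (rule sum.swap)
    also have "\<dots> = (\<Sum>l\<in>UNIV. (W ** E) $ j $ l * complex_of_real (x $ l))"
      by (simp add: matrix_matrix_mult_def sum_distrib_right)
    also have "\<dots> = (\<Sum>l\<in>UNIV. if j = l then complex_of_real (x $ l) else 0)"
      unfolding W by (intro sum.cong refl) (simp add: mat_def)
    finally show ?thesis by simp
  qed
  from this[symmetric] have "(\<lambda>x. of_real (x $ j) * f x)
      = (\<lambda>x. \<Sum>k\<in>UNIV. W $ j $ k * ((\<Sum>l\<in>UNIV. E $ k $ l * of_real (x $ l)) * f x))"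
    by (simp only: sum_distrib_right mult.assoc)
  moreover have "test_fun (\<lambda>x. (\<Sum>l\<in>UNIV. E $ k $ l * of_real (x $ l)) * f x)" for k
    by (intro test_fun_mult f smooth_sum smooth_cmult smooth_coord) auto
  ultimately show ?thesis
    by (simp add: gint_sum test_fun_cmult gint_cmult gint_by_parts[OF E f])
qed

text \<open>The product \<open>W\<^sup>T P W\<close>.\<close>

definition sandwich :: "complex^'n^'n \<Rightarrow> complex^'n^'n \<Rightarrow> complex^'n^'n::finite" where
  "sandwich W P = (\<chi> m p. \<Sum>k\<in>UNIV. \<Sum>l\<in>UNIV. P $ k $ l * W $ k $ m * W $ l $ p)"

lemma gint_lap:
  assumes f: "test_fun f"
  shows "gint E (lap P f) = (\<Sum>k\<in>UNIV. \<Sum>l\<in>UNIV. P $ k $ l * gint E (partial_deriv k (partial_deriv l f)))"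
proof -
  have t: "test_fun (\<lambda>x. P $ k $ l * partial_deriv k (partial_deriv l f) x)" for k l 
    by (intro test_fun_cmult test_fun_partial f)
  have t2: "test_fun (\<lambda>x. \<Sum>l\<in>UNIV. P $ k $ l * partial_deriv k (partial_deriv l f) x)" for k
    by (intro test_fun_sum t) auto
  show ?thesis
    unfolding lap_def[abs_def] by (simp add: gint_sum[OF finite t2] gint_sum[OF finite t] gint_cmult)
qed

text \<open>Two integrations by parts trade the two factors \<open>x\<close> in the form for derivatives; the trace term arises
when the second one hits the remaining factor \<open>x\<close>.\<close>

lemma gint_qform:
  fixes f :: "real^'n::finite \<Rightarrow> complex"
  assumes E: "transpose E = E" and W: "W ** E = mat 1" and f: "test_fun f"
  shows "gint E (\<lambda>x. qform P x * f x) = (\<Sum>k\<in>UNIV. \<Sum>l\<in>UNIV. P $ k $ l * W $ l $ k) * gint E f + gint E (lap (sandwich W P) f)"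
proof -
  have tc: "test_fun (\<lambda>x. of_real (x $ k) * g x)" if "test_fun g" for k and g :: "real^'n \<Rightarrow> complex"
    by (intro test_fun_mult smooth_coord that)
  have step: "gint E (\<lambda>x. of_real (x $ l) * (of_real (x $ k) * f x))
     = W $ l $ k * gint E f + (\<Sum>p\<in>UNIV. \<Sum>m\<in>UNIV. W $ l $ p * W $ k $ m * gint E (partial_deriv m (partial_deriv p f)))" for k l
  proof -
    have "gint E (partial_deriv p (\<lambda>x. of_real (x $ k) * f x)) = (if k = p then gint E f else 0) 
        + (\<Sum>m\<in>UNIV. W $ k $ m * gint E (partial_deriv m (partial_deriv p f)))" for p
    proof -
      have "partial_deriv p (\<lambda>x. of_real (x $ k) * f x) = (\<lambda>x. (if k = p then 1 else 0) * f x + of_real (x $ k) * partial_deriv p f x)"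
        unfolding fun_eq_iff partial_deriv_mult[OF differentiable_coord smooth_differentiable[OF test_fun_smooth[OF f]]]
        by simp
      then have "gint E (partial_deriv p (\<lambda>x. of_real (x $ k) * f x)) = 
          (if k = p then 1 else 0) * gint E f + gint E (\<lambda>x. of_real (x $ k) * partial_deriv p f x)"
        by (simp only: gint_add[OF test_fun_cmult[OF f] tc[OF test_fun_partial[OF f]]] gint_cmult)
      also have "gint E (\<lambda>x. of_real (x $ k) * partial_deriv p f x) = (\<Sum>m\<in>UNIV. W $ k $ m * gint E (partial_deriv m (partial_deriv p f)))"
        by (rule gint_coord[OF E W test_fun_partial[OF f]])
      finally show ?thesis by simp
    qed
    then have "gint E (\<lambda>x. of_real (x $ l) * (of_real (x $ k) * f x)) = (\<Sum>p\<in>UNIV. W $ l $ p * (if k = p then gint E f else 0))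
       + (\<Sum>p\<in>UNIV. \<Sum>m\<in>UNIV. W $ l $ p * W $ k $ m * gint E (partial_deriv m (partial_deriv p f)))"
      by (simp only: gint_coord[OF E W tc[OF f]] distrib_left sum.distrib sum_distrib_left mult.assoc)
    also have "(\<Sum>p\<in>UNIV. W $ l $ p * (if k = p then gint E f else 0)) = (\<Sum>p\<in>UNIV. if k = p then W $ l $ p * gint E f else 0)"
      by (intro sum.cong) auto
    finally show ?thesis by simp
  qed
  have t1: "test_fun (\<lambda>x. P $ k $ l * (of_real (x $ l) * (of_real (x $ k) * f x)))" for k l
    by (intro test_fun_cmult tc f)
  have t2: "test_fun (\<lambda>x. \<Sum>l\<in>UNIV. P $ k $ l * (of_real (x $ l) * (of_real (x $ k) * f x)))" for k
    by (intro test_fun_sum t1) auto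
  have "gint E (\<lambda>x. qform P x * f x) = gint E (\<lambda>x. \<Sum>k\<in>UNIV. \<Sum>l\<in>UNIV. P $ k $ l * (of_real (x $ l) * (of_real (x $ k) * f x)))"
    by (simp add: qform_def sum_distrib_right mult.assoc)
  also have "\<dots> = (\<Sum>k\<in>UNIV. \<Sum>l\<in>UNIV. P $ k $ l * gint E (\<lambda>x. of_real (x $ l) * (of_real (x $ k) * f x)))"
    by (simp add: gint_sum[OF finite t2] gint_sum[OF finite t1] gint_cmult)
  also have "\<dots> = (\<Sum>k\<in>UNIV. \<Sum>l\<in>UNIV. P $ k $ l * W $ l $ k) * gint E f 
     + (\<Sum>k\<in>UNIV. \<Sum>l\<in>UNIV. \<Sum>p\<in>UNIV. \<Sum>m\<in>UNIV. P $ k $ l * (W $ l $ p * W $ k $ m * gint E (partial_deriv m (partial_deriv p f))))"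
    by (simp only: step distrib_left sum.distrib sum_distrib_left sum_distrib_right mult.assoc)
  also have "(\<Sum>k\<in>UNIV. \<Sum>l\<in>UNIV. \<Sum>p\<in>UNIV. \<Sum>m\<in>UNIV. P $ k $ l * (W $ l $ p * W $ k $ m * gint E (partial_deriv m (partial_deriv p f))))
     = gint E (lap (sandwich W P) f)"
  proof -
    let ?t = "\<lambda>k l p m. P $ k $ l * (W $ l $ p * W $ k $ m * gint E (partial_deriv m (partial_deriv p f)))"
    have "(\<Sum>k\<in>UNIV. \<Sum>l\<in>UNIV. \<Sum>p\<in>UNIV. \<Sum>m\<in>UNIV. ?t k l p m) = (\<Sum>(k,l)\<in>UNIV. \<Sum>(m,p)\<in>UNIV. ?t k l p m)"
      unfolding UNIV_Times_UNIV[symmetric] sum.cartesian_product[symmetric]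
      by (intro sum.cong refl sum.swap)
    also have "\<dots> = (\<Sum>(m,p)\<in>UNIV. \<Sum>(k,l)\<in>UNIV. ?t k l p m)"
      unfolding split_beta by (rule sum.swap)
    also have "\<dots> = (\<Sum>m\<in>UNIV. \<Sum>p\<in>UNIV. \<Sum>k\<in>UNIV. \<Sum>l\<in>UNIV. ?t k l p m)"
      unfolding UNIV_Times_UNIV[symmetric] sum.cartesian_product[symmetric] ..
    also have "\<dots> = gint E (lap (sandwich W P) f)"
      unfolding gint_lap[OF f] sandwich_def by (simp add: sum_distrib_right mult.assoc) (simp add: mult_ac)
    finally show ?thesis .
  qed
  finally show ?thesis .
qed

definition normalized_gint :: "complex^'n^'n \<Rightarrow> (real^'n::finite \<Rightarrow> complex) \<Rightarrow> complex" where
  "normalized_gint E f = det_sqrt E * gint E f"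

text \<open>Differentiating the exponential gives the form of \<open>E'\<close>, and \<open>gint_qform\<close> splits it into a
trace and a second-order operator.  By Jacobi's formula the logarithmic derivative of the root of the
determinant is half that trace, so the trace cancels in the normalised integral.\<close>

lemma normalized_gint_path:
  fixes E E' :: "real \<Rightarrow> complex^'n::finite^'n"
  assumes T: "convex T" "t0 \<in> T" and D: "\<And>t. t \<in> T \<Longrightarrow> E t \<in> det_sqrt_domain"
    and d: "\<And>t k l. t \<in> T \<Longrightarrow> ((\<lambda>t. E t $ k $ l) has_vector_derivative E' t $ k $ l) (at t within T)"
    and c': "\<And>k l. continuous_on T (\<lambda>t. E' t $ k $ l)"
    and W: "W ** E t0 = mat 1" and f: "test_fun f"
  shows "((\<lambda>t. normalized_gint (E t) f) has_vector_derivative 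
     - (1/2) * normalized_gint (E t0) (lap (sandwich W (E' t0)) f)) (at t0 within T)"
proof -
  have c: "continuous_on T (\<lambda>t. E t $ k $ l)" for k l
    unfolding continuous_on_eq_continuous_within
    by (rule ballI) (rule has_vector_derivative_continuous[OF d])
  have cE: "continuous_on T E"
  proof -
    have "continuous_on T (\<lambda>t. \<chi> k l. E t $ k $ l)" by (intro continuous_intros c)
    then show ?thesis by simp
  qed
  have sym: "transpose (E t0) = E t0" using D[OF T(2)] by (simp add: det_sqrt_domain_iff)
  let ?tr = "\<Sum>k\<in>UNIV. \<Sum>l\<in>UNIV. E' t0 $ k $ l * W $ l $ k"
  let ?e = "\<lambda>t x. exp (- (1/2) * qform (E t) x)"
  have fc: "continuous_on UNIV f" by (rule smooth_continuous[OF test_fun_smooth[OF f]])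
  have "((\<lambda>t. LINT x|lborel. ?e t x * f x) has_vector_derivative
      (LINT x|lborel. ?e t0 x * (- (1/2) * qform (E' t0) x) * f x)) (at t0 within T)"
  proof (rule leibniz_bounded_support[OF T, where R = 1])
    fix t x assume t: "t \<in> T"
    have "((\<lambda>t. qform (E t) x) has_vector_derivative qform (E' t) x) (at t within T)"
      unfolding qform_def by (intro has_vector_derivative_sum has_vector_derivative_mult_left d t)
    then have "((\<lambda>t. - (1/2) * qform (E t) x) has_vector_derivative - (1/2) * qform (E' t) x) (at t within T)"
      by (rule has_vector_derivative_mult_right)
    then have "((\<lambda>t. ?e t x) has_vector_derivative (- (1/2) * qform (E' t) x) * ?e t x) (at t within T)"
      by (rule field_vector_diff_chain_within[unfolded o_def, OF _ has_field_derivative_at_within[OF DERIV_exp]])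
    from has_vector_derivative_mult_left[OF this, of "f x"]
    show "((\<lambda>t. ?e t x * f x) has_vector_derivative ?e t x * (- (1/2) * qform (E' t) x) * f x) (at t within T)"
      by (simp add: mult_ac)
  next
    show "continuous_on UNIV (\<lambda>x. ?e t x * f x)" for t
      by (intro continuous_on_mult gaussian_factor_continuous fc)
    have 1: "continuous_on (T \<times> UNIV) (\<lambda>p. E (fst p) $ k $ l)" for k l
      by (rule continuous_on_compose2[OF c]) (auto intro!: continuous_intros)
    have 2: "continuous_on (T \<times> UNIV) (\<lambda>p. E' (fst p) $ k $ l)" for k l
      by (rule continuous_on_compose2[OF c']) (auto intro!: continuous_intros)
    have 3: "continuous_on (T \<times> UNIV) (\<lambda>p. f (snd p))" 
      by (rule continuous_on_compose2[OF fc]) (auto intro!: continuous_intros)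
    show "continuous_on (T \<times> UNIV) (\<lambda>(t, x). ?e t x * (- (1/2) * qform (E' t) x) * f x)"
      unfolding split_beta qform_def by (intro continuous_intros 1 2 3)
  qed (use f in \<open>auto simp: test_fun_def\<close>)
  moreover have "(LINT x|lborel. ?e t0 x * (- (1/2) * qform (E' t0) x) * f x)
     = - (1/2) * (?tr * gint (E t0) f + gint (E t0) (lap (sandwich W (E' t0)) f))"
  proof -
    have "(LINT x|lborel. ?e t0 x * (- (1/2) * qform (E' t0) x) * f x) = gint (E t0) (\<lambda>x. - (1/2) * (qform (E' t0) x * f x))"
      unfolding gint_def by (simp only: mult.assoc)
    also have "\<dots> = - (1/2) * gint (E t0) (\<lambda>x. qform (E' t0) x * f x)" by (rule gint_cmult)
    finally show ?thesis by (simp only: gint_qform[OF sym W f])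
  qed
  ultimately have J: "((\<lambda>t. gint (E t) f) has_vector_derivative
       - (1/2) * (?tr * gint (E t0) f + gint (E t0) (lap (sandwich W (E' t0)) f))) (at t0 within T)"
    by (simp add: gint_def[abs_def])
  have "((\<lambda>t. det_sqrt (E t)) has_vector_derivative (?tr * det (E t0)) / (2 * det_sqrt (E t0))) (at t0 within T)"
  proof (rule has_vector_derivative_sqrt)
    show "continuous_on T (\<lambda>t. det_sqrt (E t))"
      by (rule continuous_on_compose2[OF det_sqrt_continuous cE]) (use D in auto)
    show "(det_sqrt (E t))\<^sup>2 = det (E t)" for t by (rule det_sqrt_square)
    show "((\<lambda>t. det (E t)) has_vector_derivative ?tr * det (E t0)) (at t0 within T)"
      by (rule has_vector_derivative_det[OF d[OF T(2)] W])
  qed (use T D det_sqrt_nonzero in auto)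
  moreover have "(?tr * det (E t0)) / (2 * det_sqrt (E t0)) = (1/2) * ?tr * det_sqrt (E t0)"
    using det_sqrt_nonzero[OF D[OF T(2)]] by (simp add: det_sqrt_square[symmetric] power2_eq_square)
  ultimately have S: "((\<lambda>t. det_sqrt (E t)) has_vector_derivative (1/2) * ?tr * det_sqrt (E t0)) (at t0 within T)" by simp
  from has_vector_derivative_mult[OF S J] show ?thesis
    unfolding normalized_gint_def by (simp add: algebra_simps)
qed


section \<open>Expansion of quadratic phases\<close>

text \<open>Integrate from \<open>t\<close> to 1: the exponent of the singularity improves by one until the function is bounded.
Exponents in \<open>1/2 + \<nat>\<close> never equal 1, so no logarithm occurs.\<close>

lemma singular_step:
  fixes f :: "real \<Rightarrow> complex" and a :: real
  assumes d: "\<And>s. 0 < s \<Longrightarrow> s \<le> 1 \<Longrightarrow> (f has_vector_derivative f' s) (at s within {0<..1})"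
    and b: "\<And>s. 0 < s \<Longrightarrow> s \<le> 1 \<Longrightarrow> norm (f' s) \<le> a * s powr - (real n + 1/2)"
    and f1: "norm (f 1) \<le> a" and t: "0 < t" "t \<le> 1"
  shows "norm (f t) \<le> 3 * a * t powr (if n = 0 then 0 else - (real n - 1/2))"
proof -
  have a: "a \<ge> 0" using order_trans[OF norm_ge_zero f1] .
  define q where "q = real n - 1/2"
  \<comment> \<open>parity keeps the exponent \<open>q\<close> of the antiderivative away from 0\<close>
  have "real (2 * n) \<noteq> real 1" by (subst of_nat_eq_iff) presburger
  then have q: "q \<noteq> 0" by (auto simp: q_def)
  have diff: "norm (f 1 - f t) \<le> a * (t powr - q - 1) / q"
  proof (cases "t = 1")
    case False
    have "norm (f 1 - f t) \<le> - (a / q) * 1 powr - q - (- (a / q) * t powr - q)"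
    proof (rule differentiable_bound_general)
      show "t < 1" using t False by simp
      show "continuous_on {t..1} f"
        unfolding continuous_on_eq_continuous_within
      proof
        fix s assume s: "s \<in> {t..1}"
        have "continuous (at s within {0<..1}) f" 
          by (rule has_vector_derivative_continuous[OF d]) (use s t in auto)
        then show "continuous (at s within {t..1}) f" 
          by (rule continuous_within_subset) (use t in auto)
      qed
      show "continuous_on {t..1} (\<lambda>s. - (a / q) * s powr - q)"
        using t by (intro continuous_intros) auto
      fix s assume s: "t < s" "s < 1"
      have "(f has_vector_derivative f' s) (at s within {0<..<1})"
        using d[of s] s t by (auto intro: has_vector_derivative_within_subset)
      then show "(f has_vector_derivative f' s) (at s)"
        using s t by (simp add: at_within_open[of s "{0<..<1}"])
      have *: "((\<lambda>s. - (a / q) * s powr - q) has_real_derivative - (a / q) * (- q * s powr (- q - 1))) (at s)"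
        using s t by (auto intro!: derivative_eq_intros simp: powr_diff)
      then show "((\<lambda>s. - (a / q) * s powr - q) has_vector_derivative a * s powr - (real n + 1/2)) (at s)"
      proof -
        have "- q - 1 = - (real n + 1/2)" by (simp add: q_def)
        then have "- (a / q) * (- q * s powr (- q - 1)) = a * s powr - (real n + 1/2)" using q by simp
        with * show ?thesis by (simp only: has_real_derivative_iff_has_vector_derivative)
      qed
      show "norm (f' s) \<le> a * s powr - (real n + 1/2)" using b[of s] s t by simp
    qed
    also have "\<dots> = a * (t powr - q - 1) / q" using q by (simp add: field_simps)
    finally show ?thesis .
  qed simp
  have "norm (f t) \<le> norm (f 1) + norm (f 1 - f t)"
    using norm_triangle_ineq4[of "f 1" "f 1 - f t"] by simp
  also have "\<dots> \<le> a + a * (t powr - q - 1) / q" using f1 diff by simp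
  also have "\<dots> \<le> 3 * a * t powr (if n = 0 then 0 else - (real n - 1/2))"
  proof (cases "n = 0")
    case True
    then have "q = - 1/2" by (simp add: q_def)
    then have "a * (t powr - q - 1) / q = 2 * a * (1 - t powr (1/2))" by (simp only:) (simp add: field_simps)
    also have "\<dots> \<le> 2 * a * 1" using a by (intro mult_left_mono) auto
    finally show ?thesis using True t by simp
  next
    case False
    then have q2: "q \<ge> 1/2" by (simp add: q_def)
    have t1: "1 \<le> t powr - q" using t q2 powr_mono'[of "-q" 0 t] by simp
    have "a * (t powr - q - 1) / q \<le> a * (t powr - q - 1) / (1/2)"
      using q2 a t1 by (intro divide_left_mono) auto
    then have "a + a * (t powr - q - 1) / q \<le> a * 1 + a * (t powr - q - 1) / (1/2)" by simp
    also have "\<dots> \<le> 3 * a * t powr - q" using mult_left_mono[OF t1 a] a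
      by (simp add: algebra_simps)
    finally show ?thesis using False by (simp add: q_def)
  qed
  finally show ?thesis .
qed

text \<open>All derivatives up to order \<open>n + 1\<close> share the same singular bound, so \<open>singular_step\<close> improves the first
\<open>n + 1\<close> of them, then the first \<open>n\<close> of these, and so on.\<close>

lemma singular_bound:
  fixes F :: "nat \<Rightarrow> real \<Rightarrow> complex" and a :: real
  assumes d: "\<And>i s. 0 < s \<Longrightarrow> s \<le> 1 \<Longrightarrow> (F i has_vector_derivative F (Suc i) s) (at s within {0<..1})"
    and b: "\<And>i s. i \<le> Suc n \<Longrightarrow> 0 < s \<Longrightarrow> s \<le> 1 \<Longrightarrow> norm (F i s) \<le> a * s powr - (real n + 1/2)"
    and t: "0 < t" "t \<le> 1"
  shows "norm (F 0 t) \<le> 3 ^ Suc n * a"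
  using b
proof (induction n arbitrary: a)
  case 0
  have "norm (F 0 t) \<le> 3 * a * t powr (if (0::nat) = 0 then 0 else - (real 0 - 1/2))"
    by (rule singular_step[where f' = "F (Suc 0)"]) (use d 0[of 1] 0[of 0 1] t in auto)
  then show ?case using t by simp
next
  case (Suc n)
  have "norm (F i s) \<le> (3 * a) * s powr - (real n + 1/2)" if i: "i \<le> Suc n" and s: "0 < s" "s \<le> 1" for i s
  proof -
    have "norm (F i s) \<le> 3 * a * s powr (if Suc n = 0 then 0 else - (real (Suc n) - 1/2))"
    proof (rule singular_step[where f' = "F (Suc i)"])
      show "norm (F (Suc i) s) \<le> a * s powr - (real (Suc n) + 1/2)" if "0 < s" "s \<le> 1" for s
        by (rule Suc.prems) (use i that in auto)
      show "norm (F i 1) \<le> a" using Suc.prems[of i 1] i by simp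
    qed (use d s in auto)
    then show ?thesis by (simp add: algebra_simps)
  qed
  from Suc.IH[OF this] show ?case by simp
qed

text \<open>The sum of \<open>F i t * (1 - t) ^ i / fact i\<close> interpolates between the Taylor polynomial at 0 and the
value at 1, and its derivative telescopes.  At the end points only continuity is required, which is all
that is available at the singular end of the heat equation.\<close>

lemma real_Taylor:
  fixes F :: "nat \<Rightarrow> real \<Rightarrow> complex"
  assumes c: "\<And>i. i \<le> n \<Longrightarrow> continuous_on {0..1} (F i)"
    and d: "\<And>i t. i \<le> n \<Longrightarrow> 0 < t \<Longrightarrow> t < 1 \<Longrightarrow> (F i has_vector_derivative F (Suc i) t) (at t)"
    and B: "\<And>t. 0 < t \<Longrightarrow> t < 1 \<Longrightarrow> norm (F (Suc n) t) \<le> B"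
  shows "norm (F 0 1 - (\<Sum>i\<le>n. F i 0 / fact i)) \<le> B"
proof -
  define G where "G t = (\<Sum>i\<le>n. F i t * (of_real ((1 - t) ^ i / fact i)))" for t
  have G': "((\<lambda>t. \<Sum>i\<le>m. F i t * (of_real ((1 - t) ^ i / fact i))) has_vector_derivative 
     F (Suc m) t * of_real ((1 - t) ^ m / fact m)) (at t)" if "m \<le> n" "0 < t" "t < 1" for m t
    using that(1)
  proof (induction m)
    case 0
    then show ?case using d[of 0 t] that by simp
  next
    case (Suc m)
    have "((\<lambda>t. (1 - t) ^ Suc m / fact (Suc m)) has_real_derivative - ((1 - t) ^ m / fact m)) (at t)"
      by (rule derivative_eq_intros refl | simp)+ 
    then have "((\<lambda>t. complex_of_real ((1 - t) ^ Suc m / fact (Suc m))) has_vector_derivative of_real (- ((1 - t) ^ m / fact m))) (at t)"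
      by (intro has_vector_derivative_of_real) (simp add: has_real_derivative_iff_has_vector_derivative)
    then have "((\<lambda>t. F (Suc m) t * of_real ((1 - t) ^ Suc m / fact (Suc m))) has_vector_derivative
       F (Suc m) t * of_real (- ((1 - t) ^ m / fact m)) + F (Suc (Suc m)) t * of_real ((1 - t) ^ Suc m / fact (Suc m))) (at t)"
      using d[of "Suc m" t] Suc.prems that by (intro has_vector_derivative_mult) auto
    from has_vector_derivative_add[OF Suc.IH this] Suc.prems show ?case by simp
  qed
  have "norm (G 1 - G 0) \<le> B * 1 - B * 0"
  proof (rule differentiable_bound_general)
    show "continuous_on {0..1} G" unfolding G_def by (intro continuous_intros c) auto
    fix t :: real assume t: "0 < t" "t < 1"
    show "(G has_vector_derivative F (Suc n) t * of_real ((1 - t) ^ n / fact n)) (at t)"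
      unfolding G_def using G'[OF order_refl t] .
    have "(1 - t) ^ n / fact n \<le> 1 / 1"
      using t by (intro frac_le power_le_one) (auto simp: fact_ge_1)
    then have "norm (F (Suc n) t) * norm (complex_of_real ((1 - t) ^ n / fact n)) \<le> B * 1"
      using B[OF t] t order_trans[OF norm_ge_zero B[OF t]] unfolding norm_of_real
      by (intro mult_mono) auto
    then show "norm (F (Suc n) t * of_real ((1 - t) ^ n / fact n)) \<le> B" by (simp only: norm_mult mult_1_right)
    show "((*) B has_vector_derivative B) (at t)"
      by (auto intro!: derivative_eq_intros simp: has_real_derivative_iff_has_vector_derivative[symmetric])
  qed (auto intro!: continuous_intros)
  moreover have "G 1 = F 0 1"
  proof -
    have "G 1 = (\<Sum>i\<le>n. if i = 0 then F 0 1 else 0)"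
      unfolding G_def by (intro sum.cong refl) (auto simp: power_0_left)
    then show ?thesis by simp
  qed
  ultimately show ?thesis by (simp add: G_def divide_inverse)
qed

lemma lap_scaleR: "lap (c *\<^sub>R P) f = (\<lambda>x. of_real c * lap P f x)"
  by (simp add: lap_def fun_eq_iff sum_distrib_left scaleR_conv_of_real[where 'a = complex] mult_ac)

lemma normalized_gint_cmult: "normalized_gint E (\<lambda>x. a * f x) = a * normalized_gint E f"
  by (simp add: normalized_gint_def gint_cmult)

text \<open>The trivial bound, with the exponent \<open>d / 2\<close> weakened to \<open>d + 1/2\<close> so that \<open>singular_bound\<close> applies
for \<open>d\<close> of either parity.\<close>

lemma norm_normalized_gint:
  fixes f :: "real^'n::finite \<Rightarrow> complex" and M :: real
  assumes E: "E \<in> det_sqrt_domain" and t: "0 < t" "t \<le> 1" and f: "test_fun f" and M: "\<And>x. norm (f x) \<le> M"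
  shows "norm (normalized_gint ((1 / t) *\<^sub>R E) f)
    \<le> (norm (det_sqrt E) * measure lborel (cball (0::real^'n) 1) * M) * t powr - (real CARD('n) + 1/2)"
proof -
  have M0: "M \<ge> 0" using order_trans[OF norm_ge_zero M[of 0]] .
  have "norm (gint ((1 / t) *\<^sub>R E) f) \<le> M * measure lborel (cball (0::real^'n) 1)"
    unfolding gint_def
  proof (rule norm_integral_bounded_support)
    fix x :: "real^'n"
    show "norm x > 1 \<Longrightarrow> exp (- (1/2) * qform ((1 / t) *\<^sub>R E) x) * f x = 0" using f by (simp add: test_fun_def)
    have "Re (qform ((1 / t) *\<^sub>R E) x) \<ge> 0" using scaleR_domain[OF E, of "1 / t"] t by (simp add: det_sqrt_domain_iff)
    then have "norm (exp (- (1/2) * qform ((1 / t) *\<^sub>R E) x)) \<le> 1" by (simp add: norm_exp_eq_Re)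
    then have "norm (exp (- (1/2) * qform ((1 / t) *\<^sub>R E) x)) * norm (f x) \<le> 1 * M"
      using M by (intro mult_mono) auto
    then show "norm (exp (- (1/2) * qform ((1 / t) *\<^sub>R E) x) * f x) \<le> M" by (simp add: norm_mult)
  qed
  then have "norm (normalized_gint ((1 / t) *\<^sub>R E) f) 
     \<le> ((1 / t) powr (CARD('n) / 2) * norm (det_sqrt E)) * (M * measure lborel (cball (0::real^'n) 1))"
    unfolding normalized_gint_def norm_mult using t by (subst norm_det_sqrt_scaleR) (auto intro!: mult_left_mono)
  also have "\<dots> = (norm (det_sqrt E) * measure lborel (cball (0::real^'n) 1) * M) * t powr - (real CARD('n) / 2)"
    using t by (simp add: powr_divide powr_minus_divide)
  also have "\<dots> \<le> (norm (det_sqrt E) * measure lborel (cball (0::real^'n) 1) * M) * t powr - (real CARD('n) + 1/2)"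
    using t M0 by (intro mult_left_mono powr_mono') auto
  finally show ?thesis .
qed

lemma sandwich_inverse:
  fixes E W :: "complex^'n::finite^'n"
  assumes E: "transpose E = E" and W: "W ** E = mat 1" "E ** W = mat 1"
  shows "sandwich W E = W"
proof -
  have "transpose W ** E = mat 1"
    using W(2) E matrix_transpose_mul[of E W] by (simp add: transpose_mat)
  then have Wt: "transpose W = W"
    by (metis W(2) matrix_mul_assoc matrix_mul_lid matrix_mul_rid)
  have "sandwich W E $ m $ p = ((transpose W ** E) ** W) $ m $ p" for m p
  proof -
    have "((transpose W ** E) ** W) $ m $ p = (\<Sum>l\<in>UNIV. \<Sum>k\<in>UNIV. E $ k $ l * W $ k $ m * W $ l $ p)"
      by (simp add: matrix_matrix_mult_def transpose_def sum_distrib_left sum_distrib_right mult_ac)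
    also have "\<dots> = (\<Sum>k\<in>UNIV. \<Sum>l\<in>UNIV. E $ k $ l * W $ k $ m * W $ l $ p)" by (rule sum.swap)
    finally show ?thesis by (simp add: sandwich_def)
  qed
  then have "sandwich W E = (transpose W ** E) ** W" by (simp add: vec_eq_iff)
  then show ?thesis by (simp add: Wt W)
qed

lemma sandwich_scaleR: "sandwich (a *\<^sub>R W) (b *\<^sub>R P) = (a * a * b) *\<^sub>R sandwich W P"
  by (simp add: sandwich_def vec_eq_iff sum_distrib_left scaleR_conv_of_real[where 'a = complex] mult_ac)

lemma matrix_scaleR_mult:
  fixes A B :: "complex^'n::finite^'n"
  shows "(a *\<^sub>R A) ** (b *\<^sub>R B) = (a * b) *\<^sub>R (A ** B)"
  by (simp add: matrix_matrix_mult_def vec_eq_iff sum_distrib_left scaleR_conv_of_real[where 'a = complex] mult_ac)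

context
  fixes E W :: "complex^'n::finite^'n"
  assumes E: "E \<in> det_sqrt_domain" and W: "W ** E = mat 1" "E ** W = mat 1"
begin

text \<open>Along the path \<open>E / t\<close> with derivative \<open>- E / t\<^sup>2\<close> and inverse \<open>t W\<close>, the matrix \<open>W\<^sup>T E' W\<close> of
\<open>normalized_gint_path\<close> is \<open>- W\<close>, independently of \<open>t\<close>.  Hence the \<open>t\<close>-derivative acts on \<open>f\<close> as a
fixed operator.\<close>

lemma normalized_gint_heat:
  assumes f: "test_fun f" and t: "0 < t" "t \<le> 1"
  shows "((\<lambda>t. normalized_gint ((1 / t) *\<^sub>R E) f) has_vector_derivative
     normalized_gint ((1 / t) *\<^sub>R E) (lap ((1/2) *\<^sub>R W) f)) (at t within {0<..1})"
proof -
  have "((\<lambda>t. normalized_gint ((1 / t) *\<^sub>R E) f) has_vector_derivative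
     - (1/2) * normalized_gint ((1 / t) *\<^sub>R E) (lap (sandwich (t *\<^sub>R W) ((- 1 / t\<^sup>2) *\<^sub>R E)) f)) (at t within {0<..1})"
  proof (rule normalized_gint_path)
    show "(1 / s) *\<^sub>R E \<in> det_sqrt_domain" if "s \<in> {0<..1}" for s
      using that by (intro scaleR_domain E) auto
    fix s :: real and k l assume s: "s \<in> {0<..1}"
    have "((\<lambda>s. (1 / s) *\<^sub>R (E $ k $ l)) has_vector_derivative ((- 1 / s\<^sup>2) *\<^sub>R (E $ k $ l))) (at s)"
      using s by (auto intro!: derivative_eq_intros simp: power2_eq_square)
    then show "((\<lambda>s. ((1 / s) *\<^sub>R E) $ k $ l) has_vector_derivative ((- 1 / s\<^sup>2) *\<^sub>R E) $ k $ l) (at s within {0<..1})"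
      by (simp add: has_vector_derivative_at_within)
  next
    show "continuous_on {0<..1} (\<lambda>s. ((- 1 / s\<^sup>2) *\<^sub>R E) $ k $ l)" for k l
      unfolding vector_scaleR_component by (intro continuous_intros) auto
    show "t *\<^sub>R W ** (1 / t) *\<^sub>R E = mat 1" using t by (simp add: matrix_scaleR_mult W)
  qed (use t f in auto)
  moreover have "sandwich (t *\<^sub>R W) ((- 1 / t\<^sup>2) *\<^sub>R E) = (-1) *\<^sub>R W"
    unfolding sandwich_scaleR using E t W
    by (subst sandwich_inverse) (auto simp: det_sqrt_domain_iff power2_eq_square)
  ultimately show ?thesis
    by (simp only: lap_scaleR normalized_gint_cmult) simp
qed

text \<open>By the heat equation the \<open>t\<close>-derivatives are again normalised integrals and obey the trivial bound,
which \<open>singular_bound\<close> turns into one without negative powers of \<open>t\<close>.\<close>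

lemma normalized_gint_bound:
  assumes f: "test_fun f" and M: "\<And>i x. i \<le> Suc CARD('n) \<Longrightarrow> norm ((lap ((1/2) *\<^sub>R W) ^^ i) f x) \<le> M"
    and t: "0 < t" "t \<le> 1"
  shows "norm (normalized_gint ((1 / t) *\<^sub>R E) f) 
    \<le> 3 ^ Suc CARD('n) * (norm (det_sqrt E) * measure lborel (cball (0::real^'n) 1) * M)"
proof -
  have "norm (normalized_gint ((1 / t) *\<^sub>R E) ((lap ((1/2) *\<^sub>R W) ^^ 0) f)) 
    \<le> 3 ^ Suc CARD('n) * (norm (det_sqrt E) * measure lborel (cball (0::real^'n) 1) * M)"
  proof (rule singular_bound[where F = "\<lambda>i t. normalized_gint ((1 / t) *\<^sub>R E) ((lap ((1/2) *\<^sub>R W) ^^ i) f)", OF _ _ t])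
    show "((\<lambda>t. normalized_gint ((1 / t) *\<^sub>R E) ((lap ((1/2) *\<^sub>R W) ^^ i) f)) has_vector_derivative
        normalized_gint ((1 / s) *\<^sub>R E) ((lap ((1/2) *\<^sub>R W) ^^ Suc i) f)) (at s within {0<..1})" 
      if "0 < s" "s \<le> 1" for i s
      using normalized_gint_heat[OF test_fun_lap_power[OF f] that] by simp
    show "norm (normalized_gint ((1 / s) *\<^sub>R E) ((lap ((1/2) *\<^sub>R W) ^^ i) f))
      \<le> (norm (det_sqrt E) * measure lborel (cball (0::real^'n) 1) * M) * s powr - (real CARD('n) + 1/2)"
      if "i \<le> Suc CARD('n)" "0 < s" "s \<le> 1" for i s
      by (rule norm_normalized_gint[OF E that(2,3) test_fun_lap_power[OF f] M[OF that(1)]])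
  qed
  then show ?thesis by simp
qed

end

subsection \<open>The real Gaussian\<close>

lemma gaussian_integral_real: "(\<integral>\<^sup>+x. ennreal (exp (- x\<^sup>2 / 2)) \<partial>lborel) = ennreal (sqrt (2 * pi))"
proof -
  have "emeasure (density lborel std_normal_density) UNIV = 1"
    using prob_space.emeasure_space_1[OF prob_space_normal_density[of 1 0]] by simp
  then have "(\<integral>\<^sup>+x. ennreal (std_normal_density x) \<partial>lborel) = 1"
    by (simp add: emeasure_density)
  moreover have "(\<integral>\<^sup>+x. ennreal (exp (- x\<^sup>2 / 2)) \<partial>lborel)
      = (\<integral>\<^sup>+x. ennreal (sqrt (2 * pi)) * ennreal (std_normal_density x) \<partial>lborel)"
    by (intro nn_integral_cong) (simp add: std_normal_density_def flip: ennreal_mult)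
  ultimately show ?thesis by (simp add: nn_integral_cmult)
qed

lemma gaussian_integral:
  "has_bochner_integral lborel (\<lambda>x::real^'n::finite. exp (- (norm x)\<^sup>2 / 2)) ((2 * pi) powr (CARD('n) / 2))"
proof (rule has_bochner_integral_nn_integral)
  have "(\<integral>\<^sup>+x. ennreal (exp (- (norm x)\<^sup>2 / 2)) \<partial>(lborel :: (real^'n) measure))
     = (\<integral>\<^sup>+x. (\<Prod>b\<in>Basis. ennreal (exp (- (x \<bullet> b)\<^sup>2 / 2))) \<partial>(lborel :: (real^'n) measure))"
  proof (intro nn_integral_cong)
    fix x :: "real^'n"
    have "- (norm x)\<^sup>2 / 2 = (\<Sum>b\<in>Basis. - (x \<bullet> b)\<^sup>2 / 2)"
      by (simp add: norm_eq_sqrt_inner[of x] euclidean_inner[of x x] sum_nonneg power2_eq_square sum_divide_distrib sum_negf)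
    then show "ennreal (exp (- (norm x)\<^sup>2 / 2)) = (\<Prod>b\<in>Basis. ennreal (exp (- (x \<bullet> b)\<^sup>2 / 2)))"
      by (simp add: exp_sum prod_ennreal)
  qed
  also have "\<dots> = (\<Prod>b\<in>(Basis :: (real^'n) set). \<integral>\<^sup>+y. ennreal (exp (- y\<^sup>2 / 2)) \<partial>lborel)"
    by (rule nn_integral_lborel_prod) auto
  also have "\<dots> = ennreal (sqrt (2 * pi) ^ CARD('n))"
    by (simp only: gaussian_integral_real prod_constant) (simp add: ennreal_power)
  also have "sqrt (2 * pi) ^ CARD('n) = (2 * pi) powr (CARD('n) / 2)"
    by (simp add: powr_half_sqrt[symmetric] powr_powr flip: powr_realpow)
  finally show "(\<integral>\<^sup>+x. ennreal (exp (- (norm x)\<^sup>2 / 2)) \<partial>(lborel :: (real^'n) measure)) = ennreal ((2 * pi) powr (CARD('n) / 2))" .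
qed auto

text \<open>The substitution \<open>x = sqrt t * y\<close> absorbs the normalising factor.\<close>

lemma normalized_gint_mat1:
  fixes f :: "real^'n::finite \<Rightarrow> complex"
  assumes f: "test_fun f" and t: "t > 0"
  shows "normalized_gint ((1 / t) *\<^sub>R mat 1) f = (LINT y|lborel. of_real (exp (- (norm y)\<^sup>2 / 2)) * f (sqrt t *\<^sub>R y))"
proof -
  let ?g = "\<lambda>x. exp (- (1/2) * qform ((1 / t) *\<^sub>R mat 1) x) * f x"
  have g: "?g \<in> borel_measurable borel"
    by (intro borel_measurable_continuous_onI continuous_on_mult gaussian_factor_continuous 
        smooth_continuous test_fun_smooth[OF f])
  have t0: "sqrt t \<noteq> 0" "sqrt t > 0" using t by auto
  have "gint ((1 / t) *\<^sub>R mat 1) f = (LINT x|density (distr lborel borel (\<lambda>x. 0 + sqrt t *\<^sub>R x)) (\<lambda>_. ennreal (\<bar>sqrt t\<bar> ^ DIM(real^'n))). ?g x)"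
    unfolding gint_def using lborel_affine[OF t0(1), where t = "0::real^'n"] by simp
  also have "\<dots> = (LINT x|distr lborel borel (\<lambda>x. 0 + sqrt t *\<^sub>R x). (sqrt t ^ CARD('n)) *\<^sub>R ?g x)"
    using t0 g by (subst integral_density) auto
  also have "\<dots> = (LINT y|lborel. (sqrt t ^ CARD('n)) *\<^sub>R ?g (sqrt t *\<^sub>R y))"
    using g by (subst integral_distr) auto
  also have "\<dots> = of_real (sqrt t ^ CARD('n)) * (LINT y|lborel. ?g (sqrt t *\<^sub>R y))"
    by (simp add: scaleR_conv_of_real)
  also have "(LINT y|lborel. ?g (sqrt t *\<^sub>R y)) = (LINT y|lborel. of_real (exp (- (norm y)\<^sup>2 / 2)) * f (sqrt t *\<^sub>R y))"
  proof (intro Bochner_Integration.integral_cong refl)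
    fix y :: "real^'n"
    have "- (1/2) * qform ((1 / t) *\<^sub>R mat 1) (sqrt t *\<^sub>R y) = of_real (- (norm y)\<^sup>2 / 2)"
      using t by (simp add: qform_scaleR qform_mat1 power_mult_distrib scaleR_conv_of_real[where 'a = complex])
    then show "?g (sqrt t *\<^sub>R y) = of_real (exp (- (norm y)\<^sup>2 / 2)) * f (sqrt t *\<^sub>R y)"
      by (simp only: exp_of_real)
  qed
  finally have G: "gint ((1 / t) *\<^sub>R mat 1) f = of_real (sqrt t ^ CARD('n)) * (LINT y|lborel. of_real (exp (- (norm y)\<^sup>2 / 2)) * f (sqrt t *\<^sub>R y))" .
  have P: "(1 / t) powr (CARD('n) / 2) * sqrt t ^ CARD('n) = 1"
  proof -
    have "sqrt t ^ CARD('n) = t powr (CARD('n) / 2)"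
      using t by (simp add: powr_half_sqrt[symmetric] powr_powr flip: powr_realpow)
    then show ?thesis using t by (simp add: powr_divide)
  qed
  have S: "det_sqrt ((1 / t) *\<^sub>R mat 1 :: complex^'n^'n) = of_real ((1 / t) powr (CARD('n) / 2))"
    using t by (intro det_sqrt_mat1) simp
  have "normalized_gint ((1 / t) *\<^sub>R mat 1) f = of_real ((1 / t) powr (CARD('n) / 2) * sqrt t ^ CARD('n))
      * (LINT y|lborel. of_real (exp (- (norm y)\<^sup>2 / 2)) * f (sqrt t *\<^sub>R y))"
    unfolding normalized_gint_def G S of_real_mult mult.assoc ..
  then show ?thesis unfolding P by simp
qed

lemma normalized_gint_mat1_tendsto:
  fixes f :: "real^'n::finite \<Rightarrow> complex"
  assumes f: "test_fun f"
  shows "((\<lambda>t. normalized_gint ((1 / t) *\<^sub>R mat 1) f) \<longlongrightarrow> of_real ((2 * pi) powr (CARD('n) / 2)) * f 0) (at_right 0)"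
  unfolding tendsto_at_iff_sequentially
proof (intro allI impI)
  fix X :: "nat \<Rightarrow> real" assume X: "\<forall>i. X i \<in> {0<..} - {0}" "X \<longlonglongrightarrow> 0"
  let ?G = "\<lambda>y::real^'n. exp (- (norm y)\<^sup>2 / 2)"
  have fc: "continuous_on UNIV f" by (rule smooth_continuous[OF test_fun_smooth[OF f]])
  obtain M where M: "M \<ge> 0" "\<And>x. norm (f x) \<le> M"
    using test_fun_bounded[OF f, of 0] by (metis iter_partial_Nil list.size(3) order_refl)
  have Gi: "integrable lborel ?G" using gaussian_integral integrable.intros by blast
  have "(\<lambda>i. LINT y|lborel. of_real (?G y) * f (sqrt (X i) *\<^sub>R y)) \<longlonglongrightarrow> (LINT y|lborel. of_real (?G y) * f 0)"
  proof (rule integral_dominated_convergence[where w = "\<lambda>y. M * ?G y"])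
    show "integrable lborel (\<lambda>y. M * ?G y)" using Gi by simp
    have G: "continuous_on UNIV (\<lambda>y. complex_of_real (?G y))" by (intro continuous_intros) auto
    show "(\<lambda>y. of_real (?G y) * f 0) \<in> borel_measurable lborel"
      using borel_measurable_continuous_onI[OF continuous_on_mult[OF G continuous_on_const]] by simp
    show "(\<lambda>y. of_real (?G y) * f (sqrt (X i) *\<^sub>R y)) \<in> borel_measurable lborel" for i
    proof -
      have "continuous_on UNIV (\<lambda>y. f (sqrt (X i) *\<^sub>R y))"
        by (rule continuous_on_compose2[OF fc]) (auto intro!: continuous_intros)
      from borel_measurable_continuous_onI[OF continuous_on_mult[OF G this]] show ?thesis by simp
    qed
    show "AE y in lborel. (\<lambda>i. of_real (?G y) * f (sqrt (X i) *\<^sub>R y)) \<longlonglongrightarrow> of_real (?G y) * f 0"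
    proof (intro AE_I2 tendsto_mult tendsto_const)
      fix y :: "real^'n"
      have "(\<lambda>i. sqrt (X i) *\<^sub>R y) \<longlonglongrightarrow> sqrt 0 *\<^sub>R y" by (intro tendsto_intros X(2))
      then have "(\<lambda>i. sqrt (X i) *\<^sub>R y) \<longlonglongrightarrow> 0" by simp
      then show "(\<lambda>i. f (sqrt (X i) *\<^sub>R y)) \<longlonglongrightarrow> f 0"
        using continuous_on_tendsto_compose[OF fc, of _ 0 sequentially] by simp
    qed
    show "AE y in lborel. norm (of_real (?G y) * f (sqrt (X i) *\<^sub>R y)) \<le> M * ?G y" for i
      using M by (auto simp: norm_mult mult.commute[of M] intro!: AE_I2 mult_left_mono)
  qed
  moreover have "(LINT y|lborel. of_real (?G y) * f 0) = of_real ((2 * pi) powr (CARD('n) / 2)) * f 0"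
  proof -
    have "(LINT y|lborel. of_real (?G y) * f 0) = (LINT y|lborel. complex_of_real (?G y)) * f 0"
      by (rule integral_mult_left_zero)
    also have "(LINT y|lborel. complex_of_real (?G y)) = of_real (LINT y|lborel. ?G y)"
      by (rule integral_complex_of_real)
    also have "(LINT y|lborel. ?G y) = (2 * pi) powr (CARD('n) / 2)"
      by (rule has_bochner_integral_integral_eq[OF gaussian_integral])
    finally show ?thesis .
  qed
  moreover have "(\<lambda>t. normalized_gint ((1 / t) *\<^sub>R mat 1) f) \<circ> X = (\<lambda>i. LINT y|lborel. of_real (?G y) * f (sqrt (X i) *\<^sub>R y))"
    using X(1) by (auto simp: fun_eq_iff normalized_gint_mat1[OF f])
  ultimately show "((\<lambda>t. normalized_gint ((1 / t) *\<^sub>R mat 1) f) \<circ> X) \<longlonglongrightarrow> of_real ((2 * pi) powr (CARD('n) / 2)) * f 0"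
    by (simp only:)
qed


subsection \<open>The limit at the singular end and the expansion\<close>

lemma continuous_on_bounded_01:
  fixes f :: "real \<Rightarrow> complex"
  assumes "continuous_on {0..1} f"
  obtains M where "M \<ge> 0" "\<And>t. t \<in> {0..1} \<Longrightarrow> norm (f t) \<le> M"
proof -
  have "compact (f ` {0..1})" by (intro compact_continuous_image assms compact_Icc)
  then obtain M where M: "\<forall>y\<in>f ` {0..1}. norm y \<le> M"
    using compact_imp_bounded bounded_iff by metis
  have "M \<ge> 0" using M order_trans[OF norm_ge_zero, of "f 0" M] by auto
  with M show ?thesis by (intro that) auto
qed

text \<open>By Cramer's rule the entries of the inverse are quotients of determinants that depend continuously
on the compact parameter interval.\<close>

lemma interp_inverse_bounded:
  fixes E :: "complex^'n::finite^'n"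
  assumes E: "E \<in> det_sqrt_domain"
  obtains w where "w \<ge> 1" "\<And>t. t \<in> {0..1} \<Longrightarrow>
    \<exists>W. W ** interp E t = mat 1 \<and> interp E t ** W = mat 1 \<and> (\<forall>k l. norm (W $ k $ l) \<le> w)"
proof -
  \<comment> \<open>the entry \<open>(k, j)\<close> of the inverse of \<open>interp E t\<close>\<close>
  define V where "V k j t = det (\<chi> i l. if l = k then axis j 1 $ i else interp E t $ i $ l) / det (interp E t)" for k j t
  have nz: "det (interp E t) \<noteq> 0" if "t \<in> {0..1}" for t
    using interp_domain[OF E that] by (simp add: det_sqrt_domain_iff)
  have comp: "continuous_on {0..1} (\<lambda>t. interp E t $ i $ l)" for i l by (intro continuous_intros)
  have "continuous_on {0..1} (\<lambda>t. if l = k then axis j 1 $ i else interp E t $ i $ l)" for i j k l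
    by (cases "l = k") (simp_all add: comp)
  then have mat: "continuous_on {0..1} (\<lambda>t. \<chi> i l. if l = k then axis j 1 $ i else interp E t $ i $ l)" for k j
    by (intro continuous_on_vec_lambda)
  have Vc: "continuous_on {0..1} (V k j)" for k j
    unfolding V_def
    by (rule continuous_on_divide[OF continuous_on_det[OF mat] continuous_on_det[OF continuous_on_interp]])
       (use nz in auto)
  have "\<exists>M. M \<ge> 0 \<and> (\<forall>t\<in>{0..1}. norm (V k j t) \<le> M)" for k j
    by (rule continuous_on_bounded_01[OF Vc]) blast
  then obtain M where M: "\<And>k j. M k j \<ge> 0" "\<And>k j t. t \<in> {0..1} \<Longrightarrow> norm (V k j t) \<le> M k j" by metis
  define w where "w = 1 + (\<Sum>k\<in>UNIV. \<Sum>j\<in>UNIV. M k j)"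
  have Mw: "M k j \<le> w" for k j
  proof -
    have "M k j \<le> (\<Sum>j\<in>UNIV. M k j)" by (rule member_le_sum) (use M in auto)
    also have "\<dots> \<le> (\<Sum>k\<in>UNIV. \<Sum>j\<in>UNIV. M k j)" by (rule member_le_sum) (use M in \<open>auto intro: sum_nonneg\<close>)
    finally show ?thesis by (simp add: w_def)
  qed
  show ?thesis
  proof (rule that)
    show "w \<ge> 1" using M(1) by (simp add: w_def sum_nonneg)
    fix t :: real assume t: "t \<in> {0..1}"
    then have "invertible (interp E t)" using nz by (simp add: invertible_det_nz)
    then obtain W where W: "interp E t ** W = mat 1" "W ** interp E t = mat 1" by (auto simp: invertible_def)
    have "W $ k $ j = V k j t" for k j
    proof -
      have "interp E t *v column j W = axis j 1"
        using W(1) by (simp add: vec_eq_iff matrix_vector_mult_def matrix_matrix_mult_def column_def mat_def axis_def)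
      then have "column j W = (\<chi> k. det (\<chi> i l. if l = k then axis j 1 $ i else interp E t $ i $ l) / det (interp E t))"
        using cramer[OF nz[OF t]] by blast
      then show ?thesis by (simp add: vec_eq_iff column_def V_def)
    qed
    then have "norm (W $ k $ j) \<le> w" for k j using M(2)[OF t, of k j] Mw[of k j] by simp
    with W show "\<exists>W. W ** interp E t = mat 1 \<and> interp E t ** W = mat 1 \<and> (\<forall>k l. norm (W $ k $ l) \<le> w)" by blast
  qed
qed

lemma norm_lap_power:
  fixes f :: "real^'n::finite \<Rightarrow> complex"
  assumes f: "smooth f" and P: "\<And>k l. norm (P $ k $ l) \<le> p"
    and M: "\<And>ks. length ks = 2 * i \<Longrightarrow> norm (iter_partial ks f x) \<le> M"
  shows "norm ((lap P ^^ i) f x) \<le> (real CARD('n) ^ 2 * p) ^ i * M"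
  using norm_iter_lap_power[OF f P, of i "[]" x M] M by simp

text \<open>Move along the segment from the identity to \<open>E\<close>, both scaled by \<open>1 / \<tau>\<close>.  In \<open>normalized_gint_path\<close> the
inverse contributes \<open>\<tau>\<close> twice and the derivative of the path contributes \<open>1 / \<tau>\<close>, so that the speed is
\<open>\<tau>\<close> times a normalised integral, and the latter is bounded uniformly by \<open>normalized_gint_bound\<close>.\<close>

lemma normalized_gint_mat1_diff:
  fixes E :: "complex^'n::finite^'n"
  assumes E: "E \<in> det_sqrt_domain" and f: "test_fun f"
  obtains C where "\<And>\<tau>. 0 < \<tau> \<Longrightarrow> \<tau> \<le> 1 \<Longrightarrow>
    norm (normalized_gint ((1 / \<tau>) *\<^sub>R E) f - normalized_gint ((1 / \<tau>) *\<^sub>R mat 1) f) \<le> C * \<tau>"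
proof -
  obtain w where w: "w \<ge> 1" "\<And>t. t \<in> {0..1} \<Longrightarrow>
    \<exists>W. W ** interp E t = mat 1 \<and> interp E t ** W = mat 1 \<and> (\<forall>k l. norm (W $ k $ l) \<le> w)"
    using interp_inverse_bounded[OF E] by blast
  define e where "e = (\<Sum>k\<in>UNIV. \<Sum>l\<in>UNIV. norm ((E - mat 1) $ k $ l))"
  have e: "norm ((E - mat 1) $ k $ l) \<le> e" for k l
  proof -
    have "norm ((E - mat 1) $ k $ l) \<le> (\<Sum>l\<in>UNIV. norm ((E - mat 1) $ k $ l))" by (rule member_le_sum) auto
    also have "\<dots> \<le> e" unfolding e_def by (rule member_le_sum) (auto intro: sum_nonneg)
    finally show ?thesis .
  qed
  have "continuous_on {0..1} (\<lambda>t. det_sqrt (interp E t))"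
    by (rule continuous_on_compose2[OF det_sqrt_continuous]) (use interp_domain[OF E] in \<open>auto intro!: continuous_intros\<close>)
  then obtain s where s: "s \<ge> 0" "\<And>t. t \<in> {0..1} \<Longrightarrow> norm (det_sqrt (interp E t)) \<le> s"
    using continuous_on_bounded_01 by blast
  obtain M0 where M0: "M0 \<ge> 0" "\<And>ks x. length ks \<le> 2 * CARD('n) + 4 \<Longrightarrow> norm (iter_partial ks f x) \<le> M0"
    using test_fun_bounded[OF f] by blast
  let ?d = "real CARD('n)"
  have d1: "?d \<ge> 1" by (simp add: Suc_leI)
  define p where "p = ?d ^ 2 * (e * w * w)"
  define M where "M = (?d ^ 2 * w) ^ Suc CARD('n) * (?d ^ 2 * p * M0)"
  define C where "C = 3 ^ Suc CARD('n) * (s * measure lborel (cball (0::real^'n) 1) * M)"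
  have e0: "e \<ge> 0" using order_trans[OF norm_ge_zero e] .
  have p0: "p \<ge> 0" using e0 w by (simp add: p_def)
  show ?thesis
  proof (rule that)
    fix \<tau> :: real assume \<tau>: "0 < \<tau>" "\<tau> \<le> 1"
    let ?G = "\<lambda>t. normalized_gint ((1 / \<tau>) *\<^sub>R interp E t) f"
    have der: "\<exists>D. (?G has_vector_derivative D) (at t within {0..1}) \<and> norm D \<le> C * \<tau>" if t: "t \<in> {0..1}" for t
    proof -
      obtain W where W: "W ** interp E t = mat 1" "interp E t ** W = mat 1" "\<And>k l. norm (W $ k $ l) \<le> w"
        using w(2)[OF t] by blast
      let ?P = "sandwich W (E - mat 1)"
      have P: "norm (?P $ m $ q) \<le> p" for m q
      proof -
        have "norm ((E - mat 1) $ k $ l * W $ k $ m * W $ l $ q) \<le> e * w * w" for k l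
          unfolding norm_mult using e W(3) e0 w by (intro mult_mono mult_nonneg_nonneg) auto
        then have "norm (\<Sum>l\<in>UNIV. (E - mat 1) $ k $ l * W $ k $ m * W $ l $ q) \<le> (\<Sum>l\<in>(UNIV::'n set). e * w * w)" for k
          by (rule sum_norm_le)
        then have "norm (\<Sum>k\<in>UNIV. \<Sum>l\<in>UNIV. (E - mat 1) $ k $ l * W $ k $ m * W $ l $ q) \<le> (\<Sum>k\<in>(UNIV::'n set). \<Sum>l\<in>(UNIV::'n set). e * w * w)"
          by (rule sum_norm_le)
        then show ?thesis by (simp add: sandwich_def p_def power2_eq_square mult_ac)
      qed
      have "(?G has_vector_derivative - (1/2) * normalized_gint ((1 / \<tau>) *\<^sub>R interp E t) 
          (lap (sandwich (\<tau> *\<^sub>R W) ((1 / \<tau>) *\<^sub>R (E - mat 1))) f)) (at t within {0..1})"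
      proof (rule normalized_gint_path)
        show "(1 / \<tau>) *\<^sub>R interp E t \<in> det_sqrt_domain" if "t \<in> {0..1}" for t
          using \<tau> by (intro scaleR_domain interp_domain E that) simp
        show "((\<lambda>t. ((1 / \<tau>) *\<^sub>R interp E t) $ k $ l) has_vector_derivative ((1 / \<tau>) *\<^sub>R (E - mat 1)) $ k $ l) (at u within {0..1})" 
          for u k l
          unfolding interp_def vector_scaleR_component vector_add_component
          by (auto intro!: derivative_eq_intros simp: scaleR_diff_right)
        show "\<tau> *\<^sub>R W ** (1 / \<tau>) *\<^sub>R interp E t = mat 1" using \<tau> W by (simp add: matrix_scaleR_mult)
      qed (use t f in auto)
      moreover have "sandwich (\<tau> *\<^sub>R W) ((1 / \<tau>) *\<^sub>R (E - mat 1)) = \<tau> *\<^sub>R ?P"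
        unfolding sandwich_scaleR using \<tau> by simp
      ultimately have D: "(?G has_vector_derivative - (1/2) * (of_real \<tau> * normalized_gint ((1 / \<tau>) *\<^sub>R interp E t) (lap ?P f))) 
         (at t within {0..1})" by (simp only: lap_scaleR normalized_gint_cmult)
      have "norm (normalized_gint ((1 / \<tau>) *\<^sub>R interp E t) (lap ?P f))
         \<le> 3 ^ Suc CARD('n) * (norm (det_sqrt (interp E t)) * measure lborel (cball (0::real^'n) 1) * M)"
      proof (rule normalized_gint_bound[OF interp_domain[OF E t] W(1,2) test_fun_lap[OF f] _ \<tau>])
        fix i and x :: "real^'n" assume i: "i \<le> Suc CARD('n)"
        have "norm ((lap ((1/2) *\<^sub>R W) ^^ i) (lap ?P f) x) \<le> (?d ^ 2 * w) ^ i * (?d ^ 2 * p * M0)"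
        proof (rule norm_lap_power[OF smooth_lap[OF test_fun_smooth[OF f]]])
          show "norm (((1/2) *\<^sub>R W) $ k $ l) \<le> w" for k l
            using W(3)[of k l] w(1) by simp
          fix ks :: "'n list" assume ks: "length ks = 2 * i"
          have "norm (iter_partial ks ((lap ?P ^^ 1) f) x) \<le> (?d ^ 2 * p) ^ 1 * M0"
            by (rule norm_iter_lap_power[OF test_fun_smooth[OF f] P]) (use ks i in \<open>auto intro!: M0\<close>)
          then show "norm (iter_partial ks (lap ?P f) x) \<le> ?d ^ 2 * p * M0" by simp
        qed
        also have "\<dots> \<le> M"
          unfolding M_def
        proof (intro mult_right_mono power_increasing i)
          have "1 * 1 \<le> ?d ^ 2 * w" using d1 w(1) by (intro mult_mono) auto
          then show "1 \<le> ?d ^ 2 * w" by simp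
        qed (use p0 M0 in auto)
        finally show "norm ((lap ((1/2) *\<^sub>R W) ^^ i) (lap ?P f) x) \<le> M" .
      qed
      also have "\<dots> \<le> C"
        unfolding C_def using s(2)[OF t] p0 M0 w(1) by (intro mult_left_mono mult_right_mono) (auto simp: M_def)
      finally have "norm (normalized_gint ((1 / \<tau>) *\<^sub>R interp E t) (lap ?P f)) \<le> C" .
      then have "\<tau> * norm (normalized_gint ((1 / \<tau>) *\<^sub>R interp E t) (lap ?P f)) \<le> \<tau> * C"
        using \<tau> by (intro mult_left_mono) auto
      moreover have "norm (- (1/2) * (of_real \<tau> * normalized_gint ((1 / \<tau>) *\<^sub>R interp E t) (lap ?P f)))
        = (1/2) * (\<tau> * norm (normalized_gint ((1 / \<tau>) *\<^sub>R interp E t) (lap ?P f)))"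
        using \<tau> by (simp add: norm_mult)
      moreover have "0 \<le> \<tau> * norm (normalized_gint ((1 / \<tau>) *\<^sub>R interp E t) (lap ?P f))" using \<tau> by simp
      ultimately have "norm (- (1/2) * (of_real \<tau> * normalized_gint ((1 / \<tau>) *\<^sub>R interp E t) (lap ?P f))) \<le> C * \<tau>"
        by (simp only: mult.commute[of C])
      with D show ?thesis by blast
    qed
    then obtain D where D: "\<And>t. t \<in> {0..1} \<Longrightarrow> (?G has_vector_derivative D t) (at t within {0..1})"
      "\<And>t. t \<in> {0..1} \<Longrightarrow> norm (D t) \<le> C * \<tau>" by metis
    have "norm (?G 1 - ?G 0) \<le> C * \<tau> * 1 - C * \<tau> * 0"
    proof (rule differentiable_bound_general)
      show "continuous_on {0..1} ?G"
        unfolding continuous_on_eq_continuous_within by (rule ballI) (rule has_vector_derivative_continuous[OF D(1)])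
      show "(?G has_vector_derivative D t) (at t)" if "0 < t" "t < 1" for t
        using D(1)[of t] that by (simp add: at_within_Icc_at)
      show "((*) (C * \<tau>) has_vector_derivative C * \<tau>) (at t)" for t
        by (auto intro!: derivative_eq_intros simp: has_real_derivative_iff_has_vector_derivative[symmetric])
    qed (use D(2) in \<open>auto intro!: continuous_intros\<close>)
    then show "norm (normalized_gint ((1 / \<tau>) *\<^sub>R E) f - normalized_gint ((1 / \<tau>) *\<^sub>R mat 1) f) \<le> C * \<tau>" by simp
  qed
qed

lemma normalized_gint_tendsto:
  fixes f :: "real^'n::finite \<Rightarrow> complex"
  assumes E: "E \<in> det_sqrt_domain" and f: "test_fun f"
  shows "((\<lambda>t. normalized_gint ((1 / t) *\<^sub>R E) f) \<longlongrightarrow> of_real ((2 * pi) powr (CARD('n) / 2)) * f 0) (at_right 0)"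
proof -
  obtain C where C: "\<And>\<tau>. 0 < \<tau> \<Longrightarrow> \<tau> \<le> 1 \<Longrightarrow>
    norm (normalized_gint ((1 / \<tau>) *\<^sub>R E) f - normalized_gint ((1 / \<tau>) *\<^sub>R mat 1) f) \<le> C * \<tau>"
    using normalized_gint_mat1_diff[OF E f] by blast
  have "((\<lambda>\<tau>. normalized_gint ((1 / \<tau>) *\<^sub>R E) f - normalized_gint ((1 / \<tau>) *\<^sub>R mat 1) f) \<longlongrightarrow> 0) (at_right 0)"
  proof (rule Lim_null_comparison)
    show "\<forall>\<^sub>F \<tau> in at_right 0. norm (normalized_gint ((1 / \<tau>) *\<^sub>R E) f - normalized_gint ((1 / \<tau>) *\<^sub>R mat 1) f) \<le> C * \<tau>"
      unfolding eventually_at_right_field using C by (intro exI[of _ 1]) auto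
    have "((\<lambda>\<tau>. C * \<tau>) \<longlongrightarrow> C * 0) (at_right 0)" by (intro tendsto_intros)
    then show "((\<lambda>\<tau>. C * \<tau>) \<longlongrightarrow> 0) (at_right 0)" by simp
  qed
  from tendsto_add[OF this normalized_gint_mat1_tendsto[OF f]] show ?thesis by simp
qed

text \<open>Taylor's formula for the solution of the heat equation between the times 0 and 1.  The range of \<open>i\<close>
in the assumption consists of the order \<open>L + 1\<close> of the remainder and the \<open>CARD('n) + 1\<close>
further derivatives that \<open>normalized_gint_bound\<close> consumes.\<close>

lemma quadratic_expansion:
  fixes f :: "real^'n::finite \<Rightarrow> complex" and M :: real
  assumes E: "E \<in> det_sqrt_domain" and W: "W ** E = mat 1" "E ** W = mat 1" and f: "test_fun f"
    and M: "\<And>i x. L < i \<Longrightarrow> i \<le> L + CARD('n) + 2 \<Longrightarrow> norm ((lap ((1/2) *\<^sub>R W) ^^ i) f x) \<le> M"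
  shows "norm (det_sqrt E * gint E f - of_real ((2 * pi) powr (CARD('n) / 2)) * (\<Sum>i\<le>L. (lap ((1/2) *\<^sub>R W) ^^ i) f 0 / fact i))
    \<le> 3 ^ Suc CARD('n) * measure lborel (cball (0::real^'n) 1) * norm (det_sqrt E) * M"
proof -
  let ?f = "\<lambda>i. (lap ((1/2) *\<^sub>R W) ^^ i) f" and ?c = "complex_of_real ((2 * pi) powr (CARD('n) / 2))"
  \<comment> \<open>at \<open>t = 0\<close> the value is the limit, which makes \<open>F i\<close> continuous on \<open>[0, 1]\<close>\<close>
  define F where "F i t = (if t = 0 then ?c * ?f i 0 else normalized_gint ((1 / t) *\<^sub>R E) (?f i))" for i t
  have tf: "test_fun (?f i)" for i by (rule test_fun_lap_power[OF f])
  have d: "(F i has_vector_derivative F (Suc i) t) (at t within {0<..1})" if t: "0 < t" "t \<le> 1" for i t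
  proof (rule has_vector_derivative_transform)
    show "((\<lambda>t. normalized_gint ((1 / t) *\<^sub>R E) (?f i)) has_vector_derivative F (Suc i) t) (at t within {0<..1})"
      using normalized_gint_heat[OF E W tf t, of i] t by (simp add: F_def)
  qed (use t in \<open>auto simp: F_def\<close>)
  have "norm (F 0 1 - (\<Sum>i\<le>L. F i 0 / fact i)) 
    \<le> 3 ^ Suc CARD('n) * (norm (det_sqrt E) * measure lborel (cball (0::real^'n) 1) * M)"
  proof (rule real_Taylor)
    fix i t assume t: "0 < t" "t < (1::real)"
    have "(F i has_vector_derivative F (Suc i) t) (at t within {0<..<1})"
      by (rule has_vector_derivative_within_subset[OF d]) (use t in auto)
    then show "(F i has_vector_derivative F (Suc i) t) (at t)"
      using t by (simp add: at_within_open[of t "{0<..<1}"])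
  next
    fix i
    show "continuous_on {0..1} (F i)"
      unfolding continuous_on_eq_continuous_within
    proof
      fix t :: real assume t: "t \<in> {0..1}"
      show "continuous (at t within {0..1}) (F i)"
      proof (cases "t = 0")
        case True
        have "(F i \<longlongrightarrow> ?c * ?f i 0) (at_right 0)"
        proof (rule Lim_transform_eventually[OF normalized_gint_tendsto[OF E tf]])
          show "\<forall>\<^sub>F t in at_right 0. normalized_gint ((1 / t) *\<^sub>R E) (?f i) = F i t"
            unfolding eventually_at_right_field by (intro exI[of _ 1]) (auto simp: F_def)
        qed
        then show ?thesis
          using True by (simp add: continuous_within at_within_Icc_at_right) (simp add: F_def)
      next
        case False
        then have "continuous (at t within {0<..1}) (F i)"
          using t by (intro has_vector_derivative_continuous[OF d]) auto
        moreover have "at t within {0<..1} = at t within {0..1}"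
          by (rule at_within_nhd[of t "{0<..}"]) (use t False in auto)
        ultimately show ?thesis by simp
      qed
    qed
  next
    fix t :: real assume t: "0 < t" "t < 1"
    have "norm (normalized_gint ((1 / t) *\<^sub>R E) (?f (Suc L)))
      \<le> 3 ^ Suc CARD('n) * (norm (det_sqrt E) * measure lborel (cball (0::real^'n) 1) * M)"
    proof (rule normalized_gint_bound[OF E W tf])
      fix i and x :: "real^'n" assume i: "i \<le> Suc CARD('n)"
      have "(lap ((1/2) *\<^sub>R W) ^^ i) (?f (Suc L)) = ?f (i + Suc L)"
        by (simp only: funpow_add o_apply)
      then show "norm ((lap ((1/2) *\<^sub>R W) ^^ i) (?f (Suc L)) x) \<le> M" using M[of "i + Suc L" x] i by simp
    qed (use t in auto)
    then show "norm (F (Suc L) t) \<le> 3 ^ Suc CARD('n) * (norm (det_sqrt E) * measure lborel (cball (0::real^'n) 1) * M)"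
      using t by (simp add: F_def)
  qed
  then show ?thesis
    by (simp add: F_def normalized_gint_def sum_distrib_left mult_ac)
qed


section \<open>Phase and amplitude at a fixed semiclassical parameter\<close>

lemma powr_power_nat: "x > 0 \<Longrightarrow> (x powr y) ^ n = x powr (real n * y)"
  by (simp add: powr_powr mult.commute flip: powr_realpow)

locale critical_phase =
  fixes \<phi> :: "real^'n::finite \<Rightarrow> complex"
  assumes smooth_phase: "smooth \<phi>" and critical: "\<And>k. partial_deriv k \<phi> 0 = 0"
begin

abbreviation "H \<equiv> hessian \<phi> 0"
abbreviation "g \<equiv> phase_remainder \<phi>"

lemma hessian_sym: "transpose H = H"
  unfolding symmetric_iff by (simp add: hessian_def partial_deriv_commute[OF smooth_phase])

lemma remainder_eq: "g = (\<lambda>x. \<phi> x - \<phi> 0 - (1/2) * qform H x)"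
  by (simp add: phase_remainder_def qform_def fun_eq_iff)

lemma remainder_smooth: "smooth g"
  unfolding remainder_eq by (intro smooth_diff smooth_phase smooth_const smooth_cmult smooth_qform)

lemma remainder_gradient: "partial_deriv k g = (\<lambda>x. partial_deriv k \<phi> x - (\<Sum>l\<in>UNIV. H $ k $ l * of_real (x $ l)))"
proof
  fix x
  have 1: "\<phi> differentiable (at x)" "(\<lambda>x. \<phi> x - \<phi> 0) differentiable (at x)" 
     "(\<lambda>x. (1/2) * qform H x) differentiable (at x)" "qform H differentiable (at x)"
    by (intro smooth_differentiable smooth_diff smooth_phase smooth_const smooth_cmult smooth_qform)+
  show "partial_deriv k g x = partial_deriv k \<phi> x - (\<Sum>l\<in>UNIV. H $ k $ l * of_real (x $ l))"
    unfolding remainder_eq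
    by (simp only: partial_deriv_diff[OF 1(2,3)] partial_deriv_cmult[OF 1(4)] partial_deriv_qform[OF hessian_sym])
       (simp add: partial_deriv_diff[OF 1(1) differentiable_const])
qed

lemma remainder_hessian: "partial_deriv j (partial_deriv k g) = (\<lambda>x. partial_deriv j (partial_deriv k \<phi>) x - H $ k $ j)"
proof
  fix x
  have 1: "partial_deriv k \<phi> differentiable (at x)" 
     "(\<lambda>x. \<Sum>l\<in>UNIV. H $ k $ l * of_real (x $ l)) differentiable (at x)" 
     "\<And>l. (\<lambda>x. H $ k $ l * of_real (x $ l)) differentiable (at x)"
    by (intro smooth_differentiable smooth_partial smooth_phase smooth_sum smooth_cmult smooth_coord; simp)+
  have "partial_deriv j (\<lambda>x. \<Sum>l\<in>UNIV. H $ k $ l * of_real (x $ l)) x = (\<Sum>l\<in>UNIV. H $ k $ l * (if l = j then 1 else 0))"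
    by (simp add: partial_deriv_sum[OF finite 1(3)] partial_deriv_cmult)
  also have "\<dots> = H $ k $ j" by (simp add: if_distrib cong: if_cong)
  finally show "partial_deriv j (partial_deriv k g) x = partial_deriv j (partial_deriv k \<phi>) x - H $ k $ j"
    unfolding remainder_gradient by (simp add: partial_deriv_diff[OF 1(1,2)])
qed

lemma remainder_higher:
  assumes "length ks \<ge> 3" shows "iter_partial ks g = iter_partial ks \<phi>"
proof -
  obtain ls m j k where ks: "ks = ls @ [m, j, k]"
  proof -
    define ds where "ds = drop (length ks - 3) ks"
    have "length ds = 3" using assms by (simp add: ds_def)
    then obtain m j k where "ds = [m, j, k]" by (auto simp: numeral_3_eq_3 length_Suc_conv)
    moreover have "ks = take (length ks - 3) ks @ ds" by (simp add: ds_def)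
    ultimately show ?thesis using that by blast
  qed
  have "partial_deriv m (partial_deriv j (partial_deriv k g)) = partial_deriv m (partial_deriv j (partial_deriv k \<phi>))"
  proof
    fix x
    have "partial_deriv j (partial_deriv k \<phi>) differentiable (at x)"
      by (intro smooth_differentiable smooth_partial smooth_phase)
    then show "partial_deriv m (partial_deriv j (partial_deriv k g)) x = partial_deriv m (partial_deriv j (partial_deriv k \<phi>)) x"
      unfolding remainder_hessian by (simp add: partial_deriv_diff)
  qed
  then show ?thesis unfolding ks by (simp add: iter_partial_append)
qed

lemma remainder_zero: "g 0 = 0" and remainder_vanish: "length ks < 3 \<Longrightarrow> iter_partial ks g 0 = 0"
proof -
  show 0: "g 0 = 0" by (simp add: remainder_eq qform_def)
  assume "length ks < 3"
  then consider "ks = []" | k where "ks = [k]" | j k where "ks = [j, k]"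
    by (cases ks; cases "tl ks"; cases "tl (tl ks)") auto
  then show "iter_partial ks g 0 = 0"
  proof cases
    case 3
    then show ?thesis
      using hessian_sym by (simp add: remainder_hessian symmetric_iff) (simp add: hessian_def)
  qed (use 0 critical in \<open>auto simp: remainder_gradient\<close>)
qed

end

text \<open>The situation for one value of \<open>h\<close>, with the bounds on the first \<open>n\<close> derivatives only.  The ball is
open, so that derivatives can be taken at every point of the support of \<open>u\<close>.  The last assumption says that along the field \<open>W x\<close> the remainder grows at most half as fast as the
quadratic part of the phase; it is where the smallness of \<open>\<epsilon>\<close> enters.\<close>

locale stationary_data =
  fixes n :: nat and a b c \<mu> \<nu> \<sigma> \<rho> h R :: real and \<phi> u :: "real^'n::finite \<Rightarrow> complex"
  assumes exponents: "0 \<le> \<mu>" "0 \<le> \<nu>" "0 \<le> \<sigma>" "\<rho> = \<sigma> + \<nu> + \<mu>"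
    and n3: "3 \<le> n" and h: "0 < h" "h \<le> 1"
    and smooth: "smooth \<phi>" "smooth u"
    and critical_point: "\<And>k. partial_deriv k \<phi> 0 = 0"
    and Im_supp: "\<And>x. x \<in> supp u \<Longrightarrow> Im (\<phi> x) \<ge> 0" and Im_0: "Im (\<phi> 0) = 0"
    and phase_bound: "\<And>ks x. 2 \<le> length ks \<Longrightarrow> length ks \<le> n \<Longrightarrow>
      norm (iter_partial ks \<phi> x) \<le> a * h powr (- \<mu> - \<nu> * (real (length ks) - 2))"
    and hessian_invertible: "invertible (hessian \<phi> 0)"
    and hessian_inv_bound: "\<And>k l. norm (matrix_inv (hessian \<phi> 0) $ k $ l) \<le> b * h powr - \<sigma>"
    and amplitude_bound: "\<And>ks x. length ks \<le> n \<Longrightarrow> norm (iter_partial ks u x) \<le> c * h powr (- \<rho> * real (length ks))"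
    and R: "0 < R" "R \<le> h powr \<rho>" and supp_ball: "supp u \<subseteq> ball 0 R"
    and small_remainder: "\<And>x. x \<in> ball 0 R \<Longrightarrow>
      norm (\<Sum>k\<in>UNIV. (\<Sum>l\<in>UNIV. matrix_inv (hessian \<phi> 0) $ l $ k * of_real (x $ l)) * partial_deriv k (phase_remainder \<phi>) x)
        \<le> norm x ^ 2 / 2"
begin

sublocale critical_phase \<phi>
  by unfold_locales (rule smooth critical_point)+

abbreviation "W \<equiv> matrix_inv H"
abbreviation "r \<equiv> h powr \<rho>"
abbreviation "U \<equiv> ball (0::real^'n) R - {0}"

lemma rho_nonneg: "0 \<le> \<rho>" using exponents by simp

lemma r: "0 < r" "r \<le> 1"
  using h rho_nonneg by (auto intro: powr_le1)

lemma R1: "R \<le> 1" using R r by linarith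

lemma W: "W ** H = mat 1" "H ** W = mat 1"
proof -
  have "\<exists>A'. H ** A' = mat 1 \<and> A' ** H = mat 1" using hessian_invertible by (simp add: invertible_def)
  from someI_ex[OF this] show "W ** H = mat 1" "H ** W = mat 1" by (auto simp: matrix_inv_def)
qed

lemma constants_nonneg: "0 \<le> a" "0 \<le> b" "0 \<le> c"
proof -
  define k :: 'n where "k = undefined"
  have "0 \<le> a * h powr (- \<mu> - \<nu> * (real (length [k, k]) - 2))"
    by (rule order_trans[OF norm_ge_zero phase_bound[of "[k, k]" 0]]) (use n3 in auto)
  then show "0 \<le> a" using h by (simp add: zero_le_mult_iff)
  have "0 \<le> b * h powr - \<sigma>" by (rule order_trans[OF norm_ge_zero hessian_inv_bound])
  then show "0 \<le> b" using h by (simp add: zero_le_mult_iff)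
  have "norm (u 0) \<le> c" using amplitude_bound[of "[]" 0] h by simp
  then show "0 \<le> c" by (rule order_trans[OF norm_ge_zero])
qed

abbreviation "G \<equiv> a * h powr (- \<mu> - \<nu>)"

lemma G_nonneg: "0 \<le> G" using constants_nonneg by simp

lemma remainder_low:
  assumes "length ks \<le> 3"
  shows "norm (iter_partial ks g x) \<le> real CARD('n) ^ (3 - length ks) * G * norm x ^ (3 - length ks)"
proof (rule vanish_bound[OF remainder_smooth remainder_vanish _ assms])
  fix ks :: "'n list" and y assume "length ks = 3"
  then show "norm (iter_partial ks g y) \<le> G"
    using phase_bound[of ks y] n3 by (simp add: remainder_higher)
qed

lemma remainder_low':
  assumes "length ks \<le> 3"
  shows "norm (iter_partial ks g x) \<le> real CARD('n) ^ 3 * G * norm x ^ (3 - length ks)"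
proof -
  have "real CARD('n) ^ (3 - length ks) \<le> real CARD('n) ^ 3"
    by (intro power_increasing) (auto simp: Suc_leI)
  then have "real CARD('n) ^ (3 - length ks) * G * norm x ^ (3 - length ks) \<le> real CARD('n) ^ 3 * G * norm x ^ (3 - length ks)"
    using G_nonneg by (intro mult_right_mono) auto
  with remainder_low[OF assms] show ?thesis by (rule order_trans)
qed

text \<open>From the third derivative on, each further one costs \<open>h\<close> to the power \<open>- \<nu>\<close>, and \<open>\<nu> \<le> \<rho>\<close>.\<close>

lemma remainder_high:
  assumes "3 \<le> length ks" "length ks \<le> n"
  shows "norm (iter_partial ks g x) * r ^ (length ks - 3) \<le> real CARD('n) ^ 3 * G"
proof -
  have "norm (iter_partial ks g x) * r ^ (length ks - 3) \<le> a * h powr (- \<mu> - \<nu> * (real (length ks) - 2)) * r ^ (length ks - 3)"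
    using phase_bound[of ks x] assms r by (intro mult_right_mono) (auto simp: remainder_higher)
  also have "\<dots> = a * h powr (- \<mu> - \<nu> * (real (length ks) - 2) + real (length ks - 3) * \<rho>)"
    using h by (simp add: powr_power_nat powr_add)
  also have "\<dots> \<le> a * h powr (- \<mu> - \<nu>)"
  proof (intro mult_left_mono powr_mono')
    have eq: "real (length ks) - 2 = 1 + real (length ks - 3)" using assms by simp
    have "real (length ks - 3) * \<nu> \<le> real (length ks - 3) * \<rho>"
      using exponents by (intro mult_left_mono) auto
    then show "- \<mu> - \<nu> \<le> - \<mu> - \<nu> * (real (length ks) - 2) + real (length ks - 3) * \<rho>"
      unfolding eq by (simp add: distrib_left mult.commute)
  qed (use h constants_nonneg in auto)
  also have "\<dots> \<le> real CARD('n) ^ 3 * G"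
    using mult_right_mono[OF one_le_power[of "real CARD('n)" 3] G_nonneg] by (simp add: Suc_leI)
  finally show ?thesis .
qed

lemma remainder_symb_r: "symb n (ball 0 R) (\<lambda>_. r) (\<lambda>_. real CARD('n) ^ 3 * G * r ^ 3) g"
  unfolding symb_def
proof safe
  fix ks :: "'n list" and x :: "real^'n" assume ks: "length ks \<le> n" and x: "x \<in> ball 0 R"
  show "iter_partial ks g differentiable (at x)" by (intro smooth_differentiable smooth_iter remainder_smooth)
  have xr: "norm x \<le> r" using x R by auto
  show "norm (iter_partial ks g x) * r ^ length ks \<le> real CARD('n) ^ 3 * G * r ^ 3"
  proof (cases "length ks \<le> 3")
    case True
    have "norm (iter_partial ks g x) * r ^ length ks \<le> real CARD('n) ^ 3 * G * norm x ^ (3 - length ks) * r ^ length ks"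
      by (intro mult_right_mono remainder_low' True) simp
    also have "\<dots> \<le> real CARD('n) ^ 3 * G * r ^ (3 - length ks) * r ^ length ks"
      using xr G_nonneg by (intro mult_right_mono mult_left_mono power_mono) auto
    also have "\<dots> = real CARD('n) ^ 3 * G * r ^ 3" using True by (simp add: mult.assoc flip: power_add)
    finally show ?thesis .
  next
    case False
    have "r ^ length ks = r ^ (length ks - 3) * r ^ 3" using False by (simp flip: power_add)
    then show ?thesis using mult_right_mono[OF remainder_high[of ks x], of "r ^ 3"] False ks by (simp add: mult_ac)
  qed
qed

lemma remainder_symb_norm: "symb n U norm (\<lambda>x. real CARD('n) ^ 3 * G * norm x ^ 3) g"
  unfolding symb_def
proof safe
  fix ks :: "'n list" and x :: "real^'n" assume ks: "length ks \<le> n" and x: "x \<in> ball 0 R"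
  show "iter_partial ks g differentiable (at x)" by (intro smooth_differentiable smooth_iter remainder_smooth)
  have xr: "norm x \<le> r" using x R by auto
  show "norm (iter_partial ks g x) * norm x ^ length ks \<le> real CARD('n) ^ 3 * G * norm x ^ 3"
  proof (cases "length ks \<le> 3")
    case True
    have "norm (iter_partial ks g x) * norm x ^ length ks \<le> real CARD('n) ^ 3 * G * norm x ^ (3 - length ks) * norm x ^ length ks"
      by (intro mult_right_mono remainder_low' True) simp
    also have "\<dots> = real CARD('n) ^ 3 * G * norm x ^ 3" using True by (simp add: mult.assoc flip: power_add)
    finally show ?thesis .
  next
    case False
    have "norm (iter_partial ks g x) * norm x ^ length ks = norm (iter_partial ks g x) * norm x ^ (length ks - 3) * norm x ^ 3"
      using False by (simp add: mult.assoc flip: power_add)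
    also have "\<dots> \<le> norm (iter_partial ks g x) * r ^ (length ks - 3) * norm x ^ 3"
      using xr by (intro mult_right_mono mult_left_mono power_mono) auto
    also have "\<dots> \<le> real CARD('n) ^ 3 * G * norm x ^ 3"
      using remainder_high[of ks x] False ks by (intro mult_right_mono) auto
    finally show ?thesis .
  qed
qed

lemma amplitude_r: "length ks \<le> n \<Longrightarrow> norm (iter_partial ks u x) * r ^ length ks \<le> c"
proof -
  assume ks: "length ks \<le> n"
  have "norm (iter_partial ks u x) * r ^ length ks \<le> c * h powr (- \<rho> * real (length ks)) * r ^ length ks"
    using amplitude_bound[OF ks] by (intro mult_right_mono) auto
  also have "\<dots> = c * h powr (- \<rho> * real (length ks) + real (length ks) * \<rho>)"
    by (simp only: powr_power_nat[OF h(1)] powr_add mult.assoc)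
  also have "- \<rho> * real (length ks) + real (length ks) * \<rho> = 0" by simp
  also have "c * h powr 0 = c" using h by simp
  finally show ?thesis .
qed

lemma amplitude_symb_r: "symb n V (\<lambda>_. r) (\<lambda>_. c) u"
  unfolding symb_def using amplitude_r smooth_differentiable[OF smooth_iter[OF smooth(2)]] by auto

lemma amplitude_symb_norm: "symb n U norm (\<lambda>_. c) u"
  unfolding symb_def
proof safe
  fix ks :: "'n list" and x :: "real^'n" assume ks: "length ks \<le> n" and x: "x \<in> ball 0 R"
  show "iter_partial ks u differentiable (at x)" by (intro smooth_differentiable smooth_iter smooth)
  have "norm (iter_partial ks u x) * norm x ^ length ks \<le> norm (iter_partial ks u x) * r ^ length ks"
    using x R by (intro mult_left_mono power_mono) auto
  with amplitude_r[OF ks, of x] show "norm (iter_partial ks u x) * norm x ^ length ks \<le> c" by linarith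
qed

lemma amplitude_outside: "x \<notin> supp u \<Longrightarrow> u x = 0"
  unfolding supp_def using closure_subset[of "{x. u x \<noteq> 0}"] by auto

lemma product_test_fun: "test_fun (\<lambda>x. g x ^ m * u x)"
  unfolding test_fun_def
proof safe
  show "smooth (\<lambda>x. g x ^ m * u x)" by (intro smooth_mult smooth_power remainder_smooth smooth)
  fix x :: "real^'n" assume "norm x > 1"
  then have "x \<notin> supp u" using supp_ball R1 by auto
  then show "g x ^ m * u x = 0" by (simp add: amplitude_outside)
qed

text \<open>The exponent is that of \<open>h\<^sup>-\<^sup>\<mu>\<^sup>-\<^sup>\<nu> h\<^sup>3\<^sup>\<rho>\<close>, the size of \<open>g\<close> at distance \<open>h\<^sup>\<rho>\<close>, because
\<open>\<rho> - \<mu> - \<nu> = \<sigma>\<close>.\<close>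

lemma product_symb_r: "symb n (ball 0 R) (\<lambda>_. r) 
   (\<lambda>_. (2 ^ n * 2 ^ (n * m) * (real CARD('n) ^ 3 * a) ^ m * c) * h powr (real m * (\<sigma> + 2 * \<rho>))) (\<lambda>x. g x ^ m * u x)"
proof (rule symb_mono[OF symb_mult[OF _ _ symb_power[OF _ _ remainder_symb_r] amplitude_symb_r]])
  have "(h powr (- \<mu> - \<nu>) * r ^ 3) ^ m = h powr (real m * (\<sigma> + 2 * \<rho>))"
    using h exponents by (simp add: powr_power_nat powr_add[symmetric] algebra_simps)
  then have "(real CARD('n) ^ 3 * G * r ^ 3) ^ m = (real CARD('n) ^ 3 * a) ^ m * h powr (real m * (\<sigma> + 2 * \<rho>))"
    by (simp add: power_mult_distrib mult_ac)
  then show "2 ^ n * (2 ^ (n * m) * (real CARD('n) ^ 3 * G * r ^ 3) ^ m * c)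
      \<le> (2 ^ n * 2 ^ (n * m) * (real CARD('n) ^ 3 * a) ^ m * c) * h powr (real m * (\<sigma> + 2 * \<rho>))"
    by (simp add: mult_ac)
qed (use r in auto)

lemma product_symb_norm: 
  assumes "symb n' U norm (\<lambda>x. C * norm x ^ q) f" "n' \<le> n"
  shows "symb n' U norm (\<lambda>x. (2 ^ n' * 2 ^ (n' * m) * (real CARD('n) ^ 3 * G) ^ m * C) * norm x ^ (3 * m + q)) (\<lambda>x. g x ^ m * f x)"
proof (rule symb_mono[OF punctured_symb_mult[OF symb_power[OF _ _ symb_less[OF remainder_symb_norm assms(2)]] assms(1)]])
  show "2 ^ n' * (2 ^ (n' * m) * (real CARD('n) ^ 3 * G * norm x ^ 3) ^ m * (C * norm x ^ q))
      \<le> (2 ^ n' * 2 ^ (n' * m) * (real CARD('n) ^ 3 * G) ^ m * C) * norm x ^ (3 * m + q)" for x :: "real^'n"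
  proof -
    have "(real CARD('n) ^ 3 * G * norm x ^ 3) ^ m = (real CARD('n) ^ 3 * G) ^ m * norm x ^ (3 * m)"
      by (simp only: power_mult_distrib[of _ "norm x ^ 3"] power_mult)
    then show ?thesis by (simp only:) (simp add: power_add mult_ac)
  qed
qed auto

text \<open>Symbol bounds on the punctured ball say nothing about the origin itself; for a smooth function
they extend to it by continuity.\<close>

lemma symb_norm_vanish:
  assumes f: "smooth f" and s: "symb n' U norm (\<lambda>x. C * norm x ^ q) f" and ks: "length ks \<le> n'" "length ks < q"
  shows "iter_partial ks f 0 = 0"
proof -
  let ?F = "iter_partial ks f"
  have "isCont ?F 0"
    using smooth_differentiable[OF smooth_iter[OF f]] differentiable_imp_continuous_within by blast
  then have l1: "(?F \<longlongrightarrow> ?F 0) (at 0)" by (simp add: isCont_def)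
  have l2: "(?F \<longlongrightarrow> 0) (at 0)"
  proof (rule Lim_null_comparison)
    show "\<forall>\<^sub>F x in at 0. norm (?F x) \<le> C * norm x ^ (q - length ks)"
      unfolding eventually_at
    proof (intro exI[of _ R] conjI ballI impI R(1))
      fix x :: "real^'n" assume "x \<noteq> 0 \<and> dist x 0 < R"
      then have x: "x \<in> U" "norm x > 0" by auto
      have "norm (?F x) * norm x ^ length ks \<le> C * norm x ^ q" using symbD(2)[OF s ks(1) x(1)] .
      also have "\<dots> = C * norm x ^ (q - length ks) * norm x ^ length ks"
        using ks(2) by (simp add: mult.assoc flip: power_add)
      finally show "norm (?F x) \<le> C * norm x ^ (q - length ks)" using x(2) by simp
    qed
    have "((\<lambda>x::real^'n. C * norm x ^ (q - length ks)) \<longlongrightarrow> C * norm (0::real^'n) ^ (q - length ks)) (at 0)"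
      by (intro tendsto_mult_left tendsto_power tendsto_norm tendsto_ident_at)
    then show "((\<lambda>x::real^'n. C * norm x ^ (q - length ks)) \<longlongrightarrow> 0) (at 0)"
      using ks(2) by (simp add: zero_power)
  qed
  show ?thesis using tendsto_unique[OF _ l1 l2] by simp
qed

end


section \<open>The coefficients of the expansion\<close>

text \<open>Multiplication of a matrix by a complex scalar; the vector space structure of matrices provides real
scalars only.\<close>

definition smat :: "complex \<Rightarrow> complex^'n^'n \<Rightarrow> complex^'n^'n" where
  "smat z P = (\<chi> k l. z * P $ k $ l)"

lemma lap_smat: "lap (smat z P) f = (\<lambda>x. z * lap P f x)"
  by (simp add: lap_def smat_def fun_eq_iff sum_distrib_left mult.assoc)

lemma lap_cmult:
  assumes "smooth f" shows "lap P (\<lambda>x. z * f x) = (\<lambda>x. z * lap P f x)"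
proof -
  have "partial_deriv l (\<lambda>x. z * f x) = (\<lambda>x. z * partial_deriv l f x)" for l
    using iter_partial_cmult[OF assms, of "[l]"] by simp
  moreover have "partial_deriv k (\<lambda>x. z * partial_deriv l f x) = (\<lambda>x. z * partial_deriv k (partial_deriv l f) x)" for k l
    using iter_partial_cmult[OF smooth_partial[OF assms], of "[k]"] by simp
  ultimately show ?thesis
    unfolding lap_def by (simp only: sum_distrib_left mult.left_commute[of _ z])
qed

lemma lap_smat_power:
  assumes "smooth f" shows "(lap (smat z P) ^^ l) f = (\<lambda>x. z ^ l * (lap P ^^ l) f x)"
proof (induction l)
  case (Suc l)
  then show ?case
    by (simp add: lap_smat lap_cmult[OF smooth_lap_power[OF assms]] mult.assoc)
qed simp

lemma quad_D_lap:
  assumes "smooth f" shows "quad_D P f = lap (smat (-1) P) f"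
proof -
  have "D_op k (D_op l f) x = - partial_deriv k (partial_deriv l f) x" for k l x
  proof -
    have "partial_deriv k (\<lambda>x. 1 / \<i> * partial_deriv l f x) x = 1 / \<i> * partial_deriv k (partial_deriv l f) x"
      by (rule partial_deriv_cmult[OF smooth_differentiable[OF smooth_partial[OF assms]]])
    then show ?thesis by (simp add: D_op_def)
  qed
  then show ?thesis by (simp add: quad_D_def lap_def smat_def fun_eq_iff)
qed

lemma quad_D_power:
  assumes "smooth f" shows "(quad_D P ^^ l) f = (\<lambda>x. (-1) ^ l * (lap P ^^ l) f x)"
proof -
  have "(quad_D P ^^ l) f = (lap (smat (-1) P) ^^ l) f"
  proof (induction l)
    case (Suc l)
    then show ?case by (simp add: quad_D_lap[OF smooth_lap_power[OF assms]])
  qed simp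
  then show ?thesis by (simp add: lap_smat_power[OF assms])
qed

definition index_set :: "nat \<Rightarrow> (nat \<times> nat) set" where
  "index_set j = {(l, m). int l - int m = int j \<and> 2 * l \<ge> 3 * m}"

text \<open>For \<open>l = m + j\<close> the condition \<open>2 * l \<ge> 3 * m\<close> becomes \<open>m \<le> 2 * j\<close>.\<close>

lemma index_set_eq: "index_set j = (\<lambda>m. (m + j, m)) ` {..2 * j}"
  unfolding index_set_def by (auto simp: image_iff)

lemma index_set_finite: "finite (index_set j)"
  by (simp add: index_set_eq)

lemma fact_product_ge_1: "1 \<le> (fact l * fact m :: real)"
  using mult_mono[OF fact_ge_1 fact_ge_1, of l m] by simp

text \<open>The bound for \<open>\<langle>W \<partial>, \<partial>\<rangle>\<^sup>l (g\<^sup>m u)\<close> in dimension \<open>d\<close> apart from powers of \<open>h\<close>: the first factor comes from the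
entries of \<open>W\<close>, the second from the symbol bounds for the product.\<close>

definition expansion_const :: "nat \<Rightarrow> nat \<Rightarrow> real \<Rightarrow> real \<Rightarrow> real \<Rightarrow> nat \<Rightarrow> nat \<Rightarrow> real" where
  "expansion_const d n a b c l m = (real d ^ 2 * b) ^ l * (2 ^ n * 2 ^ (n * m) * (real d ^ 3 * a) ^ m * c)"

context stationary_data
begin

abbreviation "coef l m \<equiv> (lap W ^^ l) (\<lambda>x. g x ^ m * u x) 0"

text \<open>Each \<open>m\<close> comes from the Taylor expansion in the remainder of the phase and carries \<open>\<i> / h\<close>; each \<open>l\<close>
  comes from the expansion of a Gaussian integral and carries \<open>\<i> h / 2\<close>.\<close>

definition expansion_term :: "nat \<Rightarrow> nat \<Rightarrow> complex" where
  "expansion_term l m = (\<i> * of_real h / 2) ^ l * (\<i> / of_real h) ^ m / (fact l * fact m) * coef l m"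

lemma coef_const_nonneg: "0 \<le> expansion_const CARD('n) n a b c l m"
  using constants_nonneg by (simp add: expansion_const_def)

lemma closed_supp: "closed (supp u)"
  by (simp add: supp_def)

lemma product_iter_outside:
  assumes "x \<notin> supp u" shows "iter_partial ks (\<lambda>x. g x ^ m * u x) x = 0"
proof -
  have "iter_partial ks (\<lambda>x. g x ^ m * u x) x = iter_partial ks (\<lambda>_. 0) x"
  proof (rule iter_partial_cong_open[OF open_Compl[OF closed_supp]])
    show "g y ^ m * u y = 0" if "y \<in> - supp u" for y
      using that amplitude_outside[of y] by simp
  qed (use assms in simp)
  then show ?thesis by simp
qed

lemma lap_product_bound:
  assumes l: "2 * l \<le> n"
  shows "norm ((lap W ^^ l) (\<lambda>x. g x ^ m * u x) x) \<le> expansion_const CARD('n) n a b c l m * h powr ((real m - real l) * (\<sigma> + 2 * \<rho>))"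
proof -
  let ?C = "2 ^ n * 2 ^ (n * m) * (real CARD('n) ^ 3 * a) ^ m * c"
  have C0: "?C \<ge> 0" using constants_nonneg by simp
  have "norm ((lap W ^^ l) (\<lambda>x. g x ^ m * u x) x) \<le> (real CARD('n) ^ 2 * (b * h powr - \<sigma>)) ^ l * 
    (?C * h powr (real m * (\<sigma> + 2 * \<rho>) - real (2 * l) * \<rho>))"
  proof (rule norm_lap_power[OF test_fun_smooth[OF product_test_fun] hessian_inv_bound])
    fix ks :: "'n list" assume ks: "length ks = 2 * l"
    show "norm (iter_partial ks (\<lambda>x. g x ^ m * u x) x) \<le> ?C * h powr (real m * (\<sigma> + 2 * \<rho>) - real (2 * l) * \<rho>)"
    proof (cases "x \<in> supp u")
      case True
      then have "x \<in> ball 0 R" using supp_ball by auto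
      from symbD(2)[OF product_symb_r _ this, of ks] ks l
      have "norm (iter_partial ks (\<lambda>x. g x ^ m * u x) x) * r ^ (2 * l) \<le> ?C * h powr (real m * (\<sigma> + 2 * \<rho>))" by simp
      then have "norm (iter_partial ks (\<lambda>x. g x ^ m * u x) x) \<le> ?C * h powr (real m * (\<sigma> + 2 * \<rho>)) / r ^ (2 * l)"
        using r by (simp add: pos_le_divide_eq)
      also have "\<dots> = ?C * h powr (real m * (\<sigma> + 2 * \<rho>) - real (2 * l) * \<rho>)"
        by (simp only: powr_power_nat[OF h(1)] powr_diff times_divide_eq_right)
      finally show ?thesis .
    qed (use C0 product_iter_outside in simp)
  qed
  also have "\<dots> = expansion_const CARD('n) n a b c l m * (h powr (real l * - \<sigma>) * h powr (real m * (\<sigma> + 2 * \<rho>) - real (2 * l) * \<rho>))"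
    unfolding expansion_const_def powr_power_nat[OF h(1), symmetric] by (simp add: power_mult_distrib mult_ac)
  also have "h powr (real l * - \<sigma>) * h powr (real m * (\<sigma> + 2 * \<rho>) - real (2 * l) * \<rho>) = h powr ((real m - real l) * (\<sigma> + 2 * \<rho>))"
    unfolding powr_add[symmetric] by (simp add: algebra_simps)
  finally show ?thesis .
qed

text \<open>The product \<open>g\<^sup>m u\<close> vanishes to order \<open>3 * m\<close> at the origin, and the operator has order \<open>2 * l\<close>.\<close>

lemma coef_zero:
  assumes "2 * l < 3 * m" "2 * l \<le> n" shows "coef l m = 0"
proof -
  have "norm (coef l m) \<le> (real CARD('n) ^ 2 * (b * h powr - \<sigma>)) ^ l * 0"
  proof (rule norm_lap_power[OF test_fun_smooth[OF product_test_fun] hessian_inv_bound])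
    fix ks :: "'n list" assume ks: "length ks = 2 * l"
    have "symb n U norm (\<lambda>x. c * norm x ^ 0) u" using amplitude_symb_norm by simp
    from symb_norm_vanish[OF test_fun_smooth[OF product_test_fun] product_symb_norm[OF this order_refl]]
    show "norm (iter_partial ks (\<lambda>x. g x ^ m * u x) 0) \<le> 0" using ks assms by simp
  qed
  then show ?thesis by simp
qed

lemma expansion_term_bound:
  assumes "2 * l \<le> n"
  shows "norm (expansion_term l m) \<le> expansion_const CARD('n) n a b c l m * h powr ((real l - real m) * (1 - \<sigma> - 2 * \<rho>))"
proof -
  have "norm (expansion_term l m) = (h / 2) ^ l * (1 / h) ^ m / (fact l * fact m) * norm (coef l m)"
    using h by (simp add: expansion_term_def norm_mult norm_divide norm_power)
  also have "\<dots> \<le> h powr (real l - real m) * (expansion_const CARD('n) n a b c l m * h powr ((real m - real l) * (\<sigma> + 2 * \<rho>)))"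
  proof (intro mult_mono lap_product_bound[OF assms])
    have "(h / 2) ^ l \<le> h ^ l" using h by (intro power_mono) auto
    then have "(h / 2) ^ l * (1 / h) ^ m / (fact l * fact m) \<le> h ^ l * (1 / h) ^ m / 1"
      using h fact_product_ge_1[of l m] by (intro frac_le mult_right_mono) auto
    also have "\<dots> = h powr (real l - real m)" using h by (simp add: powr_diff powr_realpow power_one_over divide_inverse power_inverse)
    finally show "(h / 2) ^ l * (1 / h) ^ m / (fact l * fact m) \<le> h powr (real l - real m)" .
  qed auto
  also have "\<dots> = expansion_const CARD('n) n a b c l m * (h powr (real l - real m) * h powr ((real m - real l) * (\<sigma> + 2 * \<rho>)))" by simp
  also have "h powr (real l - real m) * h powr ((real m - real l) * (\<sigma> + 2 * \<rho>)) = h powr ((real l - real m) * (1 - \<sigma> - 2 * \<rho>))"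
    unfolding powr_add[symmetric] by (simp add: algebra_simps)
  finally show ?thesis .
qed

lemma L_op_eq: "L_op \<phi> j u 0 = (\<Sum>(l, m)\<in>index_set j. 
   \<i> powi (- int j) * 2 powi (- int l) / (fact l * fact m) * ((-1) ^ l * coef l m))"
  unfolding L_op_def index_set_def[symmetric]
  by (intro sum.cong refl) (auto simp: quad_D_power[OF test_fun_smooth[OF product_test_fun]])

text \<open>Compares the factors: \<open>h ^ j\<close> is \<open>h ^ l / h ^ m\<close>, and the sign \<open>(-1) ^ l\<close> from \<open>D = \<partial> / \<i>\<close> together with
\<open>\<i>\<close> to the power \<open>- j\<close> is \<open>\<i> ^ (l + m)\<close>.\<close>

lemma L_op_expansion: "of_real (h ^ j) * L_op \<phi> j u 0 = (\<Sum>(l, m)\<in>index_set j. expansion_term l m)"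
  unfolding L_op_eq sum_distrib_left
proof (intro sum.cong refl, clarify)
  fix l m assume "(l, m) \<in> index_set j"
  then have l: "l = m + j" by (auto simp: index_set_eq)
  have hc: "complex_of_real h \<noteq> 0" using h by simp
  have "\<i> powi (- int j) * (-1) ^ l = \<i> ^ l * \<i> ^ m"
  proof -
    have "\<i> ^ j * (\<i> ^ l * \<i> ^ m) = (\<i> * \<i>) ^ m * (\<i> * \<i>) ^ j"
      unfolding l power_add power_mult_distrib by (simp only: mult_ac)
    also have "\<dots> = (-1) ^ l" unfolding l power_add by simp
    finally have "(-1) ^ l = \<i> ^ j * (\<i> ^ l * \<i> ^ m)" ..
    then show ?thesis by (simp add: power_int_minus field_simps)
  qed
  moreover have "2 powi (- int l) = (1 / 2 :: complex) ^ l" by (simp add: power_int_minus power_one_over inverse_eq_divide)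
  moreover have "complex_of_real (h ^ j) = of_real h ^ l / of_real h ^ m" using hc unfolding l by (simp add: power_add)
  ultimately have "of_real (h ^ j) * (\<i> powi (- int j) * 2 powi (- int l) / (fact l * fact m) * ((-1) ^ l * coef l m))
     = (of_real h ^ l / of_real h ^ m) * (\<i> ^ l * \<i> ^ m) * (1 / 2) ^ l / (fact l * fact m) * coef l m"
    by (simp only: times_divide_eq_right times_divide_eq_left mult_ac) (simp add: field_simps)
  also have "\<dots> = expansion_term l m"
    using hc by (simp add: expansion_term_def power_divide power_mult_distrib field_simps)
  finally show "of_real (h ^ j) * (\<i> powi (- int j) * 2 powi (- int l) / (fact l * fact m) * ((-1) ^ l * coef l m)) = expansion_term l m" .
qed

text \<open>The indices satisfy \<open>l \<le> 3 * j\<close>, so at most \<open>6 * j\<close> derivatives occur.\<close>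

lemma L_op_bound:
  assumes "6 * j \<le> n"
  shows "norm (L_op \<phi> j u 0) \<le> (\<Sum>(l, m)\<in>index_set j. expansion_const CARD('n) n a b c l m) * h powr (- real j * (\<sigma> + 2 * \<rho>))"
proof -
  have "norm (L_op \<phi> j u 0) \<le> (\<Sum>(l, m)\<in>index_set j. expansion_const CARD('n) n a b c l m * h powr (- real j * (\<sigma> + 2 * \<rho>)))"
    unfolding L_op_eq
  proof (rule sum_norm_le, clarify)
    fix l m assume "(l, m) \<in> index_set j"
    then have l: "l = m + j" "m \<le> 2 * j" by (auto simp: index_set_eq)
    have "norm (\<i> powi (- int j) * 2 powi (- int l) / (fact l * fact m) * ((-1) ^ l * coef l m))
      = (2 powi (- int l) / (fact l * fact m)) * norm (coef l m)"
      by (simp add: norm_mult norm_divide norm_power norm_power_int)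
    also have "\<dots> \<le> 1 * (expansion_const CARD('n) n a b c l m * h powr ((real m - real l) * (\<sigma> + 2 * \<rho>)))"
    proof (intro mult_mono lap_product_bound)
      show "2 powi (- int l) / (fact l * fact m) \<le> (1::real)"
      proof -
        have "1 * 1 \<le> (2::real) ^ l * (fact l * fact m)"
          using fact_product_ge_1[of l m] by (intro mult_mono) auto
        then have "1 / ((2::real) ^ l * (fact l * fact m)) \<le> 1" by simp
        then show ?thesis by (simp add: power_int_minus divide_inverse mult.assoc)
      qed
    qed (use l assms in auto)
    finally show "norm (\<i> powi (- int j) * 2 powi (- int l) / (fact l * fact m) * ((-1) ^ l * coef l m))
       \<le> expansion_const CARD('n) n a b c l m * h powr (- real j * (\<sigma> + 2 * \<rho>))" by (simp add: l(1))
  qed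
  then show ?thesis by (simp add: sum_distrib_right split_beta)
qed

section \<open>The dichotomy at the critical point\<close>

lemma remainder_decomposition: "\<phi> x = \<phi> 0 + (1/2) * qform H x + g x"
  by (simp add: remainder_eq)

text \<open>If the form were negative in the direction \<open>v\<close>, then the imaginary part of the phase would be negative
at \<open>t v\<close> for small positive \<open>t\<close>.  These points lie outside the support of \<open>u\<close>, where all derivatives
of \<open>u\<close> vanish, and so would their limits at 0.\<close>

lemma Im_hessian_nonneg:
  assumes "iter_partial ks u 0 \<noteq> 0"
  shows "Im (qform H v) \<ge> 0"
proof (rule ccontr)
  assume neg: "\<not> Im (qform H v) \<ge> 0"
  let ?K = "real CARD('n) ^ 3 * G * norm v ^ 3"
  \<comment> \<open>up to this distance the cubic remainder is at most half of the quadratic part\<close>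
  define t0 where "t0 = - Im (qform H v) / (4 * (?K + 1))"
  have K: "?K \<ge> 0" using G_nonneg by simp
  have t0: "t0 > 0" using neg K unfolding t0_def by (intro divide_pos_pos) auto
  have zero: "iter_partial ks u (t *\<^sub>R v) = 0" if t: "0 < t" "t < t0" for t
  proof -
    have q: "qform H (t *\<^sub>R v) = of_real (t ^ 2) * qform H v"
      by (simp add: qform_def sum_distrib_left power2_eq_square mult_ac)
    have "norm (g (t *\<^sub>R v)) \<le> real CARD('n) ^ 3 * G * norm (t *\<^sub>R v) ^ 3"
      using remainder_low'[of "[]" "t *\<^sub>R v"] by simp
    also have "\<dots> = t ^ 2 * (t * ?K)" using t by (simp add: power_mult_distrib power3_eq_cube power2_eq_square mult_ac)
    also have "\<dots> \<le> t ^ 2 * (- Im (qform H v) / 4)"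
    proof (intro mult_left_mono)
      have "t * ?K \<le> t0 * (?K + 1)" using t K by (intro mult_mono) auto
      also have "\<dots> = - Im (qform H v) / 4" using K by (simp add: t0_def field_simps)
      finally show "t * ?K \<le> - Im (qform H v) / 4" .
    qed auto
    finally have "\<bar>Im (g (t *\<^sub>R v))\<bar> \<le> t ^ 2 * (- Im (qform H v) / 4)"
      using abs_Im_le_cmod order_trans by blast
    then have "Im (\<phi> (t *\<^sub>R v)) \<le> t ^ 2 * Im (qform H v) / 2 + t ^ 2 * (- Im (qform H v) / 4)"
      using Im_0 by (subst remainder_decomposition) (simp add: q)
    also have "\<dots> = t ^ 2 * (Im (qform H v) / 4)" by (simp add: field_simps)
    also have "\<dots> < 0" using neg t by (intro mult_pos_neg) auto
    finally have neg_t: "Im (\<phi> (t *\<^sub>R v)) < 0" .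
    have "iter_partial ks u (t *\<^sub>R v) = iter_partial ks (\<lambda>_. 0) (t *\<^sub>R v)"
    proof (rule iter_partial_cong_open[OF open_Compl[OF closed_supp]])
      show "t *\<^sub>R v \<in> - supp u" using Im_supp[of "t *\<^sub>R v"] neg_t by auto
      show "u y = 0" if "y \<in> - supp u" for y using that amplitude_outside[of y] by simp
    qed
    then show ?thesis by simp
  qed
  have "isCont (iter_partial ks u) 0"
    using smooth_differentiable[OF smooth_iter[OF smooth(2)]] differentiable_imp_continuous_within by blast
  then have l1: "((\<lambda>t. iter_partial ks u (t *\<^sub>R v)) \<longlongrightarrow> iter_partial ks u (0 *\<^sub>R v)) (at_right 0)"
    by (intro isCont_tendsto_compose[of _ "iter_partial ks u"] tendsto_intros) auto
  have l2: "((\<lambda>t. iter_partial ks u (t *\<^sub>R v)) \<longlongrightarrow> 0) (at_right 0)"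
  proof (rule Lim_transform_eventually[OF tendsto_const])
    show "\<forall>\<^sub>F t in at_right 0. 0 = iter_partial ks u (t *\<^sub>R v)"
      unfolding eventually_at_right_field using t0 zero by (intro exI[of _ t0]) auto
  qed
  have "iter_partial ks u 0 = 0" using tendsto_unique[OF trivial_limit_at_right_real l1 l2] by simp
  with assms show False by blast
qed

abbreviation "E0 \<equiv> (\<chi> k l. 1 / \<i> * H $ k $ l) :: complex^'n^'n"

lemma E0_inverse: "smat \<i> W ** E0 = mat 1" "E0 ** smat \<i> W = mat 1"
proof -
  have i: "- (\<i> * z * (\<i> * w)) = z * w" for z w
    using arg_cong[of "\<i> * z * (\<i> * w)" "(\<i> * \<i>) * (z * w)" uminus] by (simp only: mult_ac) simp
  have "smat \<i> W ** E0 = W ** H" "E0 ** smat \<i> W = H ** W"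
    unfolding smat_def matrix_matrix_mult_def vec_eq_iff by (simp_all add: i)
  then show "smat \<i> W ** E0 = mat 1" "E0 ** smat \<i> W = mat 1" using W by auto
qed

lemma det_E0_nonzero: "det E0 \<noteq> 0"
  using E0_inverse by (auto simp: invertible_det_nz[symmetric] invertible_def)

lemma det_sqrt_E0_nonzero: "det_sqrt E0 \<noteq> 0"
  using det_E0_nonzero det_sqrt_square[of E0] by (metis power_zero_numeral)

lemma qform_E0: "qform E0 x = - \<i> * qform H x"
  by (simp add: qform_def sum_distrib_left mult_ac sum_negf)

lemma E0_domain:
  assumes "iter_partial ks u 0 \<noteq> 0" shows "E0 \<in> det_sqrt_domain"
  unfolding det_sqrt_domain_iff
proof (intro conjI allI)
  show "transpose E0 = E0" using hessian_sym by (simp add: symmetric_iff)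
  show "0 \<le> Re (qform E0 x)" for x using Im_hessian_nonneg[OF assms, of x] unfolding qform_E0 by simp
  show "det E0 \<noteq> 0" by (rule det_E0_nonzero)
qed

text \<open>Leibniz' formula for the determinant with entries of size \<open>h\<close> to the power \<open>- \<mu>\<close>.\<close>

lemma det_sqrt_E0_bound: "norm (det_sqrt E0) \<le> (fact CARD('n) * a ^ CARD('n) + 1) * h powr (- \<mu> * real CARD('n) / 2)"
proof -
  let ?D = "fact CARD('n) * a ^ CARD('n) :: real"
  have D: "?D \<ge> 0" using constants_nonneg by simp
  have Hb: "norm (E0 $ k $ l) \<le> a * h powr - \<mu>" for k l
    using phase_bound[of "[k, l]" 0] n3 by (simp add: hessian_def norm_mult norm_divide)
  have "norm (det E0) \<le> (\<Sum>p | p permutes (UNIV::'n set). (a * h powr - \<mu>) ^ CARD('n))"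
    unfolding det_def
  proof (rule sum_norm_le)
    fix p :: "'n \<Rightarrow> 'n"
    have "norm (of_int (sign p) * (\<Prod>i\<in>UNIV. E0 $ i $ p i)) = (\<Prod>i\<in>UNIV. norm (E0 $ i $ p i))"
      unfolding norm_mult prod_norm by (simp add: sign_def)
    also have "\<dots> \<le> (\<Prod>i\<in>(UNIV::'n set). a * h powr - \<mu>)" by (intro prod_mono) (use Hb in auto)
    finally show "norm (of_int (sign p) * (\<Prod>i\<in>UNIV. E0 $ i $ p i)) \<le> (a * h powr - \<mu>) ^ CARD('n)" by simp
  qed
  also have "\<dots> = ?D * h powr (- \<mu> * real CARD('n))"
    by (simp add: card_permutations[OF refl] power_mult_distrib powr_power_nat[OF h(1)] mult_ac)
  finally have "norm (det_sqrt E0) ^ 2 \<le> ?D * h powr (- \<mu> * real CARD('n))"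
    by (simp only: norm_power[symmetric] det_sqrt_square)
  \<comment> \<open>\<open>?D + 1\<close> is a simple upper bound for the square root of \<open>?D\<close>\<close>
  also have "\<dots> \<le> (?D + 1) ^ 2 * h powr (- \<mu> * real CARD('n))"
    using D by (intro mult_right_mono) (auto simp: power2_eq_square algebra_simps)
  also have "\<dots> = ((?D + 1) * h powr (- \<mu> * real CARD('n) / 2)) ^ 2"
    by (simp add: power_mult_distrib powr_power_nat[OF h(1)])
  finally show ?thesis by (rule power2_le_imp_le) (use D in auto)
qed

end


section \<open>Taylor expansion in the phase remainder\<close>

text \<open>The constant of \<open>nonstationary_phase\<close> with the vector field of \<open>perturbed_vector_field\<close>; the parameter
\<open>v\<close> is the volume of the unit ball in dimension \<open>d\<close>.\<close>

definition nonstationary_const :: "nat \<Rightarrow> real \<Rightarrow> real \<Rightarrow> real \<Rightarrow> nat \<Rightarrow> real" where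
  "nonstationary_const d v a b p =
     v * (real d * 2 ^ Suc p) ^ p * (perturbed_field_const d (Suc p) (b * real d ^ 3 * a) * b) ^ p"

context stationary_data
begin

lemma nonstationary_const_nonneg: "0 \<le> nonstationary_const CARD('n) (measure lborel (cball (0::real^'n) 1)) a b p"
  using constants_nonneg perturbed_field_const_pos[of "b * real CARD('n) ^ 3 * a" "CARD('n)" "Suc p"]
  by (simp add: nonstationary_const_def)

text \<open>All phases with gradient \<open>H x + s \<nabla>g\<close>, where \<open>s\<close> is at most 1 in modulus, are treated at once, with a
constant that does not depend on \<open>s\<close> or \<open>h\<close>.\<close>

lemma nonstationary_estimate:
  assumes p: "Suc (Suc p) \<le> n" and \<psi>: "smooth \<psi>" and s: "norm s \<le> 1"
    and d\<psi>: "\<And>k x. partial_deriv k \<psi> x = (\<Sum>l\<in>UNIV. H $ k $ l * of_real (x $ l)) + s * partial_deriv k g x"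
    and Im: "\<And>x. x \<in> supp u \<Longrightarrow> 0 \<le> Im (\<psi> x)" and f: "\<And>x. x \<notin> supp u \<Longrightarrow> f x = 0" "f 0 = 0"
    and fs: "symb (Suc p) U norm (\<lambda>x. C * norm x ^ m) f" and m: "2 * p + 1 \<le> m"
  shows "norm (LINT x|lborel. exp (\<i> / of_real h * \<psi> x) * f x)
    \<le> nonstationary_const CARD('n) (measure lborel (cball (0::real^'n) 1)) a b p * h powr (real p * (1 - \<sigma>)) * C"
proof -
  let ?d = "real CARD('n)" and ?\<beta> = "b * h powr - \<sigma>"
  define Kv where "Kv = perturbed_field_const CARD('n) (Suc p) (b * ?d ^ 3 * a)"
  have "?\<beta> * (?d ^ 3 * G) * R \<le> ?\<beta> * (?d ^ 3 * G) * r"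
    using R constants_nonneg by (intro mult_left_mono) auto
  also have "\<dots> = (b * ?d ^ 3 * a) * (h powr - \<sigma> * h powr (- \<mu> - \<nu>) * h powr \<rho>)" by (simp add: mult_ac)
  also have "h powr - \<sigma> * h powr (- \<mu> - \<nu>) * h powr \<rho> = 1"
    unfolding powr_add[symmetric] using h exponents by simp
  finally have M: "?\<beta> * (?d ^ 3 * G) * R \<le> b * ?d ^ 3 * a" by simp
  have M0: "0 \<le> b * ?d ^ 3 * a" using constants_nonneg by simp
  obtain X where X: "\<And>k. symb (Suc p) U norm (\<lambda>x. Kv * ?\<beta> / norm x) (X k)"
    "\<And>x. x \<in> U \<Longrightarrow> (\<Sum>k\<in>UNIV. X k x * ((\<Sum>l\<in>UNIV. H $ k $ l * of_real (x $ l)) + s * partial_deriv k g x)) = 1"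
    unfolding Kv_def
    by (rule perturbed_vector_field[OF R(1) M0 W(1) hessian_inv_bound symb_less[OF remainder_symb_norm p] M s])
       (rule small_remainder, assumption, blast)
  have "norm (LINT x|lborel. exp (\<i> / of_real h * \<psi> x) * f x)
    \<le> (measure lborel (cball (0::real^'n) 1)) * (?d * 2 ^ Suc p) ^ p * (h * (Kv * ?\<beta>)) ^ p * C"
    by (rule nonstationary_phase[where X = X, OF R(1) R1 closed_supp supp_ball h(1) \<psi> _ _ _ f(2) X(1) fs m])
       (use X(2) d\<psi> Im f(1) in auto)
  also have "(h * (Kv * ?\<beta>)) ^ p = (Kv * b) ^ p * (h powr (1 - \<sigma>)) ^ p"
    using h by (simp add: powr_diff powr_minus_divide power_mult_distrib[symmetric] mult_ac divide_inverse)
  also have "(h powr (1 - \<sigma>)) ^ p = h powr (real p * (1 - \<sigma>))" by (rule powr_power_nat[OF h(1)])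
  finally show ?thesis by (simp add: nonstationary_const_def Kv_def mult_ac)
qed

text \<open>A function that vanishes to infinite order at the origin trades derivatives for powers of
\<open>norm x\<close>.\<close>

lemma flat_symb:
  assumes flat: "\<And>ks. iter_partial ks u 0 = 0" and m: "m \<le> n"
  shows "symb m U norm (\<lambda>x. (real CARD('n) ^ m * c * h powr (- \<rho> * real m)) * norm x ^ m) u"
  unfolding symb_def
proof safe
  fix ks :: "'n list" and x :: "real^'n" assume ks: "length ks \<le> m" and x: "x \<in> ball 0 R"
  show "iter_partial ks u differentiable (at x)" by (intro smooth_differentiable smooth_iter smooth)
  let ?M = "c * h powr (- \<rho> * real m)"
  have "norm (iter_partial ks u x) \<le> real CARD('n) ^ (m - length ks) * ?M * norm x ^ (m - length ks)"
    by (rule vanish_bound[OF smooth(2) flat _ ks]) (use amplitude_bound m in auto)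
  then have "norm (iter_partial ks u x) * norm x ^ length ks \<le> real CARD('n) ^ (m - length ks) * ?M * norm x ^ (m - length ks) * norm x ^ length ks"
    by (intro mult_right_mono) auto
  also have "\<dots> = real CARD('n) ^ (m - length ks) * (?M * norm x ^ m)"
    using ks by (simp add: mult.assoc flip: power_add)
  also have "\<dots> \<le> real CARD('n) ^ m * (?M * norm x ^ m)"
    using constants_nonneg by (intro mult_right_mono power_increasing) (auto simp: Suc_leI)
  finally show "norm (iter_partial ks u x) * norm x ^ length ks \<le> (real CARD('n) ^ m * c * h powr (- \<rho> * real m)) * norm x ^ m"
    by (simp add: mult_ac)
qed

lemma flat_coef_zero:
  assumes flat: "\<And>ks. iter_partial ks u 0 = 0" and l: "2 * l < n"
  shows "coef l m = 0"
proof -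
  have "norm (coef l m) \<le> (real CARD('n) ^ 2 * (b * h powr - \<sigma>)) ^ l * 0"
  proof (rule norm_lap_power[OF test_fun_smooth[OF product_test_fun] hessian_inv_bound])
    fix ks :: "'n list" assume ks: "length ks = 2 * l"
    have "Suc (2 * l) \<le> n" using l by simp
    from symb_norm_vanish[OF test_fun_smooth[OF product_test_fun] product_symb_norm[OF flat_symb[OF flat this] this]]
    show "norm (iter_partial ks (\<lambda>x. g x ^ m * u x) 0) \<le> 0" using ks by simp
  qed
  then show ?thesis by simp
qed

lemma phase_gradient: "partial_deriv k \<phi> x = (\<Sum>l\<in>UNIV. H $ k $ l * of_real (x $ l)) + 1 * partial_deriv k g x"
  by (simp add: remainder_gradient)

text \<open>The original phase is the case \<open>s = 1\<close>.  Integrating by parts \<open>p\<close> times needs an amplitude of size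
\<open>norm x\<close> to the power \<open>2 * p + 1\<close>, which costs as many factors \<open>h\<^sup>-\<^sup>\<rho>\<close>.\<close>

lemma flat_estimate:
  assumes flat: "\<And>ks. iter_partial ks u 0 = 0" and p: "2 * p + 2 \<le> n"
  shows "norm (osc_integral h \<phi> u)
    \<le> nonstationary_const CARD('n) (measure lborel (cball (0::real^'n) 1)) a b p * (real CARD('n) ^ (2 * p + 1) * c) * h powr (real p * (1 - \<sigma> - 2 * \<rho>) - \<rho>)"
proof -
  let ?m = "2 * p + 1" and ?K = "nonstationary_const CARD('n) (measure lborel (cball (0::real^'n) 1)) a b p"
  have "symb ?m U norm (\<lambda>x. (real CARD('n) ^ ?m * c * h powr (- \<rho> * real ?m)) * norm x ^ ?m) u"
    using flat p by (intro flat_symb) auto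
  then have s: "symb (Suc p) U norm (\<lambda>x. (real CARD('n) ^ ?m * c * h powr (- \<rho> * real ?m)) * norm x ^ ?m) u"
    by (rule symb_less) simp
  have "u 0 = 0" using flat iter_partial_Nil by metis
  then have "norm (LINT x|lborel. exp (\<i> / of_real h * \<phi> x) * u x)
      \<le> ?K * h powr (real p * (1 - \<sigma>)) * (real CARD('n) ^ ?m * c * h powr (- \<rho> * real ?m))"
    by (intro nonstationary_estimate[OF _ smooth(1) _ phase_gradient Im_supp amplitude_outside _ s])
       (use p in auto)
  also have "\<dots> = ?K * (real CARD('n) ^ ?m * c) * (h powr (real p * (1 - \<sigma>)) * h powr (- \<rho> * real ?m))" by (simp add: mult_ac)
  also have "h powr (real p * (1 - \<sigma>)) * h powr (- \<rho> * real ?m) = h powr (real p * (1 - \<sigma> - 2 * \<rho>) - \<rho>)"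
    unfolding powr_add[symmetric] by (simp add: algebra_simps)
  finally show ?thesis by (simp add: osc_integral_def)
qed

text \<open>The \<open>i\<close>-th derivative in \<open>s\<close> of the integral with the phase \<open>\<phi>(0) + \<langle>H x, x\<rangle> / 2 + s g\<close>.\<close>

definition osc_family :: "nat \<Rightarrow> real \<Rightarrow> complex" where
  "osc_family i s = (LINT x|lborel. exp (\<i> / of_real h * (\<phi> 0 + (1/2) * qform H x + of_real s * g x))
     * ((\<i> / of_real h * g x) ^ i * u x))"

lemma osc_family_1: "osc_family 0 1 = osc_integral h \<phi> u"
proof -
  have "\<phi> 0 + (1/2) * qform H x + of_real 1 * g x = \<phi> x" for x
    using remainder_decomposition[of x] by simp
  then show ?thesis unfolding osc_family_def osc_integral_def by simp
qed

abbreviation "E \<equiv> (1 / h) *\<^sub>R E0"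

lemma osc_family_0: "osc_family m 0 = exp (\<i> / of_real h * \<phi> 0) * (\<i> / of_real h) ^ m * gint E (\<lambda>x. g x ^ m * u x)"
proof -
  have q: "\<i> / of_real h * (\<phi> 0 + (1/2) * qform H x + of_real 0 * g x) = \<i> / of_real h * \<phi> 0 + - (1/2) * qform E x" for x
    unfolding qform_scaleR qform_E0 using h by (simp add: scaleR_conv_of_real field_simps)
  have "osc_family m 0 = (LINT x|lborel. exp (\<i> / of_real h * \<phi> 0) * (\<i> / of_real h) ^ m * (exp (- (1/2) * qform E x) * (g x ^ m * u x)))"
    unfolding osc_family_def q exp_add power_mult_distrib
    by (intro Bochner_Integration.integral_cong refl) (simp only: mult_ac)
  also have "\<dots> = exp (\<i> / of_real h * \<phi> 0) * (\<i> / of_real h) ^ m * gint E (\<lambda>x. g x ^ m * u x)"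
    unfolding gint_def by (rule integral_mult_right_zero)
  finally show ?thesis .
qed

lemma osc_family_derivative:
  assumes s: "s \<in> {0..1}"
  shows "(osc_family i has_vector_derivative osc_family (Suc i) s) (at s within {0..1})"
  unfolding osc_family_def[abs_def]
proof (rule leibniz_bounded_support[OF convex_real_interval(5) s, where R = 1])
  let ?ph = "\<lambda>s x. \<i> / of_real h * (\<phi> 0 + (1/2) * qform H x + of_real s * g x)"
  have cont: "continuous_on UNIV (\<lambda>x. (\<i> / of_real h * g x) ^ i * u x)" for i
    by (intro continuous_intros smooth_continuous remainder_smooth smooth)
  have qc: "continuous_on UNIV (qform H)" by (rule smooth_continuous[OF smooth_qform])
  have gc: "continuous_on UNIV g" by (rule smooth_continuous[OF remainder_smooth])
  fix t :: real and x :: "real^'n"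
  have "((\<lambda>t. ?ph t x) has_vector_derivative \<i> / of_real h * g x) (at t within {0..1})"
  proof -
    have "((\<lambda>t. of_real t * g x) has_vector_derivative g x) (at t within {0..1})"
      by (auto intro!: derivative_eq_intros)
    then have "((\<lambda>t. \<phi> 0 + (1/2) * qform H x + of_real t * g x) has_vector_derivative g x) (at t within {0..1})"
      by (auto intro!: derivative_eq_intros)
    then show ?thesis by (rule has_vector_derivative_mult_right)
  qed
  then have "((\<lambda>t. exp (?ph t x)) has_vector_derivative (\<i> / of_real h * g x) * exp (?ph t x)) (at t within {0..1})"
    by (rule field_vector_diff_chain_within[unfolded o_def, OF _ has_field_derivative_at_within[OF DERIV_exp]])
  from has_vector_derivative_mult_left[OF this, of "(\<i> / of_real h * g x) ^ i * u x"]
  show "((\<lambda>t. exp (?ph t x) * ((\<i> / of_real h * g x) ^ i * u x)) has_vector_derivative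
      exp (?ph t x) * ((\<i> / of_real h * g x) ^ Suc i * u x)) (at t within {0..1})"
    by (simp add: mult_ac)
  show "continuous_on UNIV (\<lambda>x. exp (?ph t x) * ((\<i> / of_real h * g x) ^ i * u x))"
    by (intro continuous_on_mult[OF _ cont] continuous_intros qc gc)
  have c2: "continuous_on ({0..1} \<times> UNIV) (\<lambda>p. F (snd p))" if "continuous_on UNIV F" for F :: "real^'n \<Rightarrow> complex"
    by (rule continuous_on_compose2[OF that]) (auto intro!: continuous_intros)
  show "continuous_on ({0..1} \<times> UNIV) (\<lambda>(t, x). exp (?ph t x) * ((\<i> / of_real h * g x) ^ Suc i * u x))"
    unfolding split_beta by (intro continuous_on_mult[OF _ c2[OF cont]] continuous_intros c2[OF qc] c2[OF gc])
qed (use product_test_fun[of 0] in \<open>auto simp: test_fun_def\<close>)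

lemma osc_family_Taylor:
  assumes "\<And>s. 0 < s \<Longrightarrow> s < 1 \<Longrightarrow> norm (osc_family (Suc M) s) \<le> B"
  shows "norm (osc_integral h \<phi> u - (\<Sum>m\<le>M. osc_family m 0 / fact m)) \<le> B"
  unfolding osc_family_1[symmetric]
proof (rule real_Taylor[where F = osc_family])
  show "continuous_on {0..1} (osc_family i)" for i
    unfolding continuous_on_eq_continuous_within
    by (rule ballI) (rule has_vector_derivative_continuous[OF osc_family_derivative])
  fix i and t :: real assume t: "0 < t" "t < 1"
  then show "(osc_family i has_vector_derivative osc_family (Suc i) t) (at t)"
    using osc_family_derivative[of t i] by (simp add: at_within_Icc_at)
qed (rule assms)

text \<open>Here \<open>quadratic_expansion\<close> is applied to \<open>E = E0 / h\<close> and \<open>f = g\<^sup>m u\<close>.\<close>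

lemma quadratic_term:
  assumes E0: "E0 \<in> det_sqrt_domain" and n: "2 * (L + CARD('n) + 2) \<le> n" and \<gamma>: "0 \<le> 1 - \<sigma> - 2 * \<rho>"
  shows "norm (det_sqrt E * gint E (\<lambda>x. g x ^ m * u x)
     - of_real ((2 * pi) powr (CARD('n) / 2)) * (\<Sum>l\<le>L. (\<i> * of_real h / 2) ^ l * coef l m / fact l))
    \<le> 3 ^ Suc CARD('n) * measure lborel (cball (0::real^'n) 1) * norm (det_sqrt E)
      * ((\<Sum>i\<le>n. expansion_const CARD('n) n a b c i m) * h powr (real (Suc L) * (1 - \<sigma> - 2 * \<rho>)))"
proof -
  let ?V = "h *\<^sub>R smat \<i> W"
  have V: "(1/2) *\<^sub>R ?V = smat (\<i> * of_real h / 2) W"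
    by (simp add: smat_def vec_eq_iff scaleR_conv_of_real[where 'a = complex])
  have sm: "smooth (\<lambda>x. g x ^ m * u x)" by (rule test_fun_smooth[OF product_test_fun])
  have pw: "(lap ((1/2) *\<^sub>R ?V) ^^ i) (\<lambda>x. g x ^ m * u x) x = (\<i> * of_real h / 2) ^ i * (lap W ^^ i) (\<lambda>x. g x ^ m * u x) x" for i x
    unfolding V by (simp only: lap_smat_power[OF sm])
  have "norm (det_sqrt E * gint E (\<lambda>x. g x ^ m * u x)
     - of_real ((2 * pi) powr (CARD('n) / 2)) * (\<Sum>l\<le>L. (lap ((1/2) *\<^sub>R ?V) ^^ l) (\<lambda>x. g x ^ m * u x) 0 / fact l))
    \<le> 3 ^ Suc CARD('n) * measure lborel (cball (0::real^'n) 1) * norm (det_sqrt E)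
      * ((\<Sum>i\<le>n. expansion_const CARD('n) n a b c i m) * h powr (real (Suc L) * (1 - \<sigma> - 2 * \<rho>)))"
  proof (rule quadratic_expansion[OF scaleR_domain[OF E0] _ _ product_test_fun])
    show "1 / h > 0" using h by simp
    show "?V ** E = mat 1" "E ** ?V = mat 1"
      unfolding matrix_scaleR_mult E0_inverse using h by simp_all
    fix i and x :: "real^'n" assume i: "L < i" "i \<le> L + CARD('n) + 2"
    have "norm ((lap ((1/2) *\<^sub>R ?V) ^^ i) (\<lambda>x. g x ^ m * u x) x) = (h / 2) ^ i * norm ((lap W ^^ i) (\<lambda>x. g x ^ m * u x) x)"
      unfolding pw using h by (simp add: norm_mult norm_divide norm_power)
    also have "\<dots> \<le> h ^ i * (expansion_const CARD('n) n a b c i m * h powr ((real m - real i) * (\<sigma> + 2 * \<rho>)))"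
      using h i n by (intro mult_mono power_mono lap_product_bound) auto
    also have "\<dots> = expansion_const CARD('n) n a b c i m * (h powr real i * h powr ((real m - real i) * (\<sigma> + 2 * \<rho>)))"
      using h by (simp add: powr_realpow)
    also have "h powr real i * h powr ((real m - real i) * (\<sigma> + 2 * \<rho>)) = h powr (real i * (1 - \<sigma> - 2 * \<rho>) + real m * (\<sigma> + 2 * \<rho>))"
      unfolding powr_add[symmetric] by (simp add: algebra_simps)
    also have "expansion_const CARD('n) n a b c i m * h powr (real i * (1 - \<sigma> - 2 * \<rho>) + real m * (\<sigma> + 2 * \<rho>))
        \<le> (\<Sum>i\<le>n. expansion_const CARD('n) n a b c i m) * h powr (real (Suc L) * (1 - \<sigma> - 2 * \<rho>))"
    proof (intro mult_mono powr_mono' sum_nonneg)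
      show "expansion_const CARD('n) n a b c i m \<le> (\<Sum>i\<le>n. expansion_const CARD('n) n a b c i m)"
        by (rule member_le_sum) (use i n coef_const_nonneg in auto)
      have "real (Suc L) * (1 - \<sigma> - 2 * \<rho>) \<le> real i * (1 - \<sigma> - 2 * \<rho>)"
        using i \<gamma> by (intro mult_right_mono) auto
      moreover have "0 \<le> real m * (\<sigma> + 2 * \<rho>)" using exponents rho_nonneg by simp
      ultimately show "real (Suc L) * (1 - \<sigma> - 2 * \<rho>) \<le> real i * (1 - \<sigma> - 2 * \<rho>) + real m * (\<sigma> + 2 * \<rho>)" by linarith
    qed (use h coef_const_nonneg in auto)
    finally show "norm ((lap ((1/2) *\<^sub>R ?V) ^^ i) (\<lambda>x. g x ^ m * u x) x)
      \<le> (\<Sum>i\<le>n. expansion_const CARD('n) n a b c i m) * h powr (real (Suc L) * (1 - \<sigma> - 2 * \<rho>))" .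
  qed
  then show ?thesis by (simp only: pw)
qed

end


context stationary_data
begin

text \<open>The error after \<open>2 * k\<close> Taylor coefficients has the amplitude \<open>(\<i> g / h) ^ (2 * k) * u\<close>, which is of size
\<open>h\<close> to the power \<open>2k (- 1 - \<mu> - \<nu>)\<close> times \<open>norm x ^ (6 * k)\<close>.  It permits \<open>3 * k - 1\<close> integrations by
parts with a gain of \<open>h\<close> to the power \<open>1 - \<sigma>\<close> each, and
\<open>3 (1 - \<sigma>) - 2 (1 + \<mu> + \<nu>) = 1 - \<sigma> - 2\<rho>\<close>.\<close>

lemma Taylor_remainder_estimate:
  assumes k: "1 \<le> k" "3 * k + 1 \<le> n" and Hnn: "\<And>x. 0 \<le> Im (qform H x)"
  shows "norm (osc_integral h \<phi> u - (\<Sum>m<2 * k. osc_family m 0 / fact m))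
    \<le> nonstationary_const CARD('n) (measure lborel (cball (0::real^'n) 1)) a b (3 * k - 1)
        * (2 ^ (3 * k) * 2 ^ (3 * k * (2 * k)) * (real CARD('n) ^ 3 * a) ^ (2 * k) * c)
        * h powr (real k * (1 - \<sigma> - 2 * \<rho>) - 1)"
proof -
  define p where "p = 3 * k - 1"
  have p: "Suc p = 3 * k" "2 * p + 1 \<le> 3 * (2 * k)" using k by (auto simp: p_def)
  let ?C = "2 ^ (3 * k) * 2 ^ (3 * k * (2 * k)) * (real CARD('n) ^ 3 * a) ^ (2 * k) * c"
  let ?K = "nonstationary_const CARD('n) (measure lborel (cball (0::real^'n) 1)) a b p"
  obtain M where M: "2 * k = Suc M" using k by (cases "2 * k") auto
  have C0: "?C \<ge> 0" using constants_nonneg by simp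
  have "norm (osc_integral h \<phi> u - (\<Sum>m\<le>M. osc_family m 0 / fact m)) \<le> ?K * ?C * h powr (real k * (1 - \<sigma> - 2 * \<rho>) - 1)"
  proof (rule osc_family_Taylor)
    fix s :: real assume s: "0 < s" "s < 1"
    let ?\<psi> = "\<lambda>x. \<phi> 0 + (1/2) * qform H x + of_real s * g x"
    let ?f = "\<lambda>x. (\<i> / of_real h * g x) ^ Suc M * u x"
    let ?c = "norm ((\<i> / of_real h) ^ (2 * k)) * (2 ^ (3 * k) * 2 ^ (3 * k * (2 * k)) * (real CARD('n) ^ 3 * G) ^ (2 * k) * c)"
    have s1: "smooth (\<lambda>x. \<phi> 0 + (1/2) * qform H x)" "smooth (\<lambda>x. of_real s * g x)" "smooth (\<lambda>x. (1/2) * qform H x)"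
      by (intro smooth_add smooth_const smooth_cmult smooth_qform remainder_smooth)+
    have \<psi>: "smooth ?\<psi>" by (rule smooth_add[OF s1(1,2)])
    have d\<psi>: "partial_deriv k ?\<psi> x = (\<Sum>l\<in>UNIV. H $ k $ l * of_real (x $ l)) + of_real s * partial_deriv k g x" for k x
      by (simp only: partial_deriv_add[OF s1(1,2)[THEN smooth_differentiable]] 
          partial_deriv_add[OF differentiable_const s1(3)[THEN smooth_differentiable]] 
          partial_deriv_cmult[OF smooth_differentiable[OF remainder_smooth]]
          partial_deriv_cmult[OF smooth_differentiable[OF smooth_qform]] partial_deriv_qform[OF hessian_sym] partial_deriv_const)
         simp
    have Im: "0 \<le> Im (?\<psi> x)" if "x \<in> supp u" for x
    proof -
      have "0 \<le> Im (\<phi> 0 + (1/2) * qform H x + g x)" using Im_supp[OF that] remainder_decomposition[of x] by simp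
      \<comment> \<open>the phase with parameter \<open>s\<close> is a convex combination of the original phase and its quadratic part\<close>
      then have "0 \<le> s * (Im (qform H x) / 2 + Im (g x))" using s Im_0 by simp
      moreover have "0 \<le> (1 - s) * (Im (qform H x) / 2)" using Hnn s by simp
      ultimately have "0 \<le> s * (Im (qform H x) / 2 + Im (g x)) + (1 - s) * (Im (qform H x) / 2)" by linarith
      also have "\<dots> = Im (?\<psi> x)" using Im_0 by (simp add: field_simps)
      finally show ?thesis .
    qed
    have f: "?f = (\<lambda>x. (\<i> / of_real h) ^ (2 * k) * (g x ^ (2 * k) * u x))"
      unfolding M by (simp only: power_mult_distrib mult.assoc)
    have "symb (3 * k) U norm (\<lambda>x. c * norm x ^ 0) u"
      using symb_less[OF amplitude_symb_norm] k by simp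
    from punctured_symb_cmult[where a = "(\<i> / of_real h) ^ (2 * k)", OF product_symb_norm[OF this, where m = "2 * k"]]
    have fs: "symb (Suc p) U norm (\<lambda>x. ?c * norm x ^ (3 * (2 * k))) ?f"
      using k unfolding f p by (simp add: mult.assoc)
    have "norm (osc_family (Suc M) s) \<le> ?K * h powr (real p * (1 - \<sigma>)) * ?c"
      unfolding osc_family_def
    proof (rule nonstationary_estimate[OF _ \<psi> _ d\<psi> Im _ _ fs p(2)])
      show "Suc (Suc p) \<le> n" using k p by simp
      show "norm (complex_of_real s) \<le> 1" using s by simp
      show "?f 0 = 0" using remainder_zero by simp
      show "?f x = 0" if "x \<notin> supp u" for x using amplitude_outside[OF that] by simp
    qed
    also have "?c = ?C * ((1 / h) ^ (2 * k) * (h powr (- \<mu> - \<nu>)) ^ (2 * k))"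
      using h by (simp add: norm_power norm_divide power_mult_distrib mult_ac)
    also have "(1 / h) ^ (2 * k) * (h powr (- \<mu> - \<nu>)) ^ (2 * k) = h powr (real (2 * k) * (- 1 - \<mu> - \<nu>))"
    proof -
      have "(1 / h) ^ (2 * k) * (h powr (- \<mu> - \<nu>)) ^ (2 * k) = (h powr (- 1) * h powr (- \<mu> - \<nu>)) ^ (2 * k)"
        unfolding power_mult_distrib using h by (simp add: powr_minus_divide)
      then show ?thesis unfolding powr_add[symmetric] powr_power_nat[OF h(1)] by (simp add: algebra_simps)
    qed
    also have "?K * h powr (real p * (1 - \<sigma>)) * (?C * h powr (real (2 * k) * (- 1 - \<mu> - \<nu>)))
       = ?K * ?C * (h powr (real p * (1 - \<sigma>)) * h powr (real (2 * k) * (- 1 - \<mu> - \<nu>)))" by (simp only: mult_ac)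
    also have "h powr (real p * (1 - \<sigma>)) * h powr (real (2 * k) * (- 1 - \<mu> - \<nu>)) = h powr (real k * (1 - \<sigma> - 2 * \<rho>) - (1 - \<sigma>))"
    proof -
      have rp: "real p = 3 * real k - 1" using k by (simp add: p_def of_nat_diff)
      show ?thesis unfolding powr_add[symmetric] exponents(4) rp by (simp add: algebra_simps)
    qed
    also have "?K * ?C * h powr (real k * (1 - \<sigma> - 2 * \<rho>) - (1 - \<sigma>)) \<le> ?K * ?C * h powr (real k * (1 - \<sigma> - 2 * \<rho>) - 1)"
      using exponents h by (intro mult_left_mono[OF _ mult_nonneg_nonneg[OF nonstationary_const_nonneg C0]] powr_mono') auto
    finally show "norm (osc_family (Suc M) s) \<le> ?K * ?C * h powr (real k * (1 - \<sigma> - 2 * \<rho>) - 1)" .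
  qed
  then show "norm (osc_integral h \<phi> u - (\<Sum>m<2 * k. osc_family m 0 / fact m)) \<le> ?K * ?C * h powr (real k * (1 - \<sigma> - 2 * \<rho>) - 1)"
    unfolding M lessThan_Suc_atMost p_def .
qed

text \<open>Multiply and divide by the root of the determinant, whose modulus is at most of the order
\<open>h\<close> to the power \<open>- \<mu> d / 2\<close>.\<close>

lemma absorb_determinant:
  fixes K e e' :: real
  assumes X: "norm X \<le> K * h powr e" and K: "K \<ge> 0" and e: "e' + \<mu> * real CARD('n) / 2 \<le> e"
  shows "norm X \<le> (K * (fact CARD('n) * a ^ CARD('n) + 1)) * norm (1 / det_sqrt E0) * h powr e'"
proof -
  let ?D = "fact CARD('n) * a ^ CARD('n) + 1 :: real"
  have D: "?D \<ge> 0" using constants_nonneg by (simp add: add_nonneg_nonneg)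
  have "norm X = norm (1 / det_sqrt E0) * (norm (det_sqrt E0) * norm X)"
    using det_sqrt_E0_nonzero by (simp add: norm_divide)
  also have "\<dots> \<le> norm (1 / det_sqrt E0) * ((?D * h powr (- \<mu> * real CARD('n) / 2)) * (K * h powr e))"
    using D by (intro mult_left_mono mult_mono det_sqrt_E0_bound X) auto
  also have "\<dots> = (K * ?D) * norm (1 / det_sqrt E0) * h powr (- \<mu> * real CARD('n) / 2 + e)"
    by (simp only: powr_add mult_ac)
  also have "\<dots> \<le> (K * ?D) * norm (1 / det_sqrt E0) * h powr e'"
    using D K h e by (intro mult_left_mono powr_mono' mult_nonneg_nonneg) auto
  finally show ?thesis .
qed

lemma L_op_sum:
  "(\<Sum>j<N. of_real (h ^ j) * L_op \<phi> j u 0) = (\<Sum>(l, m)\<in>(\<Union>j<N. index_set j). expansion_term l m)"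
  unfolding L_op_expansion
proof (rule sum.UNION_disjoint[symmetric])
  show "\<forall>i\<in>{..<N}. \<forall>j\<in>{..<N}. i \<noteq> j \<longrightarrow> index_set i \<inter> index_set j = {}"
    by (auto simp: index_set_eq)
qed (auto simp: index_set_finite)

text \<open>The terms of the series up to order \<open>N\<close> all lie in the box \<open>l \<le> L\<close>, \<open>m < M\<close>.  A further term of the
box has either \<open>2 * l < 3 * m\<close>, and is zero, or \<open>l - m \<ge> N\<close>, and is as small as the claimed
error.\<close>

lemma box_sum:
  assumes N: "3 * N \<le> L" "2 * N \<le> M" and n: "2 * L \<le> n" and \<gamma>: "0 \<le> 1 - \<sigma> - 2 * \<rho>"
  shows "norm ((\<Sum>m<M. \<Sum>l\<le>L. expansion_term l m) - (\<Sum>j<N. of_real (h ^ j) * L_op \<phi> j u 0))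
    \<le> (\<Sum>m<M. \<Sum>l\<le>L. expansion_const CARD('n) n a b c l m) * h powr (real N * (1 - \<sigma> - 2 * \<rho>))"
proof -
  let ?A = "\<Union>j<N. index_set j" and ?B = "{..L} \<times> {..<M}"
  have A: "?A \<subseteq> ?B" using N by (auto simp: index_set_eq)
  have box: "(\<Sum>m<M. \<Sum>l\<le>L. t l m) = (\<Sum>(l, m)\<in>?B. t l m)" for t :: "nat \<Rightarrow> nat \<Rightarrow> 'z::comm_monoid_add"
    by (subst sum.swap) (rule sum.cartesian_product)
  have "(\<Sum>m<M. \<Sum>l\<le>L. expansion_term l m) - (\<Sum>j<N. of_real (h ^ j) * L_op \<phi> j u 0) = (\<Sum>(l, m)\<in>?B - ?A. expansion_term l m)"
    unfolding L_op_sum box by (rule sum_diff[OF _ A, symmetric]) auto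
  also have "norm \<dots> \<le> (\<Sum>(l, m)\<in>?B - ?A. expansion_const CARD('n) n a b c l m * h powr (real N * (1 - \<sigma> - 2 * \<rho>)))"
  proof (rule sum_norm_le, clarify)
    fix l m assume lm: "l \<le> L" "m < M" "(l, m) \<notin> ?A"
    have l2: "2 * l \<le> n" using lm n by simp
    show "norm (expansion_term l m) \<le> expansion_const CARD('n) n a b c l m * h powr (real N * (1 - \<sigma> - 2 * \<rho>))"
    proof (cases "2 * l < 3 * m")
      case True
      then show ?thesis
        using coef_zero[OF True l2] coef_const_nonneg[of l m] by (simp add: expansion_term_def)
    next
      case False
      then have "(l, m) \<in> index_set (l - m)" by (auto simp: index_set_def)
      then have "N \<le> l - m" using lm(3) by (metis UN_I lessThan_iff not_less)
      then have "real N \<le> real l - real m" using False by linarith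
      then have "real N * (1 - \<sigma> - 2 * \<rho>) \<le> (real l - real m) * (1 - \<sigma> - 2 * \<rho>)"
        using \<gamma> by (intro mult_right_mono) auto
      then have "h powr ((real l - real m) * (1 - \<sigma> - 2 * \<rho>)) \<le> h powr (real N * (1 - \<sigma> - 2 * \<rho>))"
        using h by (intro powr_mono') auto
      then show ?thesis
        using expansion_term_bound[OF l2] coef_const_nonneg mult_left_mono order_trans by meson
    qed
  qed
  also have "\<dots> \<le> (\<Sum>(l, m)\<in>?B. expansion_const CARD('n) n a b c l m * h powr (real N * (1 - \<sigma> - 2 * \<rho>)))"
    using coef_const_nonneg by (intro sum_mono2) auto
  also have "\<dots> = (\<Sum>m<M. \<Sum>l\<le>L. expansion_const CARD('n) n a b c l m) * h powr (real N * (1 - \<sigma> - 2 * \<rho>))"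
    unfolding box by (simp add: sum_distrib_right split_beta)
  finally show ?thesis .
qed

text \<open>The three summands of the bound are the error of the Taylor expansion in the remainder of the phase,
the errors of the expansions of the Gaussian integrals, and the terms of the box beyond the
series.  In the second one the factors \<open>(\<i> / h) ^ m\<close> account for the loss of \<open>h\<close> to the power \<open>- M\<close>.\<close>

lemma nondegenerate_estimate:
  fixes B :: real
  assumes E0: "E0 \<in> det_sqrt_domain" and N: "3 * N \<le> L" "2 * N \<le> M" and n: "2 * (L + CARD('n) + 2) \<le> n"
    and \<gamma>: "0 \<le> 1 - \<sigma> - 2 * \<rho>" and B: "norm (osc_integral h \<phi> u - (\<Sum>m<M. osc_family m 0 / fact m)) \<le> B"
  shows "norm (osc_integral h \<phi> u - of_real ((2 * pi * h) powr (real CARD('n) / 2))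
       * (exp (\<i> / of_real h * \<phi> 0) / det_sqrt E0) * (\<Sum>j<N. of_real (h ^ j) * L_op \<phi> j u 0))
    \<le> B + (3 ^ Suc CARD('n) * measure lborel (cball (0::real^'n) 1) * (\<Sum>m<M. \<Sum>i\<le>n. expansion_const CARD('n) n a b c i m))
           * h powr (real (Suc L) * (1 - \<sigma> - 2 * \<rho>) - real M)
       + ((2 * pi) powr (CARD('n) / 2) * (\<Sum>m<M. \<Sum>l\<le>L. expansion_const CARD('n) n a b c l m))
           * norm (1 / det_sqrt E0) * h powr ((1 - \<sigma> - 2 * \<rho>) * real N + real CARD('n) / 2)"
proof -
  let ?\<gamma> = "1 - \<sigma> - 2 * \<rho>"
  define e where "e = exp (\<i> / of_real h * \<phi> 0)"
  define s where "s = det_sqrt E"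
  define q where "q = complex_of_real ((2 * pi) powr (CARD('n) / 2))"
  define S where "S m = (\<Sum>l\<le>L. (\<i> * of_real h / 2) ^ l * coef l m / fact l)" for m
  define err where "err m = s * gint E (\<lambda>x. g x ^ m * u x) - q * S m" for m
  have e1: "norm e = 1" using h Im_0 by (simp add: e_def norm_exp_eq_Re)
  have s_eq: "s = of_real ((1 / h) powr (CARD('n) / 2)) * det_sqrt E0"
    unfolding s_def using h by (intro det_sqrt_scaleR E0) simp
  have s0: "s \<noteq> 0" using s_eq det_sqrt_E0_nonzero h by simp
  \<comment> \<open>the prefactor of the theorem belongs to the matrix \<open>E = E0 / h\<close> in \<open>osc_family_0\<close>\<close>
  have P: "of_real ((2 * pi * h) powr (real CARD('n) / 2)) * (e / det_sqrt E0) = q * e / s"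
    using h by (simp add: s_eq q_def powr_mult powr_divide field_simps)
  have term_eq: "osc_family m 0 / fact m = q * e / s * (\<Sum>l\<le>L. expansion_term l m) + e / s * ((\<i> / of_real h) ^ m / fact m * err m)" for m
  proof -
    have gi: "gint E (\<lambda>x. g x ^ m * u x) = (q * S m + err m) / s" using s0 by (simp add: err_def)
    have "osc_family m 0 / fact m = q * e / s * ((\<i> / of_real h) ^ m / fact m * S m) + e / s * ((\<i> / of_real h) ^ m / fact m * err m)"
      unfolding osc_family_0 e_def[symmetric] gi using s0 by (simp add: field_simps) (simp add: add_divide_distrib)
    also have "(\<i> / of_real h) ^ m / fact m * S m = (\<Sum>l\<le>L. expansion_term l m)"
      unfolding S_def sum_distrib_left expansion_term_def by (intro sum.cong refl) (simp add: field_simps)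
    finally show ?thesis .
  qed
  let ?L = "\<Sum>j<N. of_real (h ^ j) * L_op \<phi> j u 0" and ?Box = "\<Sum>m<M. \<Sum>l\<le>L. expansion_term l m"
  have split: "osc_integral h \<phi> u - q * e / s * ?L
     = (osc_integral h \<phi> u - (\<Sum>m<M. osc_family m 0 / fact m)) + e / s * (\<Sum>m<M. (\<i> / of_real h) ^ m / fact m * err m)
       + q * e / s * (?Box - ?L)"
    unfolding term_eq sum.distrib sum_distrib_left[symmetric] by (simp add: right_diff_distrib)
  have E2: "norm (e / s * (\<Sum>m<M. (\<i> / of_real h) ^ m / fact m * err m))
    \<le> (3 ^ Suc CARD('n) * measure lborel (cball (0::real^'n) 1) * (\<Sum>m<M. \<Sum>i\<le>n. expansion_const CARD('n) n a b c i m))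
           * h powr (real (Suc L) * ?\<gamma> - real M)"
  proof -
    let ?k = "3 ^ Suc CARD('n) * measure lborel (cball (0::real^'n) 1)"
    have "norm (\<Sum>m<M. (\<i> / of_real h) ^ m / fact m * err m) \<le> (\<Sum>m<M. h powr - real M * (?k * norm s * ((\<Sum>i\<le>n. expansion_const CARD('n) n a b c i m) * h powr (real (Suc L) * ?\<gamma>))))"
    proof (rule sum_norm_le)
      fix m assume m: "m \<in> {..<M}"
      have "norm ((\<i> / of_real h) ^ m / fact m :: complex) = (1 / h) ^ m / fact m"
        using h by (simp add: norm_divide norm_power)
      also have "\<dots> \<le> (1 / h) ^ M / 1"
        using h m by (intro frac_le power_increasing) auto
      also have "\<dots> = h powr - real M" using h by (simp add: powr_minus powr_realpow power_one_over inverse_eq_divide)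
      finally have "norm ((\<i> / of_real h) ^ m / fact m :: complex) \<le> h powr - real M" .
      moreover have "norm (err m) \<le> ?k * norm s * ((\<Sum>i\<le>n. expansion_const CARD('n) n a b c i m) * h powr (real (Suc L) * ?\<gamma>))"
        using quadratic_term[OF E0 n \<gamma>, of m] unfolding err_def S_def q_def s_def .
      ultimately show "norm ((\<i> / of_real h) ^ m / fact m * err m)
         \<le> h powr - real M * (?k * norm s * ((\<Sum>i\<le>n. expansion_const CARD('n) n a b c i m) * h powr (real (Suc L) * ?\<gamma>)))"
        unfolding norm_mult by (intro mult_mono) auto
    qed
    also have "\<dots> = norm s * ((?k * (\<Sum>m<M. \<Sum>i\<le>n. expansion_const CARD('n) n a b c i m)) * (h powr - real M * h powr (real (Suc L) * ?\<gamma>)))"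
      by (simp only: sum_distrib_left sum_distrib_right mult_ac)
    also have "h powr - real M * h powr (real (Suc L) * ?\<gamma>) = h powr (real (Suc L) * ?\<gamma> - real M)"
      unfolding powr_add[symmetric] by (rule arg_cong[where f = "\<lambda>x. h powr x"]) simp
    finally have "norm (\<Sum>m<M. (\<i> / of_real h) ^ m / fact m * err m) \<le> norm s * ((?k * (\<Sum>m<M. \<Sum>i\<le>n. expansion_const CARD('n) n a b c i m)) * h powr (real (Suc L) * ?\<gamma> - real M))" .
    then show ?thesis using s0 e1 by (simp add: norm_mult norm_divide divide_le_eq mult.commute)
  qed
  have E3: "norm (q * e / s * (?Box - ?L)) \<le> ((2 * pi) powr (CARD('n) / 2) * (\<Sum>m<M. \<Sum>l\<le>L. expansion_const CARD('n) n a b c l m))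
           * norm (1 / det_sqrt E0) * h powr (?\<gamma> * real N + real CARD('n) / 2)"
  proof -
    have n2: "2 * L \<le> n" using n by simp
    have "norm (q * e / s) = (2 * pi) powr (CARD('n) / 2) * (norm (1 / det_sqrt E0) * h powr (real CARD('n) / 2))"
      using h e1 by (simp add: norm_mult norm_divide q_def s_eq powr_divide)
    then have "norm (q * e / s * (?Box - ?L)) \<le> ((2 * pi) powr (CARD('n) / 2) * (norm (1 / det_sqrt E0) * h powr (real CARD('n) / 2)))
        * ((\<Sum>m<M. \<Sum>l\<le>L. expansion_const CARD('n) n a b c l m) * h powr (real N * ?\<gamma>))"
      unfolding norm_mult[of "q * e / s"] using box_sum[OF N n2 \<gamma>] by (simp only: mult_left_mono mult_nonneg_nonneg powr_ge_zero norm_ge_zero)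
    also have "\<dots> = ((2 * pi) powr (CARD('n) / 2) * (\<Sum>m<M. \<Sum>l\<le>L. expansion_const CARD('n) n a b c l m))
           * norm (1 / det_sqrt E0) * (h powr (real N * ?\<gamma>) * h powr (real CARD('n) / 2))" by (simp only: mult_ac)
    also have "h powr (real N * ?\<gamma>) * h powr (real CARD('n) / 2) = h powr (?\<gamma> * real N + real CARD('n) / 2)"
      by (simp only: powr_add mult.commute)
    finally show ?thesis .
  qed
  have "norm (osc_integral h \<phi> u - q * e / s * ?L) 
    \<le> norm (osc_integral h \<phi> u - (\<Sum>m<M. osc_family m 0 / fact m)) + norm (e / s * (\<Sum>m<M. (\<i> / of_real h) ^ m / fact m * err m))
       + norm (q * e / s * (?Box - ?L))"
    unfolding split by (intro norm_triangle_le add_right_mono norm_triangle_ineq)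
  with B E2 E3 show ?thesis unfolding e_def[symmetric] P by linarith
qed

end


section \<open>Estimates uniform in the semiclassical parameter\<close>

abbreviation phase_matrix :: "(real^'n::finite \<Rightarrow> complex) \<Rightarrow> complex^'n^'n" where
  "phase_matrix \<phi> \<equiv> (\<chi> k l. 1 / \<i> * hessian \<phi> 0 $ k $ l)"

abbreviation expansion_error :: "nat \<Rightarrow> real \<Rightarrow> (real^'n::finite \<Rightarrow> complex) \<Rightarrow> (real^'n \<Rightarrow> complex) \<Rightarrow> complex" where
  "expansion_error N h \<phi> u \<equiv> osc_integral h \<phi> u
     - of_real ((2 * pi * h) powr (real CARD('n) / 2)) * (exp (\<i> / of_real h * \<phi> 0) / det_sqrt (phase_matrix \<phi>))
       * (\<Sum>j<N. of_real (h ^ j) * L_op \<phi> j u 0)"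

text \<open>Let \<open>T\<close> be the power of \<open>h\<close> in the claim.  The errors without determinant have to be of order
\<open>T + \<mu> d / 2\<close>, to make up for \<open>absorb_determinant\<close>.  First \<open>k\<close> is chosen with
\<open>k \<gamma> - 1\<close> above this number, which settles the error of the Taylor expansion and the degenerate case; then
\<open>L\<close> such that \<open>(L + 1) \<gamma> - 2 k\<close> is above it as well, which settles the Gaussian integrals; finally \<open>n\<close> is
the number of derivatives that have been used.\<close>

lemma expansion_estimate:
  fixes \<mu> \<nu> \<sigma> \<rho> :: real
  assumes \<rho>: "\<rho> \<le> 1" and \<gamma>: "0 < 1 - \<sigma> - 2 * \<rho>"
  obtains n K where "3 \<le> n" and "\<And>a b c h R (\<phi> :: real^'n::finite \<Rightarrow> complex) u.
     stationary_data n a b c \<mu> \<nu> \<sigma> \<rho> h R \<phi> u \<Longrightarrow>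
     norm (expansion_error N h \<phi> u) \<le> K a b c * norm (1 / det_sqrt (phase_matrix \<phi>)) * h powr ((1 - \<sigma> - 2 * \<rho>) * real N + real CARD('n) / 2)"
proof -
  let ?\<gamma> = "1 - \<sigma> - 2 * \<rho>"
  define T where "T = ?\<gamma> * real N + real CARD('n) / 2"
  obtain k0 :: nat where k0: "(T + \<mu> * real CARD('n) / 2 + 1) / ?\<gamma> \<le> real k0" using real_arch_simple by blast
  define k where "k = k0 + N + 1"
  have k: "1 \<le> k" "2 * N \<le> 2 * k" by (auto simp: k_def)
  have "(T + \<mu> * real CARD('n) / 2 + 1) \<le> real k0 * ?\<gamma>" using k0 \<gamma> by (simp add: pos_divide_le_eq)
  also have "\<dots> \<le> real k * ?\<gamma>" using \<gamma> by (intro mult_right_mono) (auto simp: k_def)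
  finally have kT: "T + \<mu> * real CARD('n) / 2 \<le> real k * ?\<gamma> - 1" by simp
  obtain L0 :: nat where L0: "(T + \<mu> * real CARD('n) / 2 + real (2 * k)) / ?\<gamma> \<le> real L0" using real_arch_simple by blast
  \<comment> \<open>the summand \<open>3 * N\<close> makes the box contain all terms of the series\<close>
  define L where "L = L0 + 3 * N"
  have L: "3 * N \<le> L" by (simp add: L_def)
  have "(T + \<mu> * real CARD('n) / 2 + real (2 * k)) \<le> real L0 * ?\<gamma>" using L0 \<gamma> by (simp add: pos_divide_le_eq)
  also have "\<dots> \<le> real (Suc L) * ?\<gamma>" using \<gamma> by (intro mult_right_mono) (auto simp: L_def)
  finally have LT: "T + \<mu> * real CARD('n) / 2 \<le> real (Suc L) * ?\<gamma> - real (2 * k)" by simp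
  define n where "n = 2 * (L + CARD('n) + 2) + 3 * k + 2"
  have n: "2 * (L + CARD('n) + 2) \<le> n" "3 * k + 1 \<le> n" "2 * k + 2 \<le> n" "3 \<le> n" by (auto simp: n_def)
  let ?v = "measure lborel (cball (0::real^'n) 1)"
  define K1 where "K1 a b c = nonstationary_const CARD('n) ?v a b (3 * k - 1)
     * (2 ^ (3 * k) * 2 ^ (3 * k * (2 * k)) * (real CARD('n) ^ 3 * a) ^ (2 * k) * c)" for a b c
  define K2 where "K2 a b c = nonstationary_const CARD('n) ?v a b k * (real CARD('n) ^ (2 * k + 1) * c)" for a b c
  define K3 where "K3 a b c = 3 ^ Suc CARD('n) * ?v * (\<Sum>m<2 * k. \<Sum>i\<le>n. expansion_const CARD('n) n a b c i m)" for a b c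
  define K4 where "K4 a b c = (2 * pi) powr (CARD('n) / 2) * (\<Sum>m<2 * k. \<Sum>l\<le>L. expansion_const CARD('n) n a b c l m)" for a b c
  define D where "D a = fact CARD('n) * a ^ CARD('n) + (1::real)" for a
  define K where "K a b c = \<bar>K2 a b c\<bar> * D a + (\<bar>K1 a b c\<bar> * D a + \<bar>K3 a b c\<bar> * D a + K4 a b c)" for a b c
  show ?thesis
  proof (rule that[of n K, OF n(4)], unfold T_def[symmetric])
    fix a b c h R and \<phi> u :: "real^'n \<Rightarrow> complex"
    assume data: "stationary_data n a b c \<mu> \<nu> \<sigma> \<rho> h R \<phi> u"
    interpret stationary_data n a b c \<mu> \<nu> \<sigma> \<rho> h R \<phi> u by (rule data)
    let ?s = "norm (1 / det_sqrt (phase_matrix \<phi>)) * h powr T"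
    have D: "D a \<ge> 0" using constants_nonneg by (simp add: D_def add_nonneg_nonneg)
    have K4: "K4 a b c \<ge> 0" using coef_const_nonneg by (auto simp: K4_def intro!: mult_nonneg_nonneg sum_nonneg)
    have ab: "norm X \<le> \<bar>K'\<bar> * D a * ?s" if "norm X \<le> K' * h powr e" "T + \<mu> * real CARD('n) / 2 \<le> e" for X :: complex and K' e
    proof -
      have "norm X \<le> \<bar>K'\<bar> * h powr e" by (rule order_trans[OF that(1)]) (auto intro: mult_right_mono)
      from absorb_determinant[OF this _ that(2), folded D_def] show ?thesis by (simp add: mult.assoc)
    qed
    show "norm (expansion_error N h \<phi> u) \<le> K a b c * norm (1 / det_sqrt (phase_matrix \<phi>)) * h powr T"
    proof (cases "\<forall>ks. iter_partial ks u 0 = 0")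
      case True
      have "expansion_term l m = 0" if "(l, m) \<in> (\<Union>j<N. index_set j)" for l m
      proof -
        have "2 * l < n" using that L n by (auto simp: index_set_eq)
        then have "coef l m = 0" using True by (intro flat_coef_zero) auto
        then show ?thesis by (simp add: expansion_term_def)
      qed
      then have "(\<Sum>j<N. of_real (h ^ j) * L_op \<phi> j u 0) = 0"
        unfolding L_op_sum by (intro sum.neutral) auto
      then have eq: "expansion_error N h \<phi> u = osc_integral h \<phi> u" by simp
      have "norm (expansion_error N h \<phi> u) \<le> \<bar>K2 a b c\<bar> * D a * ?s"
      proof (rule ab)
        show "norm (expansion_error N h \<phi> u) \<le> K2 a b c * h powr (real k * ?\<gamma> - \<rho>)"
          unfolding eq K2_def by (rule flat_estimate) (use n(3) True in auto)
        show "T + \<mu> * real CARD('n) / 2 \<le> real k * ?\<gamma> - \<rho>" using kT \<rho> by linarith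
      qed
      also have "\<dots> \<le> K a b c * ?s" using D K4 by (intro mult_right_mono) (auto simp: K_def)
      finally show ?thesis by (simp add: mult.assoc)
    next
      case False
      then obtain ks where ks: "iter_partial ks u 0 \<noteq> 0" by blast
      have B: "norm (osc_integral h \<phi> u - (\<Sum>m<2 * k. osc_family m 0 / fact m)) \<le> K1 a b c * h powr (real k * ?\<gamma> - 1)"
        unfolding K1_def by (rule Taylor_remainder_estimate[OF k(1) n(2) Im_hessian_nonneg[OF ks]])
      have "norm (expansion_error N h \<phi> u) \<le> norm (osc_integral h \<phi> u - (\<Sum>m<2 * k. osc_family m 0 / fact m))
         + K3 a b c * h powr (real (Suc L) * ?\<gamma> - real (2 * k)) + K4 a b c * norm (1 / det_sqrt (phase_matrix \<phi>)) * h powr T"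
        unfolding K3_def K4_def T_def
        by (rule nondegenerate_estimate[OF E0_domain[OF ks] L k(2) n(1) _ order_refl]) (use \<gamma> in simp)
      also have "\<dots> \<le> \<bar>K1 a b c\<bar> * D a * ?s + \<bar>K3 a b c\<bar> * D a * ?s + K4 a b c * ?s"
      proof (intro add_mono)
        show "norm (osc_integral h \<phi> u - (\<Sum>m<2 * k. osc_family m 0 / fact m)) \<le> \<bar>K1 a b c\<bar> * D a * ?s"
          by (rule ab[OF B kT])
        have "norm (complex_of_real (K3 a b c * h powr (real (Suc L) * ?\<gamma> - real (2 * k)))) \<le> \<bar>\<bar>K3 a b c\<bar>\<bar> * D a * ?s"
          by (rule ab[OF _ LT]) (simp add: norm_mult)
        then show "K3 a b c * h powr (real (Suc L) * ?\<gamma> - real (2 * k)) \<le> \<bar>K3 a b c\<bar> * D a * ?s"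
          unfolding norm_of_real by linarith
      qed (simp add: mult.assoc)
      also have "\<dots> = (\<bar>K1 a b c\<bar> * D a + \<bar>K3 a b c\<bar> * D a + K4 a b c) * ?s" by (simp only: distrib_right)
      also have "\<dots> \<le> K a b c * ?s" using D by (intro mult_right_mono) (auto simp: K_def)
      finally show ?thesis by (simp add: mult.assoc)
    qed
  qed
qed

lemma norm_entry_le_onorm:
  fixes A :: "complex^'n::finite^'n"
  shows "norm (A $ k $ l) \<le> onorm (\<lambda>v. A *v v)"
proof -
  have "A $ k $ l = (A *v axis l 1) $ k"
    by (simp add: matrix_vector_mult_def axis_def if_distrib cong: if_cong)
  also have "norm \<dots> \<le> norm (A *v axis l 1)" by (rule Finite_Cartesian_Product.norm_nth_le)
  also have "\<dots> \<le> onorm (\<lambda>v. A *v v) * norm (axis l 1 :: complex^'n)"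
    by (rule onorm) (rule matrix_vector_mul_bounded_linear)
  also have "norm (axis l 1 :: complex^'n) = 1"
    by (simp add: norm_vec_def L2_set_def axis_def if_distrib[of norm] if_distrib[of "\<lambda>x. x ^ 2"] cong: if_cong)
  finally show ?thesis by simp
qed

definition derivative_bound :: "nat \<Rightarrow> ('n::finite multi_index \<Rightarrow> real) \<Rightarrow> real" where
  "derivative_bound n A = (\<Sum>\<alpha> | mi_order \<alpha> \<le> n. \<bar>A \<alpha>\<bar>)"

lemma derivative_bound: "mi_order \<alpha> \<le> n \<Longrightarrow> A \<alpha> \<le> derivative_bound n A"
  unfolding derivative_bound_def
  by (rule order_trans[OF abs_ge_self member_le_sum[OF _ _ finite_mi_order]]) auto

lemma derivative_bound_nonneg: "0 \<le> derivative_bound n A"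
  by (simp add: derivative_bound_def sum_nonneg)

text \<open>Expresses that only finitely many of the constants enter.\<close>

lemma derivative_bound_restrict:
  "derivative_bound n (restrict A {\<alpha>. mi_order \<alpha> \<le> n}) = derivative_bound n A"
  unfolding derivative_bound_def by (intro sum.cong) auto

text \<open>The denominator makes \<open>4 \<epsilon> d\<^sup>4 B A\<close> at most 1.  In \<open>stationary_phase_data_fixed\<close> the field \<open>W x\<close>
contributes \<open>d B\<close>, the gradient of the remainder \<open>d\<^sup>2 A\<close> and the sum over the coordinates \<open>d\<close>; of
the factor 4, one half provides the room between the radii \<open>\<epsilon> h\<^sup>\<rho>\<close> and \<open>2 \<epsilon> h\<^sup>\<rho>\<close>, the other
half the factor 1/2 in the last assumption of \<open>stationary_data\<close>.  The summand 1 gives \<open>4 \<epsilon> \<le> 1\<close>.  Only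
derivatives of the phase up to order three are involved, so the size does not depend on the order
of the expansion.\<close>

definition support_size :: "('n::finite multi_index \<Rightarrow> real) \<Rightarrow> real \<Rightarrow> real" where
  "support_size A B = 1 / (4 * (1 + real CARD('n) ^ 4 * \<bar>B\<bar> * derivative_bound 3 A))"

lemma support_size_pos: "support_size A B > 0"
  using derivative_bound_nonneg[of 3 A] by (simp add: support_size_def add_pos_nonneg)

lemma stationary_phase_data_fixed:
  fixes \<phi> u :: "real \<Rightarrow> real^'n::finite \<Rightarrow> complex"
  assumes data: "stationary_phase_data \<mu> \<nu> \<sigma> A B C \<epsilon> \<phi> u" and exps: "0 \<le> \<mu>" "0 \<le> \<nu>" "0 \<le> \<sigma>" "\<rho> = \<sigma> + \<nu> + \<mu>"
    and \<epsilon>: "0 < \<epsilon>" "\<epsilon> \<le> support_size A B" and n: "3 \<le> n" and h: "h \<in> {0<..1}"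
  shows "stationary_data n (derivative_bound n A) \<bar>B\<bar> (derivative_bound n C) \<mu> \<nu> \<sigma> \<rho> h (2 * \<epsilon> * h powr \<rho>) (\<phi> h) (u h)"
proof -
  have h': "0 < h" "h \<le> 1" using h by auto
  have sm: "smooth (\<phi> h)" "smooth (u h)" and crit: "\<And>k. partial_deriv k (\<phi> h) 0 = 0"
    and im: "\<And>x. x \<in> supp (u h) \<Longrightarrow> 0 \<le> Im (\<phi> h x)" "Im (\<phi> h 0) = 0"
    using data h by (auto simp: stationary_phase_data_def)
  have pb: "norm (iter_partial ks (\<phi> h) x) \<le> A (count_list ks) * h powr (- \<mu> - \<nu> * (real (length ks) - 2))" if "2 \<le> length ks" for ks x
    using data h that unfolding stationary_phase_data_def phase_bounds_def
    by (metis mi_order_count_list mi_partial_eq_iter[OF sm(1)])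
  have ub: "norm (iter_partial ks (u h) x) \<le> C (count_list ks) * h powr (- \<rho> * real (length ks))" for ks x
    using data h unfolding stationary_phase_data_def amplitude_bounds_def exps(4)
    by (metis mi_order_count_list mi_partial_eq_iter[OF sm(2)])
  have inv: "invertible (hessian (\<phi> h) 0)" and on: "onorm (\<lambda>v. matrix_inv (hessian (\<phi> h) 0) *v v) \<le> B * h powr - \<sigma>"
    and su: "supp (u h) \<subseteq> {x. norm x \<le> \<epsilon> * h powr \<rho>}"
    using data h by (auto simp: stationary_phase_data_def phase_bounds_def amplitude_bounds_def exps(4))
  have pb': "norm (iter_partial ks (\<phi> h) x) \<le> derivative_bound j A * h powr (- \<mu> - \<nu> * (real (length ks) - 2))"
    if "2 \<le> length ks" "length ks \<le> j" for ks x j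
    by (rule order_trans[OF pb[OF that(1)]])
       (use that in \<open>auto intro!: mult_right_mono derivative_bound simp: mi_order_count_list\<close>)
  have Wb: "norm (matrix_inv (hessian (\<phi> h) 0) $ k $ l) \<le> \<bar>B\<bar> * h powr - \<sigma>" for k l
    by (rule order_trans[OF norm_entry_le_onorm order_trans[OF on]]) (auto intro: mult_right_mono)
  interpret critical_phase "\<phi> h" by unfold_locales (rule sm crit)+
  let ?r = "h powr \<rho>" and ?A = "derivative_bound 3 A" and ?d = "real CARD('n)"
  have A0: "?A \<ge> 0" by (rule derivative_bound_nonneg)
  have \<epsilon>1: "\<epsilon> * (4 * (1 + ?d ^ 4 * \<bar>B\<bar> * ?A)) \<le> 1"
    using \<epsilon>(2) A0 by (simp add: support_size_def pos_le_divide_eq add_pos_nonneg)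
  have "\<epsilon> * 4 * (?d ^ 4 * \<bar>B\<bar> * ?A) \<ge> 0" using \<epsilon>(1) A0 by simp
  then have \<epsilon>2: "4 * \<epsilon> \<le> 1" and \<epsilon>3: "4 * \<epsilon> * (?d ^ 4 * \<bar>B\<bar> * ?A) \<le> 1"
    using \<epsilon>1 \<epsilon>(1) by (auto simp: algebra_simps)
  show ?thesis
  proof
    show "0 < 2 * \<epsilon> * ?r" using \<epsilon> h' by simp
    show "2 * \<epsilon> * ?r \<le> ?r" using \<epsilon>2 \<epsilon>(1) by (intro mult_left_le_one_le) auto
    show "supp (u h) \<subseteq> ball 0 (2 * \<epsilon> * ?r)"
    proof
      fix x assume "x \<in> supp (u h)"
      then have "norm x \<le> \<epsilon> * ?r" using su by auto
      also have "\<dots> < 2 * \<epsilon> * ?r" using \<epsilon> h' by simp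
      finally show "x \<in> ball 0 (2 * \<epsilon> * ?r)" by simp
    qed
    show "norm (iter_partial ks (\<phi> h) x) \<le> derivative_bound n A * h powr (- \<mu> - \<nu> * (real (length ks) - 2))"
      if "2 \<le> length ks" "length ks \<le> n" for ks x using pb'[OF that] .
    show "norm (iter_partial ks (u h) x) \<le> derivative_bound n C * h powr (- \<rho> * real (length ks))" if "length ks \<le> n" for ks x
      by (rule order_trans[OF ub]) (use that in \<open>auto intro!: mult_right_mono derivative_bound simp: mi_order_count_list\<close>)
    fix x :: "real^'n" assume x: "x \<in> ball 0 (2 * \<epsilon> * ?r)"
    let ?W = "matrix_inv (hessian (\<phi> h) 0)"
    let ?G = "?A * h powr (- \<mu> - \<nu>)"
    \<comment> \<open>the third derivatives are bounded with \<open>derivative_bound 3 A\<close>, so that the size of \<open>\<epsilon>\<close> does not depend on \<open>n\<close>\<close>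
    have grad: "norm (partial_deriv k g x) \<le> ?d ^ 2 * ?G * norm x ^ 2" for k
    proof -
      have "norm (iter_partial [k] g x) \<le> ?d ^ (3 - length [k]) * ?G * norm x ^ (3 - length [k])"
      proof (rule vanish_bound[OF remainder_smooth remainder_vanish])
        fix ks :: "'n list" and y assume "length ks = 3"
        then show "norm (iter_partial ks g y) \<le> ?G" using pb'[of ks 3 y] by (simp add: remainder_higher)
      qed auto
      then show ?thesis by (simp add: numeral_2_eq_2)
    qed
    have Wx: "norm (\<Sum>l\<in>UNIV. ?W $ l $ k * complex_of_real (x $ l)) \<le> ?d * (\<bar>B\<bar> * h powr - \<sigma>) * norm x" for k
    proof -
      have "norm (?W $ l $ k * complex_of_real (x $ l)) \<le> \<bar>B\<bar> * h powr - \<sigma> * norm x" for l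
        unfolding norm_mult using Wb component_le_norm_cart[of x l] by (intro mult_mono) auto
      then have "norm (\<Sum>l\<in>UNIV. ?W $ l $ k * complex_of_real (x $ l)) \<le> (\<Sum>l\<in>(UNIV::'n set). \<bar>B\<bar> * h powr - \<sigma> * norm x)"
        by (rule sum_norm_le)
      then show ?thesis by (simp add: mult.assoc)
    qed
    have "norm ((\<Sum>l\<in>UNIV. ?W $ l $ k * complex_of_real (x $ l)) * partial_deriv k g x)
      \<le> (?d * (\<bar>B\<bar> * h powr - \<sigma>) * norm x) * (?d ^ 2 * ?G * norm x ^ 2)" for k
      unfolding norm_mult by (intro mult_mono Wx grad) auto
    then have "norm (\<Sum>k\<in>UNIV. (\<Sum>l\<in>UNIV. ?W $ l $ k * complex_of_real (x $ l)) * partial_deriv k g x)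
      \<le> (\<Sum>k\<in>(UNIV::'n set). (?d * (\<bar>B\<bar> * h powr - \<sigma>) * norm x) * (?d ^ 2 * ?G * norm x ^ 2))"
      by (rule sum_norm_le)
    also have "\<dots> = (?d ^ 4 * \<bar>B\<bar> * ?A) * (h powr - \<sigma> * h powr (- \<mu> - \<nu>)) * (norm x * norm x ^ 2)"
      by (simp add: power4_eq_xxxx power2_eq_square mult_ac)
    also have "\<dots> \<le> (?d ^ 4 * \<bar>B\<bar> * ?A) * (h powr - \<sigma> * h powr (- \<mu> - \<nu>)) * ((2 * \<epsilon> * ?r) * norm x ^ 2)"
      using x A0 by (intro mult_left_mono mult_right_mono mult_nonneg_nonneg) auto
    also have "\<dots> = (4 * \<epsilon> * (?d ^ 4 * \<bar>B\<bar> * ?A)) * (h powr - \<sigma> * h powr (- \<mu> - \<nu>) * ?r) * (norm x ^ 2 / 2)" by simp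
    also have "h powr - \<sigma> * h powr (- \<mu> - \<nu>) * ?r = 1"
      unfolding powr_add[symmetric] exps(4) using h' by simp
    also have "(4 * \<epsilon> * (?d ^ 4 * \<bar>B\<bar> * ?A)) * 1 * (norm x ^ 2 / 2) \<le> 1 * (norm x ^ 2 / 2)"
      using \<epsilon>3 by (intro mult_right_mono) auto
    finally show "norm (\<Sum>k\<in>UNIV. (\<Sum>l\<in>UNIV. ?W $ l $ k * complex_of_real (x $ l)) * partial_deriv k g x) \<le> norm x ^ 2 / 2" by simp
  qed (use exps n h' sm crit im inv Wb in auto)
qed

theorem theorem1p1:
  shows "\<exists>\<epsilon>0 :: ('n::finite multi_index \<Rightarrow> real) \<Rightarrow> real \<Rightarrow> real.
    (\<forall>A B. \<epsilon>0 A B > 0) \<and>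
    (\<forall>\<mu> \<nu> \<sigma> \<rho> :: real. \<mu> \<ge> 0 \<and> \<nu> \<ge> 0 \<and> \<sigma> \<ge> 0 \<and> 1 > 5 * \<mu> + 6 * \<sigma> + 2 * \<nu> \<and> \<rho> = \<sigma> + \<nu> + \<mu> \<longrightarrow>
      (\<forall>N::nat. N \<ge> 1 \<longrightarrow>
        (\<exists>(F :: 'n multi_index set) K. finite F \<and>
          (\<forall>A B C \<epsilon> \<phi> u. 0 < \<epsilon> \<and> \<epsilon> \<le> \<epsilon>0 A B \<and> stationary_phase_data \<mu> \<nu> \<sigma> A B C \<epsilon> \<phi> u \<longrightarrow>
            (\<forall>h\<in>{0<..1}.
              norm (osc_integral h (\<phi> h) (u h)
                - of_real ((2 * pi * h) powr (real CARD('n) / 2))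
                  * (exp (\<i> / of_real h * \<phi> h 0) / det_sqrt (\<chi> k l. 1 / \<i> * hessian (\<phi> h) 0 $ k $ l))
                  * (\<Sum>j<N. of_real (h ^ j) * L_op (\<phi> h) j (u h) 0))
              \<le> K (restrict A F) B (restrict C F)
                * norm (1 / det_sqrt (\<chi> k l. 1 / \<i> * hessian (\<phi> h) 0 $ k $ l))
                * h powr ((1 - \<sigma> - 2 * \<rho>) * real N + real CARD('n) / 2))))) \<and>
      (\<forall>A B C. \<forall>j::nat. \<exists>K. \<forall>\<epsilon> \<phi> u.
        0 < \<epsilon> \<and> \<epsilon> \<le> \<epsilon>0 A B \<and> stationary_phase_data \<mu> \<nu> \<sigma> A B C \<epsilon> \<phi> u \<longrightarrow>
          (\<forall>h\<in>{0<..1}. norm (L_op (\<phi> h) j (u h) 0) \<le> K * h powr (- real j * (\<sigma> + 2 * \<rho>)))))"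
proof (intro exI[of _ support_size] conjI allI impI; (elim conjE)?)
  fix A :: "'n multi_index \<Rightarrow> real" and B
  show "support_size A B > 0" by (rule support_size_pos)
next
  fix \<mu> \<nu> \<sigma> \<rho> :: real and N :: nat
  assume e: "\<mu> \<ge> 0" "\<nu> \<ge> 0" "\<sigma> \<ge> 0" "1 > 5 * \<mu> + 6 * \<sigma> + 2 * \<nu>" "\<rho> = \<sigma> + \<nu> + \<mu>"
  then have "\<rho> \<le> 1" "0 < 1 - \<sigma> - 2 * \<rho>" by auto
  then obtain n K where n: "3 \<le> n" and K: "\<And>a b c h R (\<phi> :: real^'n \<Rightarrow> complex) u.
     stationary_data n a b c \<mu> \<nu> \<sigma> \<rho> h R \<phi> u \<Longrightarrow>
     norm (expansion_error N h \<phi> u) \<le> K a b c * norm (1 / det_sqrt (phase_matrix \<phi>)) * h powr ((1 - \<sigma> - 2 * \<rho>) * real N + real CARD('n) / 2)"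
    by (rule expansion_estimate[where N = N and \<mu> = \<mu> and \<nu> = \<nu> and 'n = 'n]) blast
  let ?F = "{\<alpha> :: 'n multi_index. mi_order \<alpha> \<le> n}"
  let ?K = "\<lambda>A B C. K (derivative_bound n A) \<bar>B\<bar> (derivative_bound n C)"
  show "\<exists>(F :: 'n multi_index set) K. finite F \<and>
          (\<forall>A B C \<epsilon> \<phi> u. 0 < \<epsilon> \<and> \<epsilon> \<le> support_size A B \<and> stationary_phase_data \<mu> \<nu> \<sigma> A B C \<epsilon> \<phi> u \<longrightarrow>
            (\<forall>h\<in>{0<..1}. norm (expansion_error N h (\<phi> h) (u h))
              \<le> K (restrict A F) B (restrict C F) * norm (1 / det_sqrt (phase_matrix (\<phi> h)))
                * h powr ((1 - \<sigma> - 2 * \<rho>) * real N + real CARD('n) / 2)))"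
  proof (intro exI[of _ ?F] exI[of _ ?K] conjI allI impI ballI finite_mi_order; elim conjE)
    fix A C :: "'n multi_index \<Rightarrow> real" and B \<epsilon> h :: real and \<phi> u :: "real \<Rightarrow> real^'n \<Rightarrow> complex"
    assume "0 < \<epsilon>" "\<epsilon> \<le> support_size A B" "stationary_phase_data \<mu> \<nu> \<sigma> A B C \<epsilon> \<phi> u" "h \<in> {0<..1}"
    then have "stationary_data n (derivative_bound n A) \<bar>B\<bar> (derivative_bound n C) \<mu> \<nu> \<sigma> \<rho> h (2 * \<epsilon> * h powr \<rho>) (\<phi> h) (u h)"
      by (intro stationary_phase_data_fixed e n)
    from K[OF this]
    show "norm (expansion_error N h (\<phi> h) (u h))
       \<le> ?K (restrict A ?F) B (restrict C ?F) * norm (1 / det_sqrt (phase_matrix (\<phi> h)))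
         * h powr ((1 - \<sigma> - 2 * \<rho>) * real N + real CARD('n) / 2)"
      by (simp only: derivative_bound_restrict)
  qed
next
  fix \<mu> \<nu> \<sigma> \<rho> :: real and A C :: "'n multi_index \<Rightarrow> real" and B :: real and j :: nat
  assume e: "\<mu> \<ge> 0" "\<nu> \<ge> 0" "\<sigma> \<ge> 0" "1 > 5 * \<mu> + 6 * \<sigma> + 2 * \<nu>" "\<rho> = \<sigma> + \<nu> + \<mu>"
  \<comment> \<open>the operator of index \<open>j\<close> involves \<open>6 * j\<close> derivatives; the summand 3 serves the locale\<close>
  define n where "n = 6 * j + 3"
  let ?K = "\<Sum>(l, m)\<in>index_set j. expansion_const CARD('n) n (derivative_bound n A) \<bar>B\<bar> (derivative_bound n C) l m"
  show "\<exists>K. \<forall>\<epsilon> \<phi> u. 0 < \<epsilon> \<and> \<epsilon> \<le> support_size A B \<and> stationary_phase_data \<mu> \<nu> \<sigma> A B C \<epsilon> \<phi> u \<longrightarrow>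
          (\<forall>h\<in>{0<..1}. norm (L_op (\<phi> h) j (u h) 0) \<le> K * h powr (- real j * (\<sigma> + 2 * \<rho>)))"
  proof (intro exI[of _ ?K] allI impI ballI; elim conjE)
    fix \<epsilon> h :: real and \<phi> u :: "real \<Rightarrow> real^'n \<Rightarrow> complex"
    assume "0 < \<epsilon>" "\<epsilon> \<le> support_size A B" "stationary_phase_data \<mu> \<nu> \<sigma> A B C \<epsilon> \<phi> u" "h \<in> {0<..1}"
    then have "stationary_data n (derivative_bound n A) \<bar>B\<bar> (derivative_bound n C) \<mu> \<nu> \<sigma> \<rho> h (2 * \<epsilon> * h powr \<rho>) (\<phi> h) (u h)"
      by (intro stationary_phase_data_fixed e) (auto simp: n_def)
    from stationary_data.L_op_bound[OF this, of j]
    show "norm (L_op (\<phi> h) j (u h) 0) \<le> ?K * h powr (- real j * (\<sigma> + 2 * \<rho>))" by (simp add: n_def)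
  qed
qed

end
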